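(* Let $A$ be a Noetherian integral domain and $p$ a prime ideal of $A$ such that $A_p$ is a rank-one discrete valuation ring. Let $G(A):=\bigoplus_{n\geq 0}p^{(n)}/p^{(n+1)}$ be the associated graded ring of $A$ with respect to the filtration $(p^{(n)})_n$. Let $u\in p$ be such that $pA_p=uA_p$, and let $v$ be the image of $u$ in $p/p^{(2)}$ (viewed as a degree-one element of $G(A)$). For each $n\geq 0$ let $E_n:=\{x\in A_p\mid xu^n\in A\}$ and let $F_n$ be the image of $E_n$ in $K:=A_p/pA_p$. Let $D:=\bigcup_{n\geq 0}F_n$ (a subring of $K$ containing $A/p$) and let $X$ be an indeterminate over $D$. Then: (1) $G(A)$ is a domain with $\dim(G(A))=1+\dim(A/p)$, and, provided $\dim(A/p)<\infty$, $G(A)$ is a Jaffard domain. (2) $\dim(G(A)/vG(A))=\dim(A/p)$ and $\dim(G(A)[v^{-1}])=\dim(D[X])$.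
   Context: For $n\ge 0$, $p^{(n)}:=p^nA_p\cap A$ is the $n$th symbolic power of $p$ (so $p^{(0)}=A$ and $p^{(1)}=p$). $\dim$ denotes Krull dimension. A finite-dimensional domain $S$ is Jaffard if $\dim(S[X_1,\ldots,X_n])=n+\dim(S)$ for all $n\geq 1$ or, equivalently, if $\dim(S)=\dim_v(S)$, where the valuative dimension $\dim_v(S)$ is the supremum of the dimensions of the valuation overrings of $S$. $G(A)[v^{-1}]$ is the localization of $G(A)$ at the powers of $v$. *)

theory Defs
  imports "HOL-Algebra.Algebra" "HOL-Library.Extended_Nat"
begin

section \<open>Krull dimension, discrete valuation rings, Jaffard domains\<close>

text \<open>
  The supremum of the lengths of chains of prime ideals.  By this definition the zero ring
  has dimension \<open>Sup {} = 0\<close>; all rings below to which it is applied are nonzero.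
\<close>

definition krull_dim :: "('a, 'm) ring_scheme \<Rightarrow> enat" where
  "krull_dim R = Sup {enat n | n. \<exists>P :: nat \<Rightarrow> 'a set.
      (\<forall>i\<le>n. primeideal (P i) R) \<and> (\<forall>i<n. P i \<subset> P (Suc i))}"

text \<open>A (rank-one) discrete valuation ring: a local principal ideal domain that is not a field.\<close>

definition dvr :: "('a, 'm) ring_scheme \<Rightarrow> bool" where
  "dvr R \<longleftrightarrow> principal_domain R \<and> \<not> field R \<and> (\<exists>!M. maximalideal M R)"

text \<open>
  The ring \<open>R[X\<^sub>0, \<dots>, X\<^sub>n\<^sub>-\<^sub>1]\<close>.  As in \<^theory>\<open>HOL-Algebra.Indexed_Polynomials\<close>, a monomial
  is a multiset of variable indices and a polynomial is its coefficient function.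
\<close>

definition mpoly_ring :: "('a, 'm) ring_scheme \<Rightarrow> nat \<Rightarrow> (nat multiset \<Rightarrow> 'a) ring" where
  "mpoly_ring R n = \<lparr>
     carrier = {f. (\<forall>m. f m \<in> carrier R) \<and> finite {m. f m \<noteq> \<zero>\<^bsub>R\<^esub>} \<and>
                   (\<forall>m. f m \<noteq> \<zero>\<^bsub>R\<^esub> \<longrightarrow> set_mset m \<subseteq> {..<n})},
     Group.monoid.mult = (\<lambda>f g m. \<Oplus>\<^bsub>R\<^esub>a \<in> {a. a \<subseteq># m}. f a \<otimes>\<^bsub>R\<^esub> g (m - a)),
     one = (\<lambda>m. if m = {#} then \<one>\<^bsub>R\<^esub> else \<zero>\<^bsub>R\<^esub>),
     Ring.ring.zero = (\<lambda>m. \<zero>\<^bsub>R\<^esub>),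
     add = (\<lambda>f g m. f m \<oplus>\<^bsub>R\<^esub> g m)\<rparr>"

definition jaffard_domain :: "('a, 'm) ring_scheme \<Rightarrow> bool" where
  "jaffard_domain S \<longleftrightarrow> domain S \<and> krull_dim S < \<infinity> \<and>
     (\<forall>n\<ge>1. krull_dim (mpoly_ring S n) = enat n + krull_dim S)"


section \<open>Localization\<close>

text \<open>
  \<open>S\<^sup>-\<^sup>1R\<close> for a multiplicatively closed set \<open>S\<close> containing \<open>\<one>\<close> in a commutative ring \<open>R\<close>: classes of
  pairs \<open>(a, s)\<close>, where \<open>a/s = b/t\<close> iff \<open>w a t = w b s\<close> for some \<open>w \<in> S\<close>.  The ring operations
  are taken over all representatives of the two arguments; since they respect the relation, each
  of these unions is the union of a single class.
\<close>

definition loc_rel :: "('a, 'm) ring_scheme \<Rightarrow> 'a set \<Rightarrow> (('a \<times> 'a) \<times> ('a \<times> 'a)) set" where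
  "loc_rel R S = {((a, s), (b, t)) | a s b t.
      a \<in> carrier R \<and> s \<in> S \<and> b \<in> carrier R \<and> t \<in> S \<and>
      (\<exists>w\<in>S. w \<otimes>\<^bsub>R\<^esub> (a \<otimes>\<^bsub>R\<^esub> t) = w \<otimes>\<^bsub>R\<^esub> (b \<otimes>\<^bsub>R\<^esub> s))}"

definition loc_frac :: "('a, 'm) ring_scheme \<Rightarrow> 'a set \<Rightarrow> 'a \<Rightarrow> 'a \<Rightarrow> ('a \<times> 'a) set" where
  "loc_frac R S a s = loc_rel R S `` {(a, s)}"

definition localization :: "('a, 'm) ring_scheme \<Rightarrow> 'a set \<Rightarrow> ('a \<times> 'a) set ring" where
  "localization R S = \<lparr>
     carrier = {loc_frac R S a s | a s. a \<in> carrier R \<and> s \<in> S},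
     Group.monoid.mult = (\<lambda>x y. \<Union>(a, s)\<in>x. \<Union>(b, t)\<in>y. loc_frac R S (a \<otimes>\<^bsub>R\<^esub> b) (s \<otimes>\<^bsub>R\<^esub> t)),
     one = loc_frac R S \<one>\<^bsub>R\<^esub> \<one>\<^bsub>R\<^esub>,
     Ring.ring.zero = loc_frac R S \<zero>\<^bsub>R\<^esub> \<one>\<^bsub>R\<^esub>,
     add = (\<lambda>x y. \<Union>(a, s)\<in>x. \<Union>(b, t)\<in>y.
              loc_frac R S ((a \<otimes>\<^bsub>R\<^esub> t) \<oplus>\<^bsub>R\<^esub> (b \<otimes>\<^bsub>R\<^esub> s)) (s \<otimes>\<^bsub>R\<^esub> t))\<rparr>"

definition powers :: "('a, 'm) ring_scheme \<Rightarrow> 'a \<Rightarrow> 'a set" where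
  "powers R v = {v [^]\<^bsub>R\<^esub> (k :: nat) | k. True}"

definition loc_at_prime :: "('a, 'm) ring_scheme \<Rightarrow> 'a set \<Rightarrow> ('a \<times> 'a) set ring" where
  "loc_at_prime A p = localization A (carrier A - p)"

definition to_loc_at_prime :: "('a, 'm) ring_scheme \<Rightarrow> 'a set \<Rightarrow> 'a \<Rightarrow> ('a \<times> 'a) set" where
  "to_loc_at_prime A p a = loc_frac A (carrier A - p) a \<one>\<^bsub>A\<^esub>"

definition extend_at_prime :: "('a, 'm) ring_scheme \<Rightarrow> 'a set \<Rightarrow> 'a set \<Rightarrow> ('a \<times> 'a) set set" where
  "extend_at_prime A p I = Idl\<^bsub>loc_at_prime A p\<^esub> (to_loc_at_prime A p ` I)"


section \<open>Symbolic powers and the associated graded ring\<close>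

definition symbolic_power :: "('a, 'm) ring_scheme \<Rightarrow> 'a set \<Rightarrow> nat \<Rightarrow> 'a set" where
  "symbolic_power A p n =
     {a \<in> carrier A. to_loc_at_prime A p a \<in> extend_at_prime A p (p [^]\<^bsub>ideals_set A\<^esub> n)}"

text \<open>
  The associated graded ring of a descending filtration \<open>I 0 = R, I 1, I 2, \<dots>\<close> by ideals with
  \<open>I i \<cdot> I j \<subseteq> I (i + j)\<close>.  An element is the family of its homogeneous components; the
  component of degree \<open>n\<close> is a coset of \<open>I (n + 1)\<close> in \<open>I n\<close>, so it lies in \<open>R Quot I (n + 1)\<close>,
  whose zero is \<open>I (n + 1)\<close>.
  The product of \<open>x + I (i + 1)\<close> and \<open>y + I (j + 1)\<close> is \<open>x y + I (i + j + 1)\<close>; in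
  \<open>graded_prod\<close> it is again written as a union over all representatives.
\<close>

definition graded_prod ::
    "('a, 'm) ring_scheme \<Rightarrow> (nat \<Rightarrow> 'a set) \<Rightarrow> nat \<Rightarrow> 'a set \<Rightarrow> 'a set \<Rightarrow> 'a set" where
  "graded_prod R I n B C = (\<Union>x\<in>B. \<Union>y\<in>C. I (Suc n) +>\<^bsub>R\<^esub> (x \<otimes>\<^bsub>R\<^esub> y))"

definition homogeneous_form ::
    "('a, 'm) ring_scheme \<Rightarrow> (nat \<Rightarrow> 'a set) \<Rightarrow> nat \<Rightarrow> 'a \<Rightarrow> (nat \<Rightarrow> 'a set)" where
  "homogeneous_form R I d a = (\<lambda>n. if n = d then I (Suc n) +>\<^bsub>R\<^esub> a else I (Suc n))"

definition assoc_graded :: "('a, 'm) ring_scheme \<Rightarrow> (nat \<Rightarrow> 'a set) \<Rightarrow> (nat \<Rightarrow> 'a set) ring" where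
  "assoc_graded R I = \<lparr>
     carrier = {f. (\<forall>n. \<exists>a\<in>I n. f n = I (Suc n) +>\<^bsub>R\<^esub> a) \<and> finite {n. f n \<noteq> I (Suc n)}},
     Group.monoid.mult = (\<lambda>f g n. \<Oplus>\<^bsub>R Quot I (Suc n)\<^esub>i \<in> {..n}. graded_prod R I n (f i) (g (n - i))),
     one = homogeneous_form R I 0 \<one>\<^bsub>R\<^esub>,
     Ring.ring.zero = (\<lambda>n. I (Suc n)),
     add = (\<lambda>f g n. f n \<oplus>\<^bsub>R Quot I (Suc n)\<^esub> g n)\<rparr>"

definition symbolic_graded :: "('a, 'm) ring_scheme \<Rightarrow> 'a set \<Rightarrow> (nat \<Rightarrow> 'a set) ring" where
  "symbolic_graded A p = assoc_graded A (symbolic_power A p)"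


section \<open>The residue field at \<open>p\<close> and its subring \<open>D\<close>\<close>

text \<open>
  \<open>A\<close> is identified with its image in the localization at \<open>p\<close>; thus \<open>E_set\<close> consists of the
  \<open>x\<close> with \<open>x u\<^sup>n \<in> A\<close>, \<open>F_set\<close> is its image in the residue field, and \<open>D\<close> is the union of the
  latter with the operations of the residue field.
\<close>

definition residue_field :: "('a, 'm) ring_scheme \<Rightarrow> 'a set \<Rightarrow> ('a \<times> 'a) set set ring" where
  "residue_field A p = loc_at_prime A p Quot extend_at_prime A p p"

definition E_set :: "('a, 'm) ring_scheme \<Rightarrow> 'a set \<Rightarrow> 'a \<Rightarrow> nat \<Rightarrow> ('a \<times> 'a) set set" where
  "E_set A p u n = {x \<in> carrier (loc_at_prime A p).
     x \<otimes>\<^bsub>loc_at_prime A p\<^esub> (to_loc_at_prime A p u [^]\<^bsub>loc_at_prime A p\<^esub> n)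
       \<in> to_loc_at_prime A p ` carrier A}"

definition F_set :: "('a, 'm) ring_scheme \<Rightarrow> 'a set \<Rightarrow> 'a \<Rightarrow> nat \<Rightarrow> ('a \<times> 'a) set set set" where
  "F_set A p u n = (\<lambda>x. extend_at_prime A p p +>\<^bsub>loc_at_prime A p\<^esub> x) ` E_set A p u n"

definition D_ring :: "('a, 'm) ring_scheme \<Rightarrow> 'a set \<Rightarrow> 'a \<Rightarrow> ('a \<times> 'a) set set ring" where
  "D_ring A p u = residue_field A p \<lparr>carrier := (\<Union>n. F_set A p u n)\<rparr>"

end

theory Submission
  imports Defs
begin

text \<open>
  Writing \<open>B = A/p\<close> and \<open>K\<close> for its fraction field, \<open>y \<mapsto> y/u\<^sup>n\<close> identifies
  \<open>p\<^sup>(\<^sup>n\<^sup>)/p\<^sup>(\<^sup>n\<^sup>+\<^sup>1\<^sup>)\<close> with \<open>F\<^sub>n \<subseteq> K\<close>, so that \<open>G\<close> becomes a ring between \<open>B[X]\<close> and \<open>D[X] \<subseteq> K[X]\<close>, with \<open>v\<close>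
  corresponding to \<open>X\<close> and \<open>G[v\<^sup>-\<^sup>1] = D[X, X\<^sup>-\<^sup>1]\<close>. A finite subset of \<open>G\<close> lies in a ring obtained from
  \<open>B[v]\<close> by adjoining finitely many elements of its fraction field. As \<open>B\<close> is Noetherian, adjoining an
  element raises the dimension by at most one, and not at all if the element is algebraic: if \<open>S\<close> is
  Noetherian then so is \<open>S[z]\<close>, a quotient of \<open>S[Z]\<close>, and \<open>dim S[Z] = dim S + 1\<close>, because by Krull's
  principal ideal theorem a chain of primes of \<open>S[Z]\<close> can be rearranged to pass through a given element of
  its last member. Since a chain of primes of length \<open>n\<close> is separated by \<open>n\<close> elements, these local bounds
  give \<open>dim G[Y\<^sub>1, \<dots>, Y\<^sub>n] \<le> n + 1 + dim B\<close>; the reverse inequality comes from the prime ideal \<open>G\<^sub>+ \<noteq> 0\<close>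
  of forms of positive degree, with \<open>G/G\<^sub>+ = B\<close>.
\<close>

text \<open>Nothing forces G or D to be Noetherian, so dimension theory reaches them only through
  Noetherian subrings that contain a given finite set. The relation that keeps an adjoined form z of
  degree n from costing a dimension is linear: s z = c v^n with s, c in B and s nonzero. No
  isomorphism between the localization of G at v and D[X, 1/X] is constructed. The Rees ring, the
  subring of A[X] whose X^n-coefficients lie in the n-th symbolic power, maps onto G and also into
  D[X], with the same kernel; the element u X goes to v and to X respectively. The second map is
  surjective up to powers of X. So the primes of G without v and the primes of D[X] without X both
  correspond to the primes of the Rees ring that contain the kernel and avoid u X. Chains of D[X]
  ending in a prime that contains X are moved away from X by a translation of the
  indeterminate.\<close>

definition prime_chain :: "('a, 'm) ring_scheme \<Rightarrow> (nat \<Rightarrow> 'a set) \<Rightarrow> nat \<Rightarrow> bool" where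
  "prime_chain R P n \<longleftrightarrow> (\<forall>i\<le>n. primeideal (P i) R) \<and> (\<forall>i<n. P i \<subset> P (Suc i))"

lemma prime_chain_Cons:
  assumes "prime_chain R P n" "primeideal I R" "I \<subset> P 0"
  shows "prime_chain R (case_nat I P) (Suc n)"
  using assms unfolding prime_chain_def by (auto split: nat.split)

section \<open>Ideals in Noetherian commutative rings\<close>

locale noetherian_cring = noetherian_ring + cring

lemma (in cring) ideal_intro:
  assumes "I \<subseteq> carrier R" "\<zero> \<in> I"
    and add: "\<And>a b. a \<in> I \<Longrightarrow> b \<in> I \<Longrightarrow> a \<oplus> b \<in> I"
    and mult: "\<And>a r. a \<in> I \<Longrightarrow> r \<in> carrier R \<Longrightarrow> r \<otimes> a \<in> I"
  shows "ideal I R"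
proof (rule idealI[OF ring_axioms])
  have "\<ominus> a \<in> I" if "a \<in> I" for a
    using mult[OF that, of "\<ominus> \<one>"] that assms(1) by (auto simp: l_minus subset_eq)
  then show "subgroup I (add_monoid R)"
    using assms by (intro add.subgroupI) (auto simp: a_inv_def)
  show "a \<otimes> x \<in> I" if "a \<in> I" "x \<in> carrier R" for a x
    using mult[OF that] that assms(1) by (metis m_comm subsetD)
qed (use mult in auto)

text \<open>By the ascending chain condition a nonempty chain of ideals contains its own union, so
  Zorn's lemma applies to an arbitrary nonempty family of ideals, closed under unions or
  not.\<close>

lemma (in noetherian_ring) exists_maximal_ideal:
  assumes "FF \<noteq> {}" "\<And>I. I \<in> FF \<Longrightarrow> ideal I R"
  shows "\<exists>M\<in>FF. \<forall>I\<in>FF. M \<subseteq> I \<longrightarrow> I = M"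
proof (rule subset_Zorn)
  fix C assume C: "subset.chain FF C"
  show "\<exists>U\<in>FF. \<forall>Y\<in>C. Y \<subseteq> U"
  proof (cases "C = {}")
    case False
    have "subset.chain {I. ideal I R} C"
      using C assms(2) unfolding pred_on.chain_def by auto
    then have "\<Union>C \<in> C"
      using ideal_chain_is_trivial False by auto
    then show ?thesis
      using C unfolding pred_on.chain_def by (metis Union_upper subsetD)
  qed (use assms(1) in auto)
qed

lemma (in noetherian_ring) ideal_sequence_stabilises:
  fixes J :: "nat \<Rightarrow> 'a set"
  assumes "\<And>n. ideal (J n) R" "mono J"
  shows "\<exists>N. \<forall>n\<ge>N. J n = J N"
proof -
  obtain N where N: "\<And>n. J N \<subseteq> J n \<Longrightarrow> J n = J N"
    using exists_maximal_ideal[of "range J"] assms(1) by auto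
  have "J n = J N" if "n \<ge> N" for n
    using N monoD[OF assms(2) that] by simp
  then show ?thesis by blast
qed

subsection \<open>Saturated ideals\<close>

text \<open>The ideals saturated with respect to a prime \<open>P\<close> are the contractions of the ideals of the
  localization at \<open>P\<close>; working with them avoids forming that localization.\<close>

definition saturated :: "('a, 'm) ring_scheme \<Rightarrow> 'a set \<Rightarrow> 'a set \<Rightarrow> bool" where
  "saturated R P J \<longleftrightarrow> ideal J R \<and>
     (\<forall>s\<in>carrier R - P. \<forall>r\<in>carrier R. s \<otimes>\<^bsub>R\<^esub> r \<in> J \<longrightarrow> r \<in> J)"

text \<open>The contraction to \<open>R\<close> of the ideal generated by \<open>J\<close> and
  \<open>a\<close> in the localization at \<open>P\<close>; the factor \<open>s\<close> clears
  denominators.\<close>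

definition saturated_adjoin :: "('a, 'm) ring_scheme \<Rightarrow> 'a set \<Rightarrow> 'a set \<Rightarrow> 'a \<Rightarrow> 'a set" where
  "saturated_adjoin R P J a = {r \<in> carrier R. \<exists>s\<in>carrier R - P. \<exists>j\<in>J. \<exists>c\<in>carrier R.
     s \<otimes>\<^bsub>R\<^esub> r = j \<oplus>\<^bsub>R\<^esub> c \<otimes>\<^bsub>R\<^esub> a}"

definition colon :: "('a, 'm) ring_scheme \<Rightarrow> 'a set \<Rightarrow> 'a \<Rightarrow> 'a set" where
  "colon R J a = {r \<in> carrier R. r \<otimes>\<^bsub>R\<^esub> a \<in> J}"

lemma saturatedD:
  assumes "saturated R P J" "s \<in> carrier R" "s \<notin> P" "r \<in> carrier R" "s \<otimes>\<^bsub>R\<^esub> r \<in> J"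
  shows "r \<in> J"
  using assms unfolding saturated_def by blast

context cring
begin

lemma ideal_closed:
  assumes "ideal I R"
  shows "\<zero> \<in> I" "a \<in> I \<Longrightarrow> a \<in> carrier R" "a \<in> I \<Longrightarrow> b \<in> I \<Longrightarrow> a \<oplus> b \<in> I"
    "a \<in> I \<Longrightarrow> b \<in> I \<Longrightarrow> a \<ominus> b \<in> I" "a \<in> I \<Longrightarrow> \<ominus> a \<in> I"
    "a \<in> I \<Longrightarrow> r \<in> carrier R \<Longrightarrow> r \<otimes> a \<in> I" "a \<in> I \<Longrightarrow> r \<in> carrier R \<Longrightarrow> a \<otimes> r \<in> I"
proof -
  interpret ideal I R by fact
  show "\<zero> \<in> I" "a \<in> I \<Longrightarrow> a \<in> carrier R" "a \<in> I \<Longrightarrow> b \<in> I \<Longrightarrow> a \<oplus> b \<in> I"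
    "a \<in> I \<Longrightarrow> b \<in> I \<Longrightarrow> a \<ominus> b \<in> I" "a \<in> I \<Longrightarrow> \<ominus> a \<in> I"
    "a \<in> I \<Longrightarrow> r \<in> carrier R \<Longrightarrow> r \<otimes> a \<in> I" "a \<in> I \<Longrightarrow> r \<in> carrier R \<Longrightarrow> a \<otimes> r \<in> I"
    by (auto simp: a_minus_def I_l_closed I_r_closed)
qed

lemma ideal_mem_cancel:
  assumes "ideal I R" "a \<oplus> b \<in> I" "a \<in> I" "b \<in> carrier R"
  shows "b \<in> I"
proof -
  have a: "a \<in> carrier R" using assms ideal_closed by blast
  have "(a \<oplus> b) \<ominus> a = b" using a assms(4) by algebra
  then show ?thesis using ideal_closed(4)[OF assms(1,2,3)] by simp
qed

lemma prime_mult_notin: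
  assumes "primeideal P R" "s \<in> carrier R" "t \<in> carrier R" "s \<notin> P" "t \<notin> P"
  shows "s \<otimes> t \<notin> P"
  using primeideal.I_prime[OF assms(1)] assms by blast

lemma prime_one_notin:
  assumes "primeideal P R" shows "\<one> \<notin> P"
  using primeideal.I_notcarr[OF assms] ideal.one_imp_carrier primeideal.axioms(1)[OF assms] by blast

lemma prime_pow_mem:
  assumes "primeideal P R" "x \<in> carrier R" "x [^] (n::nat) \<in> P"
  shows "x \<in> P"
  using assms(3)
proof (induction n)
  case 0 then show ?case using prime_one_notin[OF assms(1)] by simp
next
  case (Suc n)
  then show ?case using primeideal.I_prime[OF assms(1), of "x [^] n" x] assms(2) by auto
qed

lemma saturated_adjoin:
  assumes P: "primeideal P R" and J: "ideal J R" and a: "a \<in> carrier R"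
  shows "saturated R P (saturated_adjoin R P J a)" "J \<subseteq> saturated_adjoin R P J a"
    "a \<in> saturated_adjoin R P J a"
proof -
  note Jc = ideal_closed[OF J]
  have one: "\<one> \<in> carrier R - P" using prime_one_notin[OF P] by simp
  show JJ: "J \<subseteq> saturated_adjoin R P J a"
  proof
    fix j assume j: "j \<in> J"
    have "\<one> \<otimes> j = j \<oplus> \<zero> \<otimes> a" using Jc(2)[OF j] a by simp
    then show "j \<in> saturated_adjoin R P J a"
      using one j Jc(2)[OF j] unfolding saturated_adjoin_def by blast
  qed
  have "\<one> \<otimes> a = \<zero> \<oplus> \<one> \<otimes> a" using a by simp
  then show "a \<in> saturated_adjoin R P J a"
    using one a Jc(1) unfolding saturated_adjoin_def by blast
  show "saturated R P (saturated_adjoin R P J a)"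
    unfolding saturated_def
  proof (intro conjI ballI impI)
    show "ideal (saturated_adjoin R P J a) R"
    proof (rule ideal_intro)
      fix x y assume "x \<in> saturated_adjoin R P J a" "y \<in> saturated_adjoin R P J a"
      then obtain s j c t k d where h: "x \<in> carrier R" "y \<in> carrier R" "s \<in> carrier R - P" "j \<in> J"
        "c \<in> carrier R" "s \<otimes> x = j \<oplus> c \<otimes> a" "t \<in> carrier R - P" "k \<in> J"
        "d \<in> carrier R" "t \<otimes> y = k \<oplus> d \<otimes> a"
        unfolding saturated_adjoin_def by blast
      have cc: "j \<in> carrier R" "k \<in> carrier R" "s \<in> carrier R" "t \<in> carrier R" using h Jc by auto
      have "(s \<otimes> t) \<otimes> (x \<oplus> y) = t \<otimes> (s \<otimes> x) \<oplus> s \<otimes> (t \<otimes> y)"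
        using h(1,2) cc by algebra
      also have "\<dots> = (t \<otimes> j \<oplus> s \<otimes> k) \<oplus> (t \<otimes> c \<oplus> s \<otimes> d) \<otimes> a"
        unfolding h using h a cc by algebra
      finally have "(s \<otimes> t) \<otimes> (x \<oplus> y) = (t \<otimes> j \<oplus> s \<otimes> k) \<oplus> (t \<otimes> c \<oplus> s \<otimes> d) \<otimes> a" .
      moreover have "s \<otimes> t \<in> carrier R - P" using prime_mult_notin[OF P] h by auto
      moreover have "t \<otimes> j \<oplus> s \<otimes> k \<in> J" using h Jc by auto
      moreover have "t \<otimes> c \<oplus> s \<otimes> d \<in> carrier R" "x \<oplus> y \<in> carrier R" using h by auto
      ultimately show "x \<oplus> y \<in> saturated_adjoin R P J a" unfolding saturated_adjoin_def by blast
    next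
      fix x r assume "x \<in> saturated_adjoin R P J a" and r: "r \<in> carrier R"
      then obtain s j c where h: "x \<in> carrier R" "s \<in> carrier R - P" "j \<in> J"
        "c \<in> carrier R" "s \<otimes> x = j \<oplus> c \<otimes> a"
        unfolding saturated_adjoin_def by blast
      have cc: "j \<in> carrier R" using h Jc by auto
      have "s \<otimes> (r \<otimes> x) = r \<otimes> (s \<otimes> x)" using h r by (simp add: m_ac)
      also have "\<dots> = r \<otimes> j \<oplus> (r \<otimes> c) \<otimes> a" unfolding h using h a r cc by algebra
      finally have "s \<otimes> (r \<otimes> x) = r \<otimes> j \<oplus> (r \<otimes> c) \<otimes> a" .
      moreover have "r \<otimes> j \<in> J" "r \<otimes> c \<in> carrier R" "r \<otimes> x \<in> carrier R" using h r Jc by auto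
      ultimately show "r \<otimes> x \<in> saturated_adjoin R P J a"
        using h(2) unfolding saturated_adjoin_def by blast
    next
      show "\<zero> \<in> saturated_adjoin R P J a" using JJ Jc(1) by blast
    qed (auto simp: saturated_adjoin_def)
    fix s r assume s: "s \<in> carrier R - P" and r: "r \<in> carrier R"
      and "s \<otimes> r \<in> saturated_adjoin R P J a"
    then obtain t j c where h: "t \<in> carrier R - P" "j \<in> J"
        "c \<in> carrier R" "t \<otimes> (s \<otimes> r) = j \<oplus> c \<otimes> a"
      unfolding saturated_adjoin_def by blast
    have "(t \<otimes> s) \<otimes> r = j \<oplus> c \<otimes> a" using h s r by (simp add: m_assoc)
    moreover have "t \<otimes> s \<in> carrier R - P" using prime_mult_notin[OF P] h s by auto
    ultimately show "r \<in> saturated_adjoin R P J a"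
      using h r unfolding saturated_adjoin_def by blast
  qed
qed

lemma ideal_colon:
  assumes J: "ideal J R" and a: "a \<in> carrier R"
  shows "ideal (colon R J a) R" "J \<subseteq> colon R J a"
  using ideal_closed[OF J] a
  by (auto intro!: ideal_intro simp: colon_def l_distr m_assoc)

lemma saturated_colon:
  assumes J: "saturated R P J" and a: "a \<in> carrier R"
  shows "saturated R P (colon R J a)"
  using J ideal_colon[of J a] a by (auto simp: saturated_def colon_def m_assoc)

text \<open>Elements outside \<open>P\<close> become units in the localization, and an ideal
  containing a unit is everything.\<close>

lemma saturated_carrier_iff:
  assumes "saturated R P J" "s \<in> J" "s \<notin> P"
  shows "J = carrier R"
proof -
  note Jc = ideal_closed[of J] and J = assms(1)[unfolded saturated_def, THEN conjunct1]
  have "\<And>r. r \<in> carrier R \<Longrightarrow> s \<otimes> r \<in> J" "s \<in> carrier R" using J assms(2) Jc by auto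
  then have "carrier R \<subseteq> J" using assms unfolding saturated_def by blast
  then show ?thesis using Jc(2)[OF J] by auto
qed

text \<open>The content of the exact sequence 0 -> R/(L : a) -> R/L -> R/(L + (a)) -> 0, without
  lengths. For m in \<open>M\<close> some multiple s m equals l + r a with l in \<open>L\<close>;
  then r a lies in \<open>M\<close>, so r lies in the common colon ideal and r a lies already in
  \<open>L\<close>.\<close>

lemma saturated_modular:
  assumes P: "primeideal P R" and L: "saturated R P L" "saturated R P M" "L \<subseteq> M"
    and a: "a \<in> carrier R"
    and e: "saturated_adjoin R P L a = saturated_adjoin R P M a" "colon R L a = colon R M a"
  shows "L = M"
proof -
  have i: "ideal L R" "ideal M R" using L unfolding saturated_def by auto
  note Lc = ideal_closed[OF i(1)] and Mc = ideal_closed[OF i(2)]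
  have "m \<in> L" if m: "m \<in> M" for m
  proof -
    have "m \<in> saturated_adjoin R P L a" using saturated_adjoin(2)[OF P i(2) a] m e by auto
    then obtain s l r where h: "s \<in> carrier R - P" "l \<in> L" "r \<in> carrier R" "s \<otimes> m = l \<oplus> r \<otimes> a"
      unfolding saturated_adjoin_def by blast
    have "l \<oplus> r \<otimes> a \<in> M" using h(1,4) m Mc(6)[of m s] by auto
    then have "r \<otimes> a \<in> M" using ideal_mem_cancel[OF i(2), of l "r \<otimes> a"] h a L(3) by auto
    then have "r \<in> colon R L a" unfolding e(2) using h by (auto simp: colon_def)
    then have "s \<otimes> m \<in> L" using h Lc by (auto simp: colon_def)
    then show ?thesis using L(1) h(1) m Mc unfolding saturated_def by blast
  qed
  then show ?thesis using L(3) by auto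
qed

end

lemma (in cring) saturated_adjoin_mono:
  assumes "J \<subseteq> K"
  shows "saturated_adjoin R P J a \<subseteq> saturated_adjoin R P K a"
  using assms unfolding saturated_adjoin_def by blast

text \<open>In the localization at \<open>P\<close>, the ideals below \<open>P\<close> containing \<open>x\<close> and \<open>Q\<close> satisfy the descending
  chain condition; a maximal counterexample \<open>J\<close> would be prime, hence equal to \<open>P\<close>.\<close>

lemma (in noetherian_cring) saturated_descending_chain:
  fixes L :: "nat \<Rightarrow> 'a set"
  assumes P: "primeideal P R" and x: "x \<in> carrier R"
    and min: "\<And>P'. primeideal P' R \<Longrightarrow> Q \<subseteq> P' \<Longrightarrow> x \<in> P' \<Longrightarrow> P' \<subseteq> P \<Longrightarrow> P' = P"
    and L: "\<And>n. saturated R P (L n)" "antimono L" "\<And>n. Q \<subseteq> L n" "\<And>n. x \<in> L n"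
  shows "\<exists>N. \<forall>n\<ge>N. L n = L N"
proof (rule ccontr)
  assume L0: "\<not> ?thesis"
  \<comment> \<open>The intersection of the given sequence is only one ideal below all its members.
    Allowing any ideal below some non-stationary sequence gives a family from which a maximal member
    can be taken.\<close>
  define bad where "bad J \<longleftrightarrow> ideal J R \<and> Q \<subseteq> J \<and> x \<in> J \<and>
    (\<exists>L :: nat \<Rightarrow> 'a set. (\<forall>n. saturated R P (L n) \<and> J \<subseteq> L n) \<and> antimono L \<and> \<not> (\<exists>N. \<forall>n\<ge>N. L n = L N))"
    for J
  have "ideal (\<Inter>n. L n) R"
    using L(1) i_Intersect[of "range L"] unfolding saturated_def by auto
  moreover have "\<forall>n. saturated R P (L n) \<and> (\<Inter>n. L n) \<subseteq> L n" using L(1) by blast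
  moreover have "Q \<subseteq> (\<Inter>n. L n)" "x \<in> (\<Inter>n. L n)" using L(3,4) by blast+
  ultimately have "bad (\<Inter>n. L n)"
    unfolding bad_def using L(2) L0 by blast
  then obtain J where J: "bad J" and Jmax: "\<And>I. bad I \<Longrightarrow> J \<subseteq> I \<Longrightarrow> I = J"
  proof -
    have "\<exists>J\<in>Collect bad. \<forall>I\<in>Collect bad. J \<subseteq> I \<longrightarrow> I = J"
    proof (rule exists_maximal_ideal)
      show "Collect bad \<noteq> {}" using \<open>bad (\<Inter>n. L n)\<close> by (metis Collect_empty_eq)
      show "ideal I R" if "I \<in> Collect bad" for I
        using that unfolding bad_def mem_Collect_eq by (elim conjE)
    qed
    then show thesis using that by (metis mem_Collect_eq)
  qed
  obtain M :: "nat \<Rightarrow> 'a set" where M: "\<And>n. saturated R P (M n)" "\<And>n. J \<subseteq> M n" "antimono M"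
      "\<not> (\<exists>N. \<forall>n\<ge>N. M n = M N)"
    using J unfolding bad_def by blast
  have Ji: "ideal J R" and QJ: "Q \<subseteq> J" "x \<in> J" using J unfolding bad_def by auto
  have Mi: "ideal (M n) R" for n using M(1) unfolding saturated_def by auto
  \<comment> \<open>Maximality of \<open>J\<close> in usable form: over an ideal strictly larger
    than \<open>J\<close>, descending sequences of saturated ideals do stabilise.\<close>
  have stab: "\<exists>N. \<forall>n\<ge>N. L' n = L' N"
    if I: "ideal I R" "J \<subset> I" and L': "\<And>n. saturated R P (L' n)" "\<And>n. I \<subseteq> L' n" "antimono L'"
    for I and L' :: "nat \<Rightarrow> 'a set"
  proof (rule ccontr)
    assume "\<not> ?thesis"
    then have "bad I" unfolding bad_def using I L' QJ by blast
    then show False using Jmax I by blast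
  qed
  have Jn: "carrier R \<noteq> J"
  proof
    assume "carrier R = J"
    then have "M n = carrier R" for n using M(2)[of n] ideal_closed(2)[OF Mi] by auto
    then show False using M(4) by auto
  qed
  have "primeideal J R"
  proof (rule primeidealI[OF Ji is_cring Jn], rule ccontr)
    fix a b assume ab: "a \<in> carrier R" "b \<in> carrier R" "a \<otimes> b \<in> J" "\<not> (a \<in> J \<or> b \<in> J)"
    \<comment> \<open>With \<open>a\<close> adjoined, the \<open>M n\<close> lie over
      \<open>I\<close>; the ideals \<open>(M n : a)\<close> lie over \<open>(J : a)\<close>, which
      contains \<open>b\<close>. Both lower bounds are strictly larger than \<open>J\<close>, so
      both sequences become constant, and by modularity so does \<open>M\<close>.\<close>
    define I where "I = saturated_adjoin R P J a"
    have I: "ideal I R" "J \<subset> I"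
      using saturated_adjoin[OF P Ji ab(1)] ab(4) unfolding saturated_def I_def by auto
    have "\<exists>N. \<forall>n\<ge>N. saturated_adjoin R P (M n) a = saturated_adjoin R P (M N) a"
    proof (rule stab[OF I])
      show "I \<subseteq> saturated_adjoin R P (M n) a" for n
        unfolding I_def by (rule saturated_adjoin_mono[OF M(2)])
      show "antimono (\<lambda>n. saturated_adjoin R P (M n) a)"
        using M(3) by (simp add: monotone_on_def saturated_adjoin_mono)
    qed (rule saturated_adjoin(1)[OF P Mi ab(1)])
    then obtain N where N: "\<And>n. n \<ge> N \<Longrightarrow> saturated_adjoin R P (M n) a = saturated_adjoin R P (M N) a"
      by blast
    have "b \<in> colon R J a" using ab by (auto simp: colon_def m_comm)
    then have I': "ideal (colon R J a) R" "J \<subset> colon R J a"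
      using ideal_colon[OF Ji ab(1)] ab(4) by auto
    have cm: "colon R I a \<subseteq> colon R K a" if "I \<subseteq> K" for I K
      using that unfolding colon_def by auto
    have "\<exists>N. \<forall>n\<ge>N. colon R (M n) a = colon R (M N) a"
    proof (rule stab[OF I'])
      show "colon R J a \<subseteq> colon R (M n) a" for n
        by (rule cm[OF M(2)])
      show "antimono (\<lambda>n. colon R (M n) a)"
        using M(3) by (simp add: monotone_on_def cm)
    qed (rule saturated_colon[OF M(1) ab(1)])
    then obtain N' where N': "\<And>n. n \<ge> N' \<Longrightarrow> colon R (M n) a = colon R (M N') a"
      by blast
    have "M n = M (max N N')" if n: "n \<ge> max N N'" for n
    proof (rule saturated_modular[OF P M(1) M(1) antimonoD[OF M(3) n] ab(1)])
      show "saturated_adjoin R P (M n) a = saturated_adjoin R P (M (max N N')) a"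
        using N[of n] N[of "max N N'"] n by simp
      show "colon R (M n) a = colon R (M (max N N')) a"
        using N'[of n] N'[of "max N N'"] n by simp
    qed
    then show False using M(4) by blast
  qed
  \<comment> \<open>If \<open>J\<close> is not inside \<open>P\<close>, every \<open>M n\<close>
    contains a unit of the localization. If it is, \<open>J = P\<close> by the assumed minimality,
    and the only saturated ideals containing \<open>P\<close> are \<open>P\<close> and
    \<open>carrier R\<close>. With two possible values a descending sequence stabilises.\<close>
  have "J = P" if "J \<subseteq> P"
    using min[OF \<open>primeideal J R\<close> QJ that] .
  then have cases: "M n = carrier R \<or> M n = P" for n
    using saturated_carrier_iff[OF M(1)] M(2)[of n] by (cases "J \<subseteq> P") (blast, blast)
  obtain N where N: "M N = P \<or> (\<forall>n. M n = carrier R)" using cases by blast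
  moreover have "M n = P" if "M N = P" "n \<ge> N" for n
    using cases[of n] antimonoD[OF M(3) that(2)] that(1) primeideal.I_notcarr[OF P]
      ideal_closed(2)[OF primeideal.axioms(1)[OF P]] by auto
  ultimately show False using M(4) by metis
qed

section \<open>Nakayama's lemma and Krull's principal ideal theorem\<close>

text \<open>If \<open>N\<close> were smaller than \<open>M\<close>, take a saturated
  \<open>K\<close> that is maximal among those containing \<open>N\<close> and strictly inside
  \<open>M\<close>. Then x M lies in \<open>K\<close>: if x a did not, adjoining it to
  \<open>K\<close> would give \<open>M\<close>, so s a = k + c x a for some s outside
  \<open>P\<close>; as \<open>x\<close> lies in \<open>P\<close>, the element s - c x is outside
  \<open>P\<close> too, a unit of the localization, and a would lie in \<open>K\<close>. But then M
  = N + x M lies in \<open>K\<close> after localization.\<close>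

lemma (in noetherian_cring) saturated_Nakayama:
  assumes P: "primeideal P R" and x: "x \<in> P" and N: "saturated R P N" "saturated R P M" "N \<subseteq> M"
    and gen: "\<And>m. m \<in> M \<Longrightarrow> \<exists>s\<in>carrier R - P. \<exists>n\<in>N. \<exists>m'\<in>M. s \<otimes> m = n \<oplus> x \<otimes> m'"
  shows "N = M"
proof (rule ccontr)
  assume NM: "N \<noteq> M"
  note Pc = ideal_closed[OF primeideal.axioms(1)[OF P]]
  obtain K where K: "saturated R P K" "N \<subseteq> K" "K \<subset> M"
    and Kmax: "\<And>I. saturated R P I \<Longrightarrow> K \<subseteq> I \<Longrightarrow> I \<subset> M \<Longrightarrow> I = K"
  proof -
    let ?F = "{I. saturated R P I \<and> N \<subseteq> I \<and> I \<subset> M}"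
    have "\<exists>K\<in>?F. \<forall>I\<in>?F. K \<subseteq> I \<longrightarrow> I = K"
      by (rule exists_maximal_ideal) (use N NM in \<open>auto simp: saturated_def\<close>)
    then obtain K where K: "K \<in> ?F" "\<forall>I\<in>?F. K \<subseteq> I \<longrightarrow> I = K" by (rule bexE)
    show thesis
    proof (rule that)
      fix I assume "saturated R P I" "K \<subseteq> I" "I \<subset> M"
      then show "I = K" using K(2)[rule_format, of I] K(1) by auto
    qed (use K(1) in simp_all)
  qed
  have Ki: "ideal K R" and Mi: "ideal M R" using K N unfolding saturated_def by auto
  note Kc = ideal_closed[OF Ki] and Mc = ideal_closed[OF Mi]
  have xm: "x \<otimes> a \<in> K" if a: "a \<in> M" for a
  proof (rule ccontr)
    assume xa: "x \<otimes> a \<notin> K"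
    have aR: "a \<in> carrier R" "x \<in> carrier R" "x \<otimes> a \<in> M" using a x Mc Pc by auto
    define I where "I = saturated_adjoin R P K (x \<otimes> a)"
    have I: "saturated R P I" "K \<subseteq> I" "x \<otimes> a \<in> I"
      using saturated_adjoin[OF P Ki, of "x \<otimes> a"] aR unfolding I_def by auto
    have "I \<subseteq> M"
    proof
      fix r assume "r \<in> I"
      then obtain s k c where h: "r \<in> carrier R" "s \<in> carrier R" "s \<notin> P" "k \<in> K" "c \<in> carrier R"
        "s \<otimes> r = k \<oplus> c \<otimes> (x \<otimes> a)" unfolding I_def saturated_adjoin_def by blast
      then have "s \<otimes> r \<in> M" using K aR Mc by auto
      then show "r \<in> M" using saturatedD[OF N(2)] h by blast
    qed
    then have "I = M" using Kmax[OF I(1,2)] I(3) xa by blast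
    then have "a \<in> I" using a by simp
    then obtain s k c where h: "s \<in> carrier R" "s \<notin> P" "k \<in> K" "c \<in> carrier R"
        "s \<otimes> a = k \<oplus> c \<otimes> (x \<otimes> a)" unfolding I_def saturated_adjoin_def by blast
    have kR: "k \<in> carrier R" using h Kc by auto
    have "(s \<ominus> c \<otimes> x) \<otimes> a = s \<otimes> a \<ominus> c \<otimes> (x \<otimes> a)" using h(1,4) aR by algebra
    also have "\<dots> = k" unfolding h using h(4) kR aR by algebra
    finally have "(s \<ominus> c \<otimes> x) \<otimes> a \<in> K" using h by simp
    moreover have "s \<ominus> c \<otimes> x \<notin> P"
    proof
      assume "s \<ominus> c \<otimes> x \<in> P"
      then have "(s \<ominus> c \<otimes> x) \<oplus> c \<otimes> x \<in> P"
        using Pc(3)[OF _ Pc(6)[OF x h(4)]] by simp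
      moreover have "(s \<ominus> c \<otimes> x) \<oplus> c \<otimes> x = s" using h(1,4) aR by algebra
      ultimately show False using h by simp
    qed
    ultimately have "a \<in> K" using saturatedD[OF K(1), of "s \<ominus> c \<otimes> x" a] h aR by auto
    then show False using xa Kc aR by auto
  qed
  have "M \<subseteq> K"
  proof
    fix m assume m: "m \<in> M"
    obtain s n m' where h: "s \<in> carrier R" "s \<notin> P" "n \<in> N" "m' \<in> M" "s \<otimes> m = n \<oplus> x \<otimes> m'"
      using gen[OF m] by blast
    then have "s \<otimes> m \<in> K" using K Kc xm[of m'] by auto
    then show "m \<in> K" using saturatedD[OF K(1)] h Mc(2)[OF m] by blast
  qed
  then show False using K by blast
qed

text \<open>A form of Krull's principal ideal theorem. In the localization at \<open>P\<close> of the domain \<open>R/Q\<^sub>0\<close>, put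
  \<open>I\<^sub>m = (y\<^sup>m : x\<^sup>\<infinity>)\<close> for \<open>y \<in> Q\<close> nonzero. The sequence \<open>I\<^sub>m + (x)\<close> stabilises, and as \<open>x\<close> is regular
  modulo \<open>I\<^sub>m\<close>, Nakayama gives \<open>I\<^sub>m = I\<^sub>m\<^sub>+\<^sub>1\<close>, whence \<open>y\<close> divides a power of \<open>x\<close>.\<close>

lemma (in noetherian_cring) no_prime_below_minimal_prime:
  assumes P: "primeideal P R" "primeideal Q R" "primeideal Q\<^sub>0 R" "Q\<^sub>0 \<subset> Q" "Q \<subset> P"
    and x: "x \<in> P"
    and min: "\<And>P'. primeideal P' R \<Longrightarrow> Q\<^sub>0 \<subseteq> P' \<Longrightarrow> x \<in> P' \<Longrightarrow> P' \<subseteq> P \<Longrightarrow> P' = P"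
  shows False
proof -
  note Pc = ideal_closed[OF primeideal.axioms(1)[OF P(1)]]
  note Qc = ideal_closed[OF primeideal.axioms(1)[OF P(2)]]
  note Oc = ideal_closed[OF primeideal.axioms(1)[OF P(3)]]
  have xQ: "x \<notin> Q" using min[of Q] P by blast
  have xR[simp]: "x \<in> carrier R" using x Pc by auto
  obtain y where y: "y \<in> Q" "y \<notin> Q\<^sub>0" using P(4) by blast
  have yR[simp]: "y \<in> carrier R" using y Qc by auto
  \<comment> \<open>The contraction of \<open>(y^m : x^\<infinity>)\<close> from the localization
    modulo \<open>Q\<^sub>0\<close>: \<open>s\<close> clears denominators, \<open>k\<close> is the
    exponent of the colon ideal, and \<open>q\<close> expresses the passage modulo
    \<open>Q\<^sub>0\<close>.\<close>
  define I where "I m = {r \<in> carrier R. \<exists>s\<in>carrier R - P. \<exists>k::nat. \<exists>c\<in>carrier R. \<exists>q\<in>Q\<^sub>0.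
     s \<otimes> x [^] k \<otimes> r = y [^] m \<otimes> c \<oplus> q}" for m :: nat
  have II: "r \<in> I m" if "r \<in> carrier R" "s \<in> carrier R" "s \<notin> P" "c \<in> carrier R" "q \<in> Q\<^sub>0"
      "s \<otimes> x [^] (k::nat) \<otimes> r = y [^] m \<otimes> c \<oplus> q" for r s c q k m
    using that unfolding I_def by blast
  have IE: thesis if "r \<in> I m" "\<And>s k c q. r \<in> carrier R \<Longrightarrow> s \<in> carrier R \<Longrightarrow> s \<notin> P \<Longrightarrow> c \<in> carrier R \<Longrightarrow>
     q \<in> Q\<^sub>0 \<Longrightarrow> q \<in> carrier R \<Longrightarrow> s \<otimes> x [^] (k::nat) \<otimes> r = y [^] m \<otimes> c \<oplus> q \<Longrightarrow> thesis" for r m thesis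
    using that Oc(2) unfolding I_def by blast
  have one: "\<one> \<notin> P" using prime_one_notin[OF P(1)] .
  have Iid: "ideal (I m) R" for m
  proof (rule ideal_intro)
    show "\<zero> \<in> I m" by (rule II[of \<zero> \<one> \<zero> \<zero> 0]) (use one Oc in auto)
  next
    fix a b assume "a \<in> I m" "b \<in> I m"
    obtain s k c q where a: "a \<in> carrier R" "s \<in> carrier R" "s \<notin> P" "c \<in> carrier R" "q \<in> Q\<^sub>0" "q \<in> carrier R"
      "s \<otimes> x [^] (k::nat) \<otimes> a = y [^] m \<otimes> c \<oplus> q" by (rule IE[OF \<open>a \<in> I m\<close>], rule that)
    obtain t l d p where b: "b \<in> carrier R" "t \<in> carrier R" "t \<notin> P" "d \<in> carrier R" "p \<in> Q\<^sub>0" "p \<in> carrier R"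
      "t \<otimes> x [^] (l::nat) \<otimes> b = y [^] m \<otimes> d \<oplus> p" by (rule IE[OF \<open>b \<in> I m\<close>], rule that)
    define Xa Za Ya where "Xa = x [^] k" and "Za = x [^] l" and "Ya = y [^] m"
    have c: "Xa \<in> carrier R" "Za \<in> carrier R" "Ya \<in> carrier R" unfolding Xa_def Za_def Ya_def by auto
    have "s \<otimes> t \<otimes> (Xa \<otimes> Za) \<otimes> (a \<oplus> b) = t \<otimes> Za \<otimes> (s \<otimes> Xa \<otimes> a) \<oplus> s \<otimes> Xa \<otimes> (t \<otimes> Za \<otimes> b)"
      using a(1,2) b(1,2) c by algebra
    also have "\<dots> = t \<otimes> Za \<otimes> (Ya \<otimes> c \<oplus> q) \<oplus> s \<otimes> Xa \<otimes> (Ya \<otimes> d \<oplus> p)"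
      using a(7) b(7) unfolding Xa_def Za_def Ya_def by simp
    also have "\<dots> = Ya \<otimes> (t \<otimes> Za \<otimes> c \<oplus> s \<otimes> Xa \<otimes> d) \<oplus> (t \<otimes> Za \<otimes> q \<oplus> s \<otimes> Xa \<otimes> p)"
      using a(2,4,6) b(2,4,6) c by algebra
    finally show "a \<oplus> b \<in> I m"
      using a b c prime_mult_notin[OF P(1), of s t] Oc
      by (intro II[of _ "s \<otimes> t" "t \<otimes> Za \<otimes> c \<oplus> s \<otimes> Xa \<otimes> d" "t \<otimes> Za \<otimes> q \<oplus> s \<otimes> Xa \<otimes> p" "k + l"])
        (auto simp: Xa_def Za_def Ya_def nat_pow_mult)
  next
    fix a r assume "a \<in> I m" and r: "r \<in> carrier R"
    obtain s k c q where a: "a \<in> carrier R" "s \<in> carrier R" "s \<notin> P" "c \<in> carrier R" "q \<in> Q\<^sub>0" "q \<in> carrier R"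
      "s \<otimes> x [^] (k::nat) \<otimes> a = y [^] m \<otimes> c \<oplus> q" by (rule IE[OF \<open>a \<in> I m\<close>], rule that)
    define Xa Ya where "Xa = x [^] k" and "Ya = y [^] m"
    have c: "Xa \<in> carrier R" "Ya \<in> carrier R" unfolding Xa_def Ya_def by auto
    have "s \<otimes> Xa \<otimes> (r \<otimes> a) = r \<otimes> (s \<otimes> Xa \<otimes> a)" using a(1,2) c r by algebra
    also have "\<dots> = r \<otimes> (Ya \<otimes> c \<oplus> q)" using a(7) unfolding Xa_def Ya_def by simp
    also have "\<dots> = Ya \<otimes> (r \<otimes> c) \<oplus> r \<otimes> q" using a(4,6) c r by algebra
    finally show "r \<otimes> a \<in> I m"
      using a c r Oc by (intro II[of _ s "r \<otimes> c" "r \<otimes> q" k]) (auto simp: Xa_def Ya_def)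
  qed (auto simp: I_def)
  note Ic = ideal_closed[OF Iid]
  have Isat: "saturated R P (I m)" for m
    unfolding saturated_def
  proof (intro conjI ballI impI Iid)
    fix t a assume t: "t \<in> carrier R - P" and aR: "a \<in> carrier R" and "t \<otimes> a \<in> I m"
    obtain s k c q where a: "s \<in> carrier R" "s \<notin> P" "c \<in> carrier R" "q \<in> Q\<^sub>0" "q \<in> carrier R"
      "s \<otimes> x [^] (k::nat) \<otimes> (t \<otimes> a) = y [^] m \<otimes> c \<oplus> q" by (rule IE[OF \<open>t \<otimes> a \<in> I m\<close>], rule that)
    have "(s \<otimes> t) \<otimes> x [^] k \<otimes> a = y [^] m \<otimes> c \<oplus> q" unfolding a(6)[symmetric]
      using a(1) t aR by (simp add: m_ac)
    then show "a \<in> I m"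
      using a t aR prime_mult_notin[OF P(1), of s t] by (intro II[of a "s \<otimes> t" c q k]) auto
  qed
  have Ix: "a \<in> I m" if aR: "a \<in> carrier R" and "x \<otimes> a \<in> I m" for a m
  proof -
    obtain s k c q where a: "s \<in> carrier R" "s \<notin> P" "c \<in> carrier R" "q \<in> Q\<^sub>0" "q \<in> carrier R"
      "s \<otimes> x [^] (k::nat) \<otimes> (x \<otimes> a) = y [^] m \<otimes> c \<oplus> q" by (rule IE[OF \<open>x \<otimes> a \<in> I m\<close>], rule that)
    have "s \<otimes> x [^] (Suc k) \<otimes> a = y [^] m \<otimes> c \<oplus> q" unfolding a(6)[symmetric]
      using a(1) aR by (simp add: m_ac)
    then show ?thesis
      using a aR by (intro II[of a s c q "Suc k"]) auto
  qed
  have Idec: "I (Suc m) \<subseteq> I m" for m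
  proof
    fix a assume "a \<in> I (Suc m)"
    obtain s k c q where a: "a \<in> carrier R" "s \<in> carrier R" "s \<notin> P" "c \<in> carrier R" "q \<in> Q\<^sub>0" "q \<in> carrier R"
      "s \<otimes> x [^] (k::nat) \<otimes> a = y [^] Suc m \<otimes> c \<oplus> q" by (rule IE[OF \<open>a \<in> I (Suc m)\<close>], rule that)
    then have "s \<otimes> x [^] k \<otimes> a = y [^] m \<otimes> (y \<otimes> c) \<oplus> q" by (simp add: m_assoc)
    then show "a \<in> I m"
      using a by (intro II[of a s "y \<otimes> c" q k]) auto
  qed
  define L where "L m = saturated_adjoin R P (I m) x" for m
  have L: "saturated R P (L m)" "I m \<subseteq> L m" "x \<in> L m" for m
    using saturated_adjoin[OF P(1) Iid xR] unfolding L_def by auto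
  have "antimono L"
    using Idec unfolding antimono_iff_le_Suc L_def by (auto intro!: saturated_adjoin_mono)
  moreover have "Q\<^sub>0 \<subseteq> I m" for m
  proof
    fix q assume q: "q \<in> Q\<^sub>0"
    show "q \<in> I m" by (rule II[of q \<one> \<zero> q 0]) (use one Oc q in auto)
  qed
  ultimately obtain N where N: "\<And>n. n \<ge> N \<Longrightarrow> L n = L N"
    using saturated_descending_chain[OF P(1) xR, of Q\<^sub>0 L] min L by blast
  \<comment> \<open>Stability of the sequence \<open>L\<close> writes s a as b + c x with b in
    \<open>I (Suc N)\<close>. Then c x lies in \<open>I N\<close>, and so does c, because x is
    regular modulo \<open>I N\<close>; this is the hypothesis of Nakayama's lemma.\<close>
  have "I (Suc N) = I N"
  proof (rule saturated_Nakayama[OF P(1) x Isat Isat Idec])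
    fix a assume aN: "a \<in> I N"
    then have "a \<in> L (Suc N)" using N[of "Suc N"] L by auto
    then obtain s b c where h: "a \<in> carrier R" "s \<in> carrier R" "s \<notin> P" "b \<in> I (Suc N)" "c \<in> carrier R"
      "s \<otimes> a = b \<oplus> c \<otimes> x" unfolding L_def saturated_adjoin_def by blast
    have "s \<otimes> a \<in> I N" using Ic(6)[OF aN h(2)] .
    then have "c \<otimes> x \<in> I N"
      using ideal_mem_cancel[OF Iid, of b "c \<otimes> x" N] h Idec by auto
    then have "c \<in> I N" using Ix[of c N] h by (simp add: m_comm)
    then show "\<exists>s\<in>carrier R - P. \<exists>n\<in>I (Suc N). \<exists>m'\<in>I N. s \<otimes> a = n \<oplus> x \<otimes> m'"
      using h m_comm[OF h(5) xR] by auto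
  qed
  moreover have "y [^] N \<in> I N" by (rule II[of _ \<one> \<one> \<zero> 0]) (use one Oc in auto)
  ultimately have yN: "y [^] N \<in> I (Suc N)" by simp
  \<comment> \<open>Cancelling y^N modulo \<open>Q\<^sub>0\<close> in this relation leaves s x^k - y
    c in \<open>Q\<^sub>0\<close>. As y lies in \<open>Q\<close>, so does s x^k, against s and x
    both being outside \<open>Q\<close>.\<close>
  obtain s k c q where h: "s \<in> carrier R" "s \<notin> P" "c \<in> carrier R" "q \<in> Q\<^sub>0" "q \<in> carrier R"
      "s \<otimes> x [^] (k::nat) \<otimes> y [^] N = y [^] Suc N \<otimes> c \<oplus> q" by (rule IE[OF yN], rule that)
  define Xa Ya where "Xa = x [^] k" and "Ya = y [^] N"
  have c: "Xa \<in> carrier R" "Ya \<in> carrier R" unfolding Xa_def Ya_def by auto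
  have "Ya \<otimes> (s \<otimes> Xa \<ominus> y \<otimes> c) = s \<otimes> Xa \<otimes> Ya \<ominus> Ya \<otimes> y \<otimes> c"
    using h(1,3) c yR by algebra
  also have "\<dots> = (Ya \<otimes> y \<otimes> c \<oplus> q) \<ominus> Ya \<otimes> y \<otimes> c" using h unfolding Xa_def Ya_def by simp
  also have "\<dots> = q" using h(3,5) c yR by algebra
  finally have "Ya \<otimes> (s \<otimes> Xa \<ominus> y \<otimes> c) \<in> Q\<^sub>0" using h by simp
  moreover have "Ya \<notin> Q\<^sub>0" using prime_pow_mem[OF P(3) yR] y unfolding Ya_def by auto
  ultimately have "s \<otimes> Xa \<ominus> y \<otimes> c \<in> Q"
    using primeideal.I_prime[OF P(3), of Ya "s \<otimes> Xa \<ominus> y \<otimes> c"] h c P(4) by auto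
  then have "(s \<otimes> Xa \<ominus> y \<otimes> c) \<oplus> y \<otimes> c \<in> Q" using Qc(3)[OF _ Qc(7)[OF y(1) h(3)]] by simp
  moreover have "(s \<otimes> Xa \<ominus> y \<otimes> c) \<oplus> y \<otimes> c = s \<otimes> Xa" using h(1,3) c yR by algebra
  ultimately have "s \<otimes> Xa \<in> Q" by simp
  then have "Xa \<in> Q" using primeideal.I_prime[OF P(2), of s Xa] h c P(5) by auto
  then show False using prime_pow_mem[OF P(2) xR] xQ unfolding Xa_def by auto
qed

text \<open>The element is carried downwards one prime at a time, with both ends fixed. If x lies in
  \<open>Q (Suc i)\<close> but not in \<open>Q j\<close>, the prime below \<open>Q i\<close>, then
  \<open>Q (Suc i)\<close> is not minimal over \<open>Q j\<close> and x, since \<open>Q i\<close>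
  sits strictly between; a smaller prime containing x replaces \<open>Q i\<close>. If x lies in
  \<open>Q j\<close>, it lies in \<open>Q i\<close> already.\<close>

lemma (in noetherian_cring) prime_chain_through_element:
  assumes "prime_chain R P n" "n \<ge> 1" "x \<in> P n" "x \<notin> P 0"
  shows "\<exists>Q. prime_chain R Q n \<and> Q 0 = P 0 \<and> Q n = P n \<and> x \<in> Q 1"
proof -
  have "\<exists>Q. prime_chain R Q n \<and> Q 0 = P 0 \<and> Q n = P n \<and> x \<in> Q (n - k)" if "k < n" for k
    using that
  proof (induction k)
    case 0
    then show ?case using assms by auto
  next
    case (Suc k)
    then obtain Q where Q: "prime_chain R Q n" "Q 0 = P 0" "Q n = P n" "x \<in> Q (n - k)" by auto
    define i where "i = n - Suc k"
    have i: "i \<ge> 1" "n - k = Suc i" "Suc i \<le> n" using Suc.prems unfolding i_def by auto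
    obtain j where j: "i = Suc j" using i(1) by (cases i) auto
    have pr: "primeideal (Q j) R" "primeideal (Q i) R" "primeideal (Q (Suc i)) R"
      "Q j \<subset> Q i" "Q i \<subset> Q (Suc i)" and x': "x \<in> Q (Suc i)"
      using Q i j unfolding prime_chain_def by auto
    have "\<exists>P'. primeideal P' R \<and> Q j \<subset> P' \<and> P' \<subset> Q (Suc i) \<and> x \<in> P'"
    proof (cases "x \<in> Q j")
      case False
      then show ?thesis
        using no_prime_below_minimal_prime[OF pr(3,2,1,4,5) x'] by blast
    qed (use pr in blast)
    then obtain P' where P': "primeideal P' R" "Q j \<subset> P'" "P' \<subset> Q (Suc i)" "x \<in> P'" by blast
    have "prime_chain R (Q(i := P')) n"
      unfolding prime_chain_def
    proof (intro conjI allI impI)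
      fix l assume "l < n"
      then show "(Q(i := P')) l \<subset> (Q(i := P')) (Suc l)"
        using Q(1) P' j i(2) unfolding prime_chain_def
        by (cases "l = i"; cases "Suc l = i") auto
    qed (use Q(1) P' in \<open>auto simp: prime_chain_def\<close>)
    moreover have "(Q(i := P')) 0 = P 0" "(Q(i := P')) n = P n" "x \<in> (Q(i := P')) i"
      using Q P' i by auto
    ultimately show ?case unfolding i_def by blast
  qed
  from this[of "n - 1"] show ?thesis using assms(2) by auto
qed

lemma (in cring) ideal_finsum_closed:
  assumes "ideal I R" "\<And>i. i \<in> A \<Longrightarrow> f i \<in> I"
  shows "finsum R f A \<in> I"
  using assms(2)
proof (induction A rule: infinite_finite_induct)
  case (insert x F)
  then have "f \<in> F \<rightarrow> carrier R" "f x \<in> carrier R" using ideal_closed(2)[OF assms(1)] by auto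
  then show ?case using insert ideal_closed(3)[OF assms(1)] by auto
qed (use ideal_closed(1)[OF assms(1)] in auto)

lemma (in ring_hom_cring) primeideal_vimage:
  assumes "primeideal Q S"
  shows "primeideal {r \<in> carrier R. h r \<in> Q} R"
proof (rule primeidealI[OF ring.ideal_vimage R.is_cring])
  interpret Q: primeideal Q S by fact
  show "ideal Q S" by (rule Q.is_ideal)
  show "carrier R \<noteq> {r \<in> carrier R. h r \<in> Q}"
    using S.prime_one_notin[OF assms] hom_one by (metis (no_types, lifting) R.one_closed mem_Collect_eq)
  show "a \<in> {r \<in> carrier R. h r \<in> Q} \<or> b \<in> {r \<in> carrier R. h r \<in> Q}"
    if "a \<in> carrier R" "b \<in> carrier R" "a \<otimes>\<^bsub>R\<^esub> b \<in> {r \<in> carrier R. h r \<in> Q}" for a b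
    using that Q.I_prime[of "h a" "h b"] by auto
qed

section \<open>Primes of a polynomial ring lying over a prime of the coefficient ring\<close>

context UP_cring
begin

abbreviation (input) cf :: "(nat \<Rightarrow> 'a) \<Rightarrow> nat \<Rightarrow> 'a" where "cf \<equiv> up_ring.coeff P"
abbreviation (input) mon :: "'a \<Rightarrow> nat \<Rightarrow> nat \<Rightarrow> 'a" where "mon \<equiv> up_ring.monom P"

text \<open>The extended ideal q R[X], described by coefficients so that no generators have to be
  handled.\<close>

definition coeff_ideal :: "'a set \<Rightarrow> (nat \<Rightarrow> 'a) set" where
  "coeff_ideal q = {f \<in> carrier P. \<forall>n. cf f n \<in> q}"

definition contraction :: "(nat \<Rightarrow> 'a) set \<Rightarrow> 'a set" where
  "contraction Q = {a \<in> carrier R. mon a 0 \<in> Q}"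

lemma const_ring_hom_cring: "ring_hom_cring R P (\<lambda>a. mon a 0)"
  by (intro ring_hom_cring.intro ring_hom_cring_axioms.intro R.is_cring P.is_cring const_ring_hom)

lemma primeideal_contraction:
  "primeideal Q P \<Longrightarrow> primeideal (contraction Q) R"
  unfolding contraction_def
  using ring_hom_cring.primeideal_vimage[OF const_ring_hom_cring] .

text \<open>Gauss's argument with lowest terms: if n and m are the first degrees in which the
  coefficients of f and g leave \<open>q\<close>, then in degree n + m every other summand of the
  product has a factor in \<open>q\<close>.\<close>

lemma primeideal_coeff_ideal:
  assumes q: "primeideal q R"
  shows "primeideal (coeff_ideal q) P"
proof (rule primeidealI[OF _ P.is_cring])
  have qi: "ideal q R" using primeideal.axioms(1)[OF q] .
  note qc = R.ideal_closed[OF qi]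
  show "ideal (coeff_ideal q) P"
  proof (rule P.ideal_intro)
    fix a r assume "a \<in> coeff_ideal q" "r \<in> carrier P"
    then show "r \<otimes>\<^bsub>P\<^esub> a \<in> coeff_ideal q"
      by (auto simp: coeff_ideal_def intro!: R.ideal_finsum_closed[OF qi] qc(6))
  qed (use qc in \<open>auto simp: coeff_ideal_def\<close>)
  have "\<one>\<^bsub>P\<^esub> \<notin> coeff_ideal q"
  proof
    assume "\<one>\<^bsub>P\<^esub> \<in> coeff_ideal q"
    then have "cf \<one>\<^bsub>P\<^esub> 0 \<in> q" unfolding coeff_ideal_def by blast
    then show False using R.prime_one_notin[OF q] by simp
  qed
  then show "carrier P \<noteq> coeff_ideal q" using P.one_closed by auto
  fix f g assume fg: "f \<in> carrier P" "g \<in> carrier P" "f \<otimes>\<^bsub>P\<^esub> g \<in> coeff_ideal q"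
  show "f \<in> coeff_ideal q \<or> g \<in> coeff_ideal q"
  proof (rule ccontr)
    assume "\<not> ?thesis"
    then have ex: "\<exists>n. cf f n \<notin> q" "\<exists>n. cf g n \<notin> q"
      using fg by (auto simp: coeff_ideal_def)
    define n m where "n = (LEAST n. cf f n \<notin> q)" and "m = (LEAST m. cf g m \<notin> q)"
    have n: "cf f n \<notin> q" "\<And>i. i < n \<Longrightarrow> cf f i \<in> q"
      and m: "cf g m \<notin> q" "\<And>i. i < m \<Longrightarrow> cf g i \<in> q"
      using LeastI_ex[OF ex(1)] LeastI_ex[OF ex(2)] not_less_Least
      unfolding n_def m_def by blast+
    let ?t = "\<lambda>i. cf f i \<otimes> cf g (n + m - i)"
    have t: "?t i \<in> carrier R" for i using fg by simp
    have e: "{..n + m} = insert n ({..n + m} - {n})" by auto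
    have "?t i \<in> q" if "i \<in> {..n + m} - {n}" for i
    proof (cases "i < n")
      case True
      then show ?thesis using n(2) qc(7) fg by auto
    next
      case False
      then have "n + m - i < m" using that by auto
      then show ?thesis using m(2) qc(6) fg by auto
    qed
    then have s: "finsum R ?t ({..n + m} - {n}) \<in> q"
      by (rule R.ideal_finsum_closed[OF qi])
    have "cf (f \<otimes>\<^bsub>P\<^esub> g) (n + m) = finsum R ?t (insert n ({..n + m} - {n}))"
      using fg by (simp only: coeff_mult e[symmetric])
    also have "\<dots> = ?t n \<oplus> finsum R ?t ({..n + m} - {n})"
      by (subst R.finsum_insert) (use t t[of n] in auto)
    also have "\<dots> = finsum R ?t ({..n + m} - {n}) \<oplus> ?t n"
      by (rule R.a_comm[OF t qc(2)[OF s]])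
    finally have "finsum R ?t ({..n + m} - {n}) \<oplus> ?t n \<in> q"
      using fg(3) unfolding coeff_ideal_def by (metis (no_types, lifting) mem_Collect_eq)
    then have "?t n \<in> q" by (rule R.ideal_mem_cancel[OF qi _ s t])
    then show False using primeideal.I_prime[OF q, of "cf f n" "cf g m"] n m fg by auto
  qed
qed

lemma coeff_ideal_contraction_subset:
  assumes Q: "ideal Q P"
  shows "coeff_ideal (contraction Q) \<subseteq> Q"
proof
  fix f assume f: "f \<in> coeff_ideal (contraction Q)"
  then have fP: "f \<in> carrier P" by (simp add: coeff_ideal_def)
  have "mon (cf f i) i \<in> Q" for i
  proof -
    have "mon (cf f i) 0 \<in> Q"
      using f by (auto simp: coeff_ideal_def contraction_def)
    then have "mon (cf f i) 0 \<otimes>\<^bsub>P\<^esub> mon \<one> i \<in> Q"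
      using P.ideal_closed(7)[OF Q] by simp
    then show ?thesis using monom_mult[of "cf f i" \<one> 0 i] fP by simp
  qed
  then have "(\<Oplus>\<^bsub>P\<^esub> i \<in> {..deg R f}. mon (cf f i) i) \<in> Q"
    by (intro P.ideal_finsum_closed[OF Q]) auto
  then show "f \<in> Q" using up_repr[OF fP] by simp
qed

text \<open>After inverting the constants outside the contraction q and reducing modulo q, one has
  polynomials over a field, where every ideal is principal; \<open>c\<close> is the denominator. The
  generator f has least degree among members of \<open>Q\<close> outside q R[X]. Its leading
  coefficient a is then outside q, so pseudo-division by f works with a power of a as
  \<open>c\<close>, and the remainder falls into q R[X] by minimality.\<close>

lemma fibre_generator:
  assumes Q: "primeideal Q P" and n: "\<not> Q \<subseteq> coeff_ideal (contraction Q)"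
  shows "\<exists>f\<in>Q - coeff_ideal (contraction Q). \<forall>g\<in>Q. \<exists>c\<in>carrier R - contraction Q.
    \<exists>h\<in>carrier P. \<exists>e\<in>coeff_ideal (contraction Q). mon c 0 \<otimes>\<^bsub>P\<^esub> g = f \<otimes>\<^bsub>P\<^esub> h \<oplus>\<^bsub>P\<^esub> e"
proof -
  let ?q = "contraction Q"
  have Qi: "ideal Q P" using primeideal.axioms(1)[OF Q] .
  have q: "primeideal ?q R" by (rule primeideal_contraction[OF Q])
  note Qc = P.ideal_closed[OF Qi]
    and qc = R.ideal_closed[OF primeideal.axioms(1)[OF q]]
    and Ec = P.ideal_closed[OF primeideal.axioms(1)[OF primeideal_coeff_ideal[OF q]]]
  have EQ: "coeff_ideal ?q \<subseteq> Q" by (rule coeff_ideal_contraction_subset[OF Qi])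
  obtain f where f: "f \<in> Q" "f \<notin> coeff_ideal ?q"
    and fmin: "\<And>g. g \<in> Q \<Longrightarrow> g \<notin> coeff_ideal ?q \<Longrightarrow> deg R f \<le> deg R g"
    using ex_has_least_nat[of "\<lambda>f. f \<in> Q \<and> f \<notin> coeff_ideal ?q" _ "deg R"] n by blast
  have fP: "f \<in> carrier P" using f Qc by auto
  define a where "a = cf f (deg R f)"
  have a: "a \<in> carrier R" using fP unfolding a_def by simp
  have aq: "a \<notin> ?q"
  proof
    assume "a \<in> ?q"
    then have m: "mon a (deg R f) \<in> coeff_ideal ?q"
      using a qc(1) by (auto simp: coeff_ideal_def)
    define g where "g = f \<ominus>\<^bsub>P\<^esub> mon a (deg R f)"
    have g: "g \<in> Q" "g \<in> carrier P" using f m EQ Qc a fP unfolding g_def by auto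
    have cg: "cf g k = \<zero>" if "k \<ge> deg R f" for k
      using that fP a deg_aboveD[of f k] unfolding g_def a_def
      by (cases "k = deg R f") (auto simp: R.minus_eq R.r_neg)
    have "g \<oplus>\<^bsub>P\<^esub> mon a (deg R f) = f"
      unfolding g_def using fP monom_closed[OF a] by algebra
    then have gE: "g \<notin> coeff_ideal ?q" using f m Ec(3) by metis
    then have "deg R f \<le> deg R g" using fmin g by auto
    \<comment> \<open>The subtraction is truncated, so the two degree bounds are contradictory only
      for positive degree; in degree 0 they leave g = 0, which lies in the extended ideal after
      all.\<close>
    moreover have "deg R g \<le> deg R f - 1" using cg g by (intro deg_aboveI) auto
    ultimately have "deg R f = 0" by simp
    then have "cf g k \<in> ?q" for k using cg qc(1) by simp
    then show False using gE g by (simp add: coeff_ideal_def)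
  qed
  have "f \<noteq> \<zero>\<^bsub>P\<^esub>" using f Ec by auto
  show ?thesis
  proof (intro bexI[of _ f] ballI)
    fix g assume g: "g \<in> Q"
    then have gP: "g \<in> carrier P" using Qc by auto
    obtain h r k where h: "h \<in> carrier P" "r \<in> carrier P"
      "a [^] (k::nat) \<odot>\<^bsub>P\<^esub> g = f \<otimes>\<^bsub>P\<^esub> h \<oplus>\<^bsub>P\<^esub> r" "r = \<zero>\<^bsub>P\<^esub> \<or> deg R r < deg R f"
      using long_div_theorem[OF fP gP \<open>f \<noteq> _\<close>] unfolding a_def by blast
    have e: "mon (a [^] k) 0 \<otimes>\<^bsub>P\<^esub> g = f \<otimes>\<^bsub>P\<^esub> h \<oplus>\<^bsub>P\<^esub> r"
      using h a gP by (simp add: monom_mult_is_smult)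
    then have "f \<otimes>\<^bsub>P\<^esub> h \<oplus>\<^bsub>P\<^esub> r \<in> Q" using Qc(6)[OF g, of "mon (a [^] k) 0"] a by simp
    then have "r \<in> Q" using P.ideal_mem_cancel[OF Qi _ Qc(7)[OF f(1) h(1)] h(2)] by simp
    then have "r \<in> coeff_ideal ?q" using fmin[of r] h(4) Ec(1) by (cases "r \<in> coeff_ideal ?q") auto
    moreover have "a [^] k \<in> carrier R - ?q" using R.prime_pow_mem[OF q a] aq a by auto
    ultimately show "\<exists>c\<in>carrier R - ?q. \<exists>h\<in>carrier P. \<exists>e\<in>coeff_ideal ?q.
        mon c 0 \<otimes>\<^bsub>P\<^esub> g = f \<otimes>\<^bsub>P\<^esub> h \<oplus>\<^bsub>P\<^esub> e"
      using e h by blast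
  qed (use f in auto)
qed

text \<open>Nonzero primes of a principal ideal domain are maximal. Over one prime of
  \<open>R\<close> a proper inclusion therefore starts at the zero ideal of the fibre, which is the
  extended prime. The proof compares generators f of \<open>Q\<close> and f' of
  \<open>Q'\<close>.\<close>

lemma fibre_lower:
  assumes Q: "primeideal Q P" "primeideal Q' P" "Q \<subset> Q'" "contraction Q' = contraction Q"
  shows "Q = coeff_ideal (contraction Q)"
proof (rule ccontr)
  let ?q = "contraction Q" let ?E = "coeff_ideal ?q"
  assume ne: "Q \<noteq> ?E"
  have i: "ideal Q P" "ideal Q' P" using Q primeideal.axioms(1) by auto
  have q: "primeideal ?q R" by (rule primeideal_contraction[OF Q(1)])
  have E: "primeideal ?E P" by (rule primeideal_coeff_ideal[OF q])
  note Qc = P.ideal_closed[OF i(1)] and Q'c = P.ideal_closed[OF i(2)]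
    and Ec = P.ideal_closed[OF primeideal.axioms(1)[OF E]]
  have EQ: "?E \<subseteq> Q" "?E \<subseteq> Q'" using coeff_ideal_contraction_subset[OF i(1)] Q(3) by auto
  have nQ': "\<not> Q' \<subseteq> ?E" using EQ Q(3) by blast
  obtain f where f: "f \<in> Q" "f \<notin> ?E" "\<And>g. g \<in> Q \<Longrightarrow> \<exists>c\<in>carrier R - ?q.
    \<exists>h\<in>carrier P. \<exists>e\<in>?E. mon c 0 \<otimes>\<^bsub>P\<^esub> g = f \<otimes>\<^bsub>P\<^esub> h \<oplus>\<^bsub>P\<^esub> e"
    using fibre_generator[OF Q(1)] ne EQ by blast
  obtain f' where f': "f' \<in> Q'" "f' \<notin> ?E" "\<And>g. g \<in> Q' \<Longrightarrow> \<exists>c\<in>carrier R - ?q.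
    \<exists>h\<in>carrier P. \<exists>e\<in>?E. mon c 0 \<otimes>\<^bsub>P\<^esub> g = f' \<otimes>\<^bsub>P\<^esub> h \<oplus>\<^bsub>P\<^esub> e"
    using fibre_generator[OF Q(2)] nQ' unfolding Q(4) by blast
  have fP: "f \<in> carrier P" "f' \<in> carrier P" using f f' Qc Q'c by auto
  have cQ: "mon c 0 \<notin> Q" if "c \<in> carrier R - ?q" for c
    using that by (auto simp: contraction_def)
  have "f' \<notin> Q"
  proof
    assume f'Q: "f' \<in> Q"
    have "g \<in> Q" if g: "g \<in> Q'" for g
    proof -
      obtain c h e where h: "c \<in> carrier R - ?q" "h \<in> carrier P" "e \<in> ?E"
        "mon c 0 \<otimes>\<^bsub>P\<^esub> g = f' \<otimes>\<^bsub>P\<^esub> h \<oplus>\<^bsub>P\<^esub> e" using f'(3)[OF g] by blast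
      have "mon c 0 \<otimes>\<^bsub>P\<^esub> g \<in> Q" unfolding h(4) using Qc(7)[OF f'Q h(2)] h(3) EQ Qc(3) by blast
      then show ?thesis
        using primeideal.I_prime[OF Q(1), of "mon c 0" g] cQ[OF h(1)] h(1) Q'c(2)[OF g] by auto
    qed
    then show False using Q(3) by blast
  qed
  obtain c h e where h: "c \<in> carrier R - ?q" "h \<in> carrier P" "e \<in> ?E"
    "mon c 0 \<otimes>\<^bsub>P\<^esub> f = f' \<otimes>\<^bsub>P\<^esub> h \<oplus>\<^bsub>P\<^esub> e" using f'(3)[of f] f(1) Q(3) by blast
  have eP: "e \<in> carrier P" using h Ec by auto
  have "e \<oplus>\<^bsub>P\<^esub> f' \<otimes>\<^bsub>P\<^esub> h \<in> Q"
    using Qc(6)[OF f(1), of "mon c 0"] h fP eP by (simp add: P.a_comm)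
  then have "f' \<otimes>\<^bsub>P\<^esub> h \<in> Q"
    using P.ideal_mem_cancel[OF i(1), of e] h EQ fP by auto
  then have hQ: "h \<in> Q" using primeideal.I_prime[OF Q(1) fP(2) h(2)] \<open>f' \<notin> Q\<close> by auto
  obtain d w e' where w: "d \<in> carrier R - ?q" "w \<in> carrier P" "e' \<in> ?E"
    "mon d 0 \<otimes>\<^bsub>P\<^esub> h = f \<otimes>\<^bsub>P\<^esub> w \<oplus>\<^bsub>P\<^esub> e'" using f(3)[OF hQ] by blast
  have eP': "e' \<in> carrier P" using w Ec by auto
  define C D where "C = mon c 0" and "D = mon d 0"
  have CD: "C \<in> carrier P" "D \<in> carrier P" "C \<notin> Q'" "D \<notin> Q'"
    using h w Q(4) unfolding C_def D_def by (auto simp: contraction_def)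
  \<comment> \<open>Up to constants outside the contraction and modulo the extended prime, f = f' h
    and h = f w. Eliminating h and cancelling f shows f' w to be such a constant, so f' would be a
    unit of the fibre.\<close>
  have "f \<otimes>\<^bsub>P\<^esub> (D \<otimes>\<^bsub>P\<^esub> C \<ominus>\<^bsub>P\<^esub> f' \<otimes>\<^bsub>P\<^esub> w)
      = D \<otimes>\<^bsub>P\<^esub> (C \<otimes>\<^bsub>P\<^esub> f) \<ominus>\<^bsub>P\<^esub> f' \<otimes>\<^bsub>P\<^esub> (f \<otimes>\<^bsub>P\<^esub> w)"
    using CD(1,2) fP w(2) by algebra
  also have "\<dots> = D \<otimes>\<^bsub>P\<^esub> (f' \<otimes>\<^bsub>P\<^esub> h \<oplus>\<^bsub>P\<^esub> e) \<ominus>\<^bsub>P\<^esub> f' \<otimes>\<^bsub>P\<^esub> (f \<otimes>\<^bsub>P\<^esub> w)"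
    using h(4) unfolding C_def by simp
  also have "\<dots> = f' \<otimes>\<^bsub>P\<^esub> (D \<otimes>\<^bsub>P\<^esub> h) \<oplus>\<^bsub>P\<^esub> D \<otimes>\<^bsub>P\<^esub> e \<ominus>\<^bsub>P\<^esub> f' \<otimes>\<^bsub>P\<^esub> (f \<otimes>\<^bsub>P\<^esub> w)"
    using CD(1,2) fP w(2) h(2) eP by algebra
  also have "\<dots> = f' \<otimes>\<^bsub>P\<^esub> (f \<otimes>\<^bsub>P\<^esub> w \<oplus>\<^bsub>P\<^esub> e') \<oplus>\<^bsub>P\<^esub> D \<otimes>\<^bsub>P\<^esub> e \<ominus>\<^bsub>P\<^esub> f' \<otimes>\<^bsub>P\<^esub> (f \<otimes>\<^bsub>P\<^esub> w)"
    using w(4) unfolding D_def by simp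
  also have "\<dots> = f' \<otimes>\<^bsub>P\<^esub> e' \<oplus>\<^bsub>P\<^esub> D \<otimes>\<^bsub>P\<^esub> e"
    using CD(1,2) fP w(2) h(2) eP eP' by algebra
  also have "\<dots> \<in> ?E" using Ec(3)[OF Ec(6)[OF w(3) fP(2)] Ec(6)[OF h(3) CD(2)]] .
  finally have "D \<otimes>\<^bsub>P\<^esub> C \<ominus>\<^bsub>P\<^esub> f' \<otimes>\<^bsub>P\<^esub> w \<in> ?E"
    using primeideal.I_prime[OF E fP(1), of "D \<otimes>\<^bsub>P\<^esub> C \<ominus>\<^bsub>P\<^esub> f' \<otimes>\<^bsub>P\<^esub> w"] CD(1,2) fP(2) w(2) f(2)
    by simp
  then have "(D \<otimes>\<^bsub>P\<^esub> C \<ominus>\<^bsub>P\<^esub> f' \<otimes>\<^bsub>P\<^esub> w) \<oplus>\<^bsub>P\<^esub> f' \<otimes>\<^bsub>P\<^esub> w \<in> Q'"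
    using EQ(2) Q'c(3)[OF _ Q'c(7)[OF f'(1) w(2)]] by blast
  moreover have "(D \<otimes>\<^bsub>P\<^esub> C \<ominus>\<^bsub>P\<^esub> f' \<otimes>\<^bsub>P\<^esub> w) \<oplus>\<^bsub>P\<^esub> f' \<otimes>\<^bsub>P\<^esub> w = D \<otimes>\<^bsub>P\<^esub> C"
    using CD(1,2) fP w(2) by algebra
  ultimately show False using primeideal.I_prime[OF Q(2), of D C] CD by auto
qed

section \<open>The Hilbert basis theorem\<close>

definition leading_coeffs :: "(nat \<Rightarrow> 'a) set \<Rightarrow> nat \<Rightarrow> 'a set" where
  "leading_coeffs J n = {cf f n | f. f \<in> J \<and> (\<forall>k>n. cf f k = \<zero>)}"

lemma leading_coeffsI:
  "f \<in> J \<Longrightarrow> (\<And>k. k > n \<Longrightarrow> cf f k = \<zero>) \<Longrightarrow> a = cf f n \<Longrightarrow> a \<in> leading_coeffs J n"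
  unfolding leading_coeffs_def by blast

lemma ideal_leading_coeffs:
  assumes J: "ideal J P"
  shows "ideal (leading_coeffs J n) R"
proof (rule R.ideal_intro)
  note Jc = P.ideal_closed[OF J]
  show "leading_coeffs J n \<subseteq> carrier R" using Jc by (auto simp: leading_coeffs_def)
  show "\<zero> \<in> leading_coeffs J n" by (rule leading_coeffsI[OF Jc(1)]) auto
  fix a assume "a \<in> leading_coeffs J n"
  then obtain f where f: "f \<in> J" "\<And>k. k > n \<Longrightarrow> cf f k = \<zero>" "a = cf f n"
    unfolding leading_coeffs_def by blast
  have fP: "f \<in> carrier P" using f Jc by auto
  show "a \<oplus> b \<in> leading_coeffs J n" if b: "b \<in> leading_coeffs J n" for b
  proof -
    obtain g where g: "g \<in> J" "\<And>k. k > n \<Longrightarrow> cf g k = \<zero>" "b = cf g n"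
      using b unfolding leading_coeffs_def by blast
    then have "g \<in> carrier P" using Jc by auto
    then show ?thesis using fP f g by (intro leading_coeffsI[OF Jc(3)[OF f(1) g(1)]]) auto
  qed
  show "r \<otimes> a \<in> leading_coeffs J n" if r: "r \<in> carrier R" for r
    using r f fP by (intro leading_coeffsI[OF Jc(6)[OF f(1), of "mon r 0"]])
      (auto simp: monom_mult_is_smult)
qed

lemma leading_coeffs_Suc:
  assumes J: "ideal J P"
  shows "leading_coeffs J n \<subseteq> leading_coeffs J (Suc n)"
proof
  note Jc = P.ideal_closed[OF J]
  fix a assume "a \<in> leading_coeffs J n"
  then obtain f where f: "f \<in> J" "\<And>k. k > n \<Longrightarrow> cf f k = \<zero>" "a = cf f n"
    unfolding leading_coeffs_def by blast
  have fP: "f \<in> carrier P" using f Jc by auto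
  have c: "cf (mon \<one> 1 \<otimes>\<^bsub>P\<^esub> f) (Suc k) = cf f k" for k
    using coeff_monom_mult[of \<one> f 1 k] fP by simp
  show "a \<in> leading_coeffs J (Suc n)"
  proof (rule leading_coeffsI[OF Jc(6)[OF f(1), of "mon \<one> 1"]])
    fix k assume "Suc n < k"
    then obtain l where "k = Suc l" "l > n" by (cases k) auto
    then show "cf (mon \<one> 1 \<otimes>\<^bsub>P\<^esub> f) k = \<zero>" using c f by simp
  qed (use c f in auto)
qed

text \<open>Induction on a degree bound: a member of \<open>J'\<close> loses its top coefficient on
  subtracting a suitable member of \<open>J\<close>, and the difference stays in
  \<open>J'\<close>.\<close>

lemma ideal_eq_of_leading_coeffs:
  assumes J: "ideal J P" "ideal J' P" "J \<subseteq> J'"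
    and L: "\<And>n. leading_coeffs J' n \<subseteq> leading_coeffs J n"
  shows "J = J'"
proof -
  note Jc = P.ideal_closed[OF J(1)] and J'c = P.ideal_closed[OF J(2)]
  have "f \<in> J" if "f \<in> J'" "\<And>k. k \<ge> n \<Longrightarrow> cf f k = \<zero>" for f n
    using that
  proof (induction n arbitrary: f)
    case 0
    then have "f = \<zero>\<^bsub>P\<^esub>" using J'c by (intro up_eqI) auto
    then show ?case using Jc by simp
  next
    case (Suc n)
    have fP: "f \<in> carrier P" using Suc.prems J'c by auto
    have "cf f n \<in> leading_coeffs J n"
      using leading_coeffsI[of f J' n] Suc.prems L by auto
    then obtain g where g: "g \<in> J" "\<And>k. k > n \<Longrightarrow> cf g k = \<zero>" "cf f n = cf g n"
      unfolding leading_coeffs_def by blast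
    have gP: "g \<in> carrier P" using g Jc by auto
    have "f \<ominus>\<^bsub>P\<^esub> g \<in> J"
    proof (rule Suc.IH)
      show "f \<ominus>\<^bsub>P\<^esub> g \<in> J'" using J'c(4) Suc.prems g J(3) by blast
      fix k assume "n \<le> k"
      then show "cf (f \<ominus>\<^bsub>P\<^esub> g) k = \<zero>"
        using Suc.prems(2)[of k] g fP gP by (cases "k = n") (auto simp: R.minus_eq R.r_neg)
    qed
    then have "(f \<ominus>\<^bsub>P\<^esub> g) \<oplus>\<^bsub>P\<^esub> g \<in> J" using Jc(3) g by blast
    moreover have "(f \<ominus>\<^bsub>P\<^esub> g) \<oplus>\<^bsub>P\<^esub> g = f" using fP gP by algebra
    ultimately show ?case by simp
  qed
  moreover have "\<exists>n. \<forall>k\<ge>n. cf f k = \<zero>" if "f \<in> J'" for f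
    using deg_aboveD[of f] J'c(2)[OF that] by (intro exI[of _ "Suc (deg R f)"]) auto
  ultimately show ?thesis using J(3) by blast
qed

text \<open>The ideals of leading coefficients stabilise at some \<open>N\<close>. Finitely many
  polynomials realise generators of each of them in degrees up to \<open>N\<close>, and together
  these polynomials generate \<open>J\<close>.\<close>

theorem Hilbert_basis:
  assumes "noetherian_ring R"
  shows "noetherian_ring P"
proof (rule P.noetherian_ringI)
  interpret N: noetherian_ring R by fact
  fix J assume J: "ideal J P"
  note Jc = P.ideal_closed[OF J]
  have "\<exists>G. finite G \<and> G \<subseteq> {f \<in> J. \<forall>k>n. cf f k = \<zero>} \<and>
      leading_coeffs J n = Idl ((\<lambda>f. cf f n) ` G)" for n
  proof -
    obtain A where A: "A \<subseteq> carrier R" "finite A" "leading_coeffs J n = Idl A"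
      using N.finetely_gen[OF ideal_leading_coeffs[OF J]] by blast
    have "A \<subseteq> (\<lambda>f. cf f n) ` {f \<in> J. \<forall>k>n. cf f k = \<zero>}"
      using R.genideal_self[OF A(1)] A(3) unfolding leading_coeffs_def by blast
    from finite_subset_image[OF A(2) this] obtain G
      where "G \<subseteq> {f \<in> J. \<forall>k>n. cf f k = \<zero>}" "finite G" "A = (\<lambda>f. cf f n) ` G" by blast
    then show ?thesis using A(3) by blast
  qed
  then have "\<exists>G. \<forall>n. finite (G n) \<and> G n \<subseteq> {f \<in> J. \<forall>k>n. cf f k = \<zero>} \<and>
      leading_coeffs J n = Idl ((\<lambda>f. cf f n) ` G n)" by (intro choice allI)
  then obtain G where G': "\<forall>n. finite (G n) \<and> G n \<subseteq> {f \<in> J. \<forall>k>n. cf f k = \<zero>} \<and>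
      leading_coeffs J n = Idl ((\<lambda>f. cf f n) ` G n)" by (elim exE)
  note G = G'[THEN spec, THEN conjunct1] G'[THEN spec, THEN conjunct2, THEN conjunct1]
    G'[THEN spec, THEN conjunct2, THEN conjunct2]
  have "mono (leading_coeffs J)" using leading_coeffs_Suc[OF J] by (simp add: mono_iff_le_Suc)
  from N.ideal_sequence_stabilises[OF ideal_leading_coeffs[OF J] this]
  obtain N where N: "\<forall>n\<ge>N. leading_coeffs J n = leading_coeffs J N" by (elim exE)
  define H where "H = (\<Union>n\<le>N. G n)"
  have "H \<subseteq> J" using G(2) unfolding H_def by blast
  moreover have "J \<subseteq> carrier P" using Jc(2) by blast
  moreover have "finite H" using G(1) unfolding H_def by (intro finite_UN_I) simp_all
  ultimately have H: "H \<subseteq> carrier P" "finite H" "H \<subseteq> J" by blast+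
  have i: "ideal (Idl\<^bsub>P\<^esub> H) P" by (rule P.genideal_ideal[OF H(1)])
  have le: "leading_coeffs J n \<subseteq> leading_coeffs (Idl\<^bsub>P\<^esub> H) n" if "n \<le> N" for n
  proof -
    have "G n \<subseteq> Idl\<^bsub>P\<^esub> H" using P.genideal_self[OF H(1)] that unfolding H_def by auto
    then have "(\<lambda>f. cf f n) ` G n \<subseteq> leading_coeffs (Idl\<^bsub>P\<^esub> H) n"
      using G(2)[of n] by (auto intro!: leading_coeffsI)
    then show ?thesis unfolding G(3) by (intro R.genideal_minimal ideal_leading_coeffs i)
  qed
  \<comment> \<open>Beyond \<open>N\<close> the left side no longer grows, while the right side is
    increasing in the degree.\<close>
  have "leading_coeffs J n \<subseteq> leading_coeffs (Idl\<^bsub>P\<^esub> H) n" for n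
  proof (cases "n \<le> N")
    case False
    then have "leading_coeffs (Idl\<^bsub>P\<^esub> H) N \<subseteq> leading_coeffs (Idl\<^bsub>P\<^esub> H) n"
      by - (rule lift_Suc_mono_le[of "leading_coeffs (Idl\<^bsub>P\<^esub> H)"],
          auto dest: subsetD[OF leading_coeffs_Suc[OF i]])
    then show ?thesis using N[rule_format, of n] False le[of N] by auto
  qed (rule le)
  then have "Idl\<^bsub>P\<^esub> H = J"
    using ideal_eq_of_leading_coeffs[OF i J P.genideal_minimal[OF J H(3)]] by blast
  then show "\<exists>A\<subseteq>carrier P. finite A \<and> J = Idl\<^bsub>P\<^esub> A" using H by blast
qed

text \<open>The loss of one occurs only when all contractions coincide. Otherwise a constant c that
  lies in the last prime but not in the first is moved into the second prime; the contraction then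
  grows strictly at the first step, and the tail is left to the induction. Prescribing
  \<open>q 0\<close> is what allows one more prime to be put in front.\<close>

lemma prime_chain_contraction:
  assumes N: "noetherian_ring R" and Q: "prime_chain P Q n"
  shows "\<exists>q m. prime_chain R q m \<and> q 0 = contraction (Q 0) \<and> n \<le> Suc m"
  using Q
proof (induction n arbitrary: Q)
  case 0
  then show ?case
    by (intro exI[of _ "\<lambda>_. contraction (Q 0)"] exI[of _ 0])
      (auto simp: prime_chain_def primeideal_contraction)
next
  case (Suc n)
  have NP: "noetherian_cring P"
    using Hilbert_basis[OF N] P.is_cring by (simp add: noetherian_cring_def)
  have pr: "primeideal (Q i) P" if "i \<le> Suc n" for i using Suc.prems that by (simp add: prime_chain_def)
  have sub: "Q i \<subset> Q (Suc i)" if "i \<le> n" for i using Suc.prems that by (simp add: prime_chain_def)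
  have mono: "Q i \<subseteq> Q j" if "i \<le> j" "j \<le> Suc n" for i j
    using that by (induction j rule: dec_induct) (auto dest!: sub)
  have cmono: "contraction I \<subseteq> contraction K" if "I \<subseteq> K" for I K using that by (auto simp: contraction_def)
  show ?case
  proof (cases "contraction (Q (Suc n)) = contraction (Q 0)")
    case True
    then have eq: "contraction (Q i) = contraction (Q 0)" if "i \<le> Suc n" for i
      using cmono[OF mono[of 0 i]] cmono[OF mono[of i "Suc n"]] that by auto
    \<comment> \<open>Among three primes of the chain with one contraction, the lower two would both
      be the extended prime.\<close>
    have "n = 0"
    proof (rule ccontr)
      assume "n \<noteq> 0"
      then have "Q 0 = coeff_ideal (contraction (Q 0))" "Q 1 = coeff_ideal (contraction (Q 0))"
        using fibre_lower[of "Q 0" "Q 1"] fibre_lower[of "Q 1" "Q 2"] pr[of 0] pr[of 1] pr[of 2]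
          sub[of 0] sub[of 1] eq[of 1] eq[of 2] by (auto simp: numeral_2_eq_2)
      then show False using sub[of 0] by simp
    qed
    then show ?thesis
      by (intro exI[of _ "\<lambda>_. contraction (Q 0)"] exI[of _ 0])
        (auto simp: prime_chain_def intro!: primeideal_contraction pr)
  next
    case False
    then obtain c where c: "c \<in> carrier R" "mon c 0 \<in> Q (Suc n)" "mon c 0 \<notin> Q 0"
      using cmono[OF mono[of 0 "Suc n"]] by (auto simp: contraction_def)
    obtain Q' where Q': "prime_chain P Q' (Suc n)" "Q' 0 = Q 0" "mon c 0 \<in> Q' 1"
      using noetherian_cring.prime_chain_through_element[OF NP Suc.prems _ c(2,3)] by auto
    have "prime_chain P (\<lambda>i. Q' (Suc i)) n" using Q'(1) by (auto simp: prime_chain_def)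
    from Suc.IH[OF this] obtain q m where q: "prime_chain R q m" "q 0 = contraction (Q' 1)" "n \<le> Suc m"
      by auto
    have "Q' 0 \<subset> Q' 1" using Q'(1) by (auto simp: prime_chain_def)
    then have "contraction (Q 0) \<subset> q 0" using Q' c q cmono[of "Q' 0" "Q' 1"] by (auto simp: contraction_def)
    with q(1) primeideal_contraction[OF pr[of 0]]
    have "prime_chain R (case_nat (contraction (Q 0)) q) (Suc m)" by (intro prime_chain_Cons) simp_all
    then show ?thesis using q(3)
      by (intro exI[of _ "case_nat (contraction (Q 0)) q"] exI[of _ "Suc m"]) simp
  qed
qed

end

subsection \<open>Chains of primes and ring homomorphisms\<close>

lemma krull_dim_leI:
  assumes "\<And>n P. prime_chain R P n \<Longrightarrow> enat n \<le> d"
  shows "krull_dim R \<le> d"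
  unfolding krull_dim_def using assms by (auto intro!: Sup_least simp: prime_chain_def)

lemma prime_chain_le_krull_dim:
  assumes "prime_chain R P n"
  shows "enat n \<le> krull_dim R"
  unfolding krull_dim_def using assms by (intro Sup_upper) (auto simp: prime_chain_def)

lemma krull_dim_mono:
  assumes "\<And>n P. prime_chain R P n \<Longrightarrow> \<exists>Q. prime_chain S Q n"
  shows "krull_dim R \<le> krull_dim S"
  using assms by (meson krull_dim_leI prime_chain_le_krull_dim)

text \<open>The chain of length 0 excludes the zero ring, whose dimension is 0 by convention and for
  which the second premise would be vacuous.\<close>

lemma krull_dim_Suc_le:
  assumes "prime_chain R P 0" and ex: "\<And>n P. prime_chain R P n \<Longrightarrow> \<exists>Q. prime_chain S Q (Suc n)"
  shows "krull_dim R + 1 \<le> krull_dim S"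
proof (cases "krull_dim S")
  case (enat d)
  have "Suc n \<le> d" if "prime_chain R P n" for P n
    using prime_chain_le_krull_dim ex[OF that] enat by (metis enat_ord_simps(1))
  then have "krull_dim R \<le> enat (d - 1)" "d \<ge> 1"
    using assms(1) by (force intro!: krull_dim_leI)+
  then have "krull_dim R + 1 \<le> enat (d - 1) + 1" by (intro add_right_mono)
  also have "\<dots> = enat d" using \<open>d \<ge> 1\<close> by (simp add: one_enat_def)
  finally show ?thesis using enat by simp
qed auto

lemma prime_chain_mono:
  assumes "prime_chain R P n" "i \<le> j" "j \<le> n"
  shows "P i \<subseteq> P j"
  using assms(2,3)
proof (induction j rule: dec_induct)
  case (step j)
  then show ?case using assms(1) unfolding prime_chain_def by (meson Suc_le_lessD less_imp_le psubset_imp_subset subset_trans)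
qed simp

lemma (in domain) prime_chain_zero: "prime_chain R (\<lambda>_. {\<zero>}) 0"
  using zeroprimeideal by (simp add: prime_chain_def)

text \<open>Up to localization at \<open>v\<close>, the homomorphism \<open>h\<close> is surjective; so the primes of \<open>S\<close> not
  containing \<open>h v\<close> correspond to the primes of \<open>R\<close> that contain the kernel and not \<open>v\<close>.\<close>

lemma (in ring_hom_cring) prime_chain_correspondence:
  assumes v: "v \<in> carrier R"
    and surj: "\<And>d. d \<in> carrier S \<Longrightarrow> \<exists>k::nat. \<exists>r\<in>carrier R. h v [^]\<^bsub>S\<^esub> k \<otimes>\<^bsub>S\<^esub> d = h r"
  shows "(\<exists>P. prime_chain S P n \<and> h v \<notin> P n) \<longleftrightarrow>
    (\<exists>P. prime_chain R P n \<and> a_kernel R S h \<subseteq> P 0 \<and> v \<notin> P n)"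
proof (intro iffI; elim exE conjE)
  fix P assume P: "prime_chain S P n" "h v \<notin> P n"
  define Q where "Q i = {r \<in> carrier R. h r \<in> P i}" for i
  have pr: "primeideal (P i) S" if "i \<le> n" for i using that P(1) by (simp add: prime_chain_def)
  have nv: "h v \<notin> P i" if "i \<le> n" for i using that P prime_chain_mono by blast
  have "Q i \<subset> Q (Suc i)" if i: "i < n" for i
  proof -
    obtain d where d: "d \<in> P (Suc i)" "d \<notin> P i" and sub: "P i \<subseteq> P (Suc i)"
      using P(1) i unfolding prime_chain_def by blast
    have dS: "d \<in> carrier S"
      using S.ideal_closed(2)[OF primeideal.axioms(1)[OF pr[of "Suc i"]] d(1)] i by simp
    obtain k :: nat and r where r: "r \<in> carrier R" "h v [^]\<^bsub>S\<^esub> k \<otimes>\<^bsub>S\<^esub> d = h r" using surj[OF dS] by blast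
    have "h r \<in> P (Suc i)"
      unfolding r(2)[symmetric]
      using S.ideal_closed(6)[OF primeideal.axioms(1)[OF pr[of "Suc i"]] d(1)] i v by simp
    moreover have "h r \<notin> P i"
    proof
      assume "h r \<in> P i"
      then have "h v [^]\<^bsub>S\<^esub> k \<in> P i"
        using primeideal.I_prime[OF pr[of i], of "h v [^]\<^bsub>S\<^esub> k" d] i d v dS unfolding r(2)[symmetric] by auto
      then show False using S.prime_pow_mem[OF pr[of i], of "h v"] nv[of i] i v by auto
    qed
    ultimately show ?thesis using sub r unfolding Q_def by blast
  qed
  then have "prime_chain R Q n"
    using primeideal_vimage[OF pr] by (simp add: prime_chain_def Q_def)
  moreover have "a_kernel R S h \<subseteq> Q 0"
    using S.ideal_closed(1)[OF primeideal.axioms(1)[OF pr[of 0]]]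
    unfolding Q_def a_kernel_def' by force
  moreover have "v \<notin> Q n" using P(2) by (simp add: Q_def)
  ultimately show "\<exists>P. prime_chain R P n \<and> a_kernel R S h \<subseteq> P 0 \<and> v \<notin> P n" by blast
next
  fix P assume P: "prime_chain R P n" "a_kernel R S h \<subseteq> P 0" "v \<notin> P n"
  \<comment> \<open>The image of \<open>P i\<close>, saturated with respect to \<open>h v\<close>.
    Each element of \<open>S\<close> becomes an image only after multiplication by a power of
    \<open>h v\<close>, so the plain image need not be an ideal.\<close>
  define Q where "Q i = {d \<in> carrier S. \<exists>k::nat. \<exists>r\<in>P i. h v [^]\<^bsub>S\<^esub> k \<otimes>\<^bsub>S\<^esub> d = h r}" for i
  have QI: "d \<in> Q i" if "d \<in> carrier S" "r \<in> P i" "h v [^]\<^bsub>S\<^esub> (k::nat) \<otimes>\<^bsub>S\<^esub> d = h r" for d i r k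
    using that unfolding Q_def by blast
  have pr: "primeideal (P i) R" if "i \<le> n" for i using that P(1) by (simp add: prime_chain_def)
  have nv: "v \<notin> P i" if "i \<le> n" for i using that P prime_chain_mono by blast
  note Pc = R.ideal_closed[OF primeideal.axioms(1)[OF pr]]
  have hv: "h v [^]\<^bsub>S\<^esub> (k::nat) = h (v [^]\<^bsub>R\<^esub> k)" for k using v by simp
  \<comment> \<open>\<open>P i\<close> contains the kernel and not \<open>v\<close>, so membership
    in it can be tested on images under \<open>h\<close> and up to powers of
    \<open>v\<close>.\<close>
  have drop: "r \<in> P i" if i: "i \<le> n" and r: "r \<in> carrier R" and e: "h (v [^]\<^bsub>R\<^esub> (k::nat) \<otimes>\<^bsub>R\<^esub> r) = h s" and s: "s \<in> P i"
    for i r k s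
  proof -
    have sR: "s \<in> carrier R" using Pc(2)[OF i s] .
    have "h (v [^]\<^bsub>R\<^esub> k \<otimes>\<^bsub>R\<^esub> r \<ominus>\<^bsub>R\<^esub> s) = h (v [^]\<^bsub>R\<^esub> k \<otimes>\<^bsub>R\<^esub> r) \<ominus>\<^bsub>S\<^esub> h s"
      using r sR v by (simp add: R.minus_eq S.minus_eq)
    also have "\<dots> = \<zero>\<^bsub>S\<^esub>" unfolding e using sR by (simp add: S.minus_eq S.r_neg)
    finally have "v [^]\<^bsub>R\<^esub> k \<otimes>\<^bsub>R\<^esub> r \<ominus>\<^bsub>R\<^esub> s \<in> a_kernel R S h" using r sR v
      unfolding a_kernel_def' by simp
    with subsetD[OF order_trans[OF P(2) prime_chain_mono[OF P(1) le0 i]]]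
    have "v [^]\<^bsub>R\<^esub> k \<otimes>\<^bsub>R\<^esub> r \<ominus>\<^bsub>R\<^esub> s \<in> P i" .
    then have "(v [^]\<^bsub>R\<^esub> k \<otimes>\<^bsub>R\<^esub> r \<ominus>\<^bsub>R\<^esub> s) \<oplus>\<^bsub>R\<^esub> s \<in> P i" using Pc(3)[OF i _ s] by blast
    moreover have "(v [^]\<^bsub>R\<^esub> k \<otimes>\<^bsub>R\<^esub> r \<ominus>\<^bsub>R\<^esub> s) \<oplus>\<^bsub>R\<^esub> s = v [^]\<^bsub>R\<^esub> k \<otimes>\<^bsub>R\<^esub> r"
      using r sR R.nat_pow_closed[OF v, of k] by algebra
    ultimately have "v [^]\<^bsub>R\<^esub> k \<otimes>\<^bsub>R\<^esub> r \<in> P i" by simp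
    then show "r \<in> P i"
      using primeideal.I_prime[OF pr[OF i], of "v [^]\<^bsub>R\<^esub> k" r] R.prime_pow_mem[OF pr[OF i] v] nv[OF i] r v by auto
  qed
  \<comment> \<open>\<open>Q i\<close> contracts back to \<open>P i\<close>; properness and strict
    inclusions are read off from this.\<close>
  have vim: "h r \<in> Q i \<longleftrightarrow> r \<in> P i" if i: "i \<le> n" and r: "r \<in> carrier R" for i r
  proof
    assume "h r \<in> Q i"
    then obtain k :: nat and s where s: "s \<in> P i" "h v [^]\<^bsub>S\<^esub> k \<otimes>\<^bsub>S\<^esub> h r = h s"
      unfolding Q_def by blast
    then show "r \<in> P i" using drop[OF i r _ s(1), of k] r v by simp
  next
    assume "r \<in> P i"
    then show "h r \<in> Q i" using r by (intro QI[of _ r i 0]) auto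
  qed
  have Qp: "primeideal (Q i) S" if i: "i \<le> n" for i
  proof (rule primeidealI[OF S.ideal_intro S.is_cring])
    show "\<zero>\<^bsub>S\<^esub> \<in> Q i" using vim[OF i R.zero_closed] Pc(1)[OF i] by simp
  next
    fix a b assume "a \<in> Q i" "b \<in> Q i"
    then obtain k l :: nat and r s where a: "a \<in> carrier S" "r \<in> P i" "h v [^]\<^bsub>S\<^esub> k \<otimes>\<^bsub>S\<^esub> a = h r"
      and b: "b \<in> carrier S" "s \<in> P i" "h v [^]\<^bsub>S\<^esub> l \<otimes>\<^bsub>S\<^esub> b = h s" unfolding Q_def by blast
    have rs: "r \<in> carrier R" "s \<in> carrier R" using Pc(2)[OF i] a b by auto
    define A B where "A = h v [^]\<^bsub>S\<^esub> k" and "B = h v [^]\<^bsub>S\<^esub> l"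
    have AB: "A \<in> carrier S" "B \<in> carrier S" using v unfolding A_def B_def by auto
    have "A \<otimes>\<^bsub>S\<^esub> B \<otimes>\<^bsub>S\<^esub> (a \<oplus>\<^bsub>S\<^esub> b) = B \<otimes>\<^bsub>S\<^esub> (A \<otimes>\<^bsub>S\<^esub> a) \<oplus>\<^bsub>S\<^esub> A \<otimes>\<^bsub>S\<^esub> (B \<otimes>\<^bsub>S\<^esub> b)"
      using AB a(1) b(1) by algebra
    also have "\<dots> = h (v [^]\<^bsub>R\<^esub> l \<otimes>\<^bsub>R\<^esub> r \<oplus>\<^bsub>R\<^esub> v [^]\<^bsub>R\<^esub> k \<otimes>\<^bsub>R\<^esub> s)"
      using a(3) b(3) rs v unfolding A_def B_def by simp
    finally show "a \<oplus>\<^bsub>S\<^esub> b \<in> Q i"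
      using a b v Pc[OF i] unfolding A_def B_def
      by (intro QI[of _ "v [^]\<^bsub>R\<^esub> l \<otimes>\<^bsub>R\<^esub> r \<oplus>\<^bsub>R\<^esub> v [^]\<^bsub>R\<^esub> k \<otimes>\<^bsub>R\<^esub> s" i "k + l"]) (auto simp: S.nat_pow_mult)
  next
    fix a d assume "a \<in> Q i" and d: "d \<in> carrier S"
    then obtain k :: nat and r where a: "a \<in> carrier S" "r \<in> P i" "h v [^]\<^bsub>S\<^esub> k \<otimes>\<^bsub>S\<^esub> a = h r"
      unfolding Q_def by blast
    obtain l :: nat and s where b: "s \<in> carrier R" "h v [^]\<^bsub>S\<^esub> l \<otimes>\<^bsub>S\<^esub> d = h s" using surj[OF d] by blast
    have rs: "r \<in> carrier R" using Pc(2)[OF i] a by auto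
    define A B where "A = h v [^]\<^bsub>S\<^esub> k" and "B = h v [^]\<^bsub>S\<^esub> l"
    have AB: "A \<in> carrier S" "B \<in> carrier S" using v unfolding A_def B_def by auto
    have "A \<otimes>\<^bsub>S\<^esub> B \<otimes>\<^bsub>S\<^esub> (d \<otimes>\<^bsub>S\<^esub> a) = (B \<otimes>\<^bsub>S\<^esub> d) \<otimes>\<^bsub>S\<^esub> (A \<otimes>\<^bsub>S\<^esub> a)"
      using AB a(1) d by algebra
    also have "\<dots> = h (s \<otimes>\<^bsub>R\<^esub> r)"
      using a(3) b rs v unfolding A_def B_def by simp
    finally show "d \<otimes>\<^bsub>S\<^esub> a \<in> Q i"
      using a b d v Pc[OF i] unfolding A_def B_def
      by (intro QI[of _ "s \<otimes>\<^bsub>R\<^esub> r" i "k + l"]) (auto simp: S.nat_pow_mult)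
  next
    have "\<one>\<^bsub>S\<^esub> \<notin> Q i" using vim[OF i R.one_closed] R.prime_one_notin[OF pr[OF i]] by simp
    then show "carrier S \<noteq> Q i" by (metis S.one_closed)
  next
    fix a b assume ab: "a \<in> carrier S" "b \<in> carrier S" "a \<otimes>\<^bsub>S\<^esub> b \<in> Q i"
    obtain k :: nat and r where a: "r \<in> carrier R" "h v [^]\<^bsub>S\<^esub> k \<otimes>\<^bsub>S\<^esub> a = h r" using surj[OF ab(1)] by blast
    obtain l :: nat and s where b: "s \<in> carrier R" "h v [^]\<^bsub>S\<^esub> l \<otimes>\<^bsub>S\<^esub> b = h s" using surj[OF ab(2)] by blast
    obtain m :: nat and t where t: "t \<in> P i" "h v [^]\<^bsub>S\<^esub> m \<otimes>\<^bsub>S\<^esub> (a \<otimes>\<^bsub>S\<^esub> b) = h t"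
      using ab(3) unfolding Q_def by blast
    have tR: "t \<in> carrier R" using Pc(2)[OF i] t by auto
    define A B C where "A = h v [^]\<^bsub>S\<^esub> k" and "B = h v [^]\<^bsub>S\<^esub> l" and "C = h v [^]\<^bsub>S\<^esub> m"
    have ABC: "A \<in> carrier S" "B \<in> carrier S" "C \<in> carrier S" using v unfolding A_def B_def C_def by auto
    have "h (v [^]\<^bsub>R\<^esub> m \<otimes>\<^bsub>R\<^esub> (r \<otimes>\<^bsub>R\<^esub> s)) = C \<otimes>\<^bsub>S\<^esub> ((A \<otimes>\<^bsub>S\<^esub> a) \<otimes>\<^bsub>S\<^esub> (B \<otimes>\<^bsub>S\<^esub> b))"
      using a b v unfolding A_def B_def C_def by simp
    also have "\<dots> = A \<otimes>\<^bsub>S\<^esub> B \<otimes>\<^bsub>S\<^esub> (C \<otimes>\<^bsub>S\<^esub> (a \<otimes>\<^bsub>S\<^esub> b))" using ABC ab(1,2) by algebra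
    also have "\<dots> = h (v [^]\<^bsub>R\<^esub> (k + l) \<otimes>\<^bsub>R\<^esub> t)"
      using t tR v unfolding A_def B_def C_def by (simp add: S.nat_pow_mult[symmetric] R.nat_pow_mult[symmetric])
    finally have "r \<otimes>\<^bsub>R\<^esub> s \<in> P i"
      by (rule drop[OF i R.m_closed[OF a(1) b(1)] _ Pc(6)[OF i t(1) R.nat_pow_closed[OF v]]])
    then have "r \<in> P i \<or> s \<in> P i" using primeideal.I_prime[OF pr[OF i] a(1) b(1)] by auto
    then show "a \<in> Q i \<or> b \<in> Q i" using a b ab QI by blast
  qed (auto simp: Q_def)
  have "Q i \<subset> Q (Suc i)" if i: "i < n" for i
  proof -
    have "P i \<subset> P (Suc i)" using i P(1) by (simp add: prime_chain_def)
    then obtain r where r: "r \<in> P (Suc i)" "r \<notin> P i" and sub: "P i \<subseteq> P (Suc i)" by blast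
    have "r \<in> carrier R" using Pc(2)[of "Suc i" r] r i by simp
    then have "h r \<in> Q (Suc i)" "h r \<notin> Q i" using vim[of "Suc i" r] vim[of i r] r i by auto
    moreover have "Q i \<subseteq> Q (Suc i)" using sub unfolding Q_def by blast
    ultimately show ?thesis by blast
  qed
  then have "prime_chain S Q n" using Qp by (simp add: prime_chain_def)
  moreover have "h v \<notin> Q n" using vim[of n v] v P(3) by simp
  ultimately show "\<exists>P. prime_chain S P n \<and> h v \<notin> P n" by blast
qed

text \<open>The correspondence for \<open>v = \<one>\<close>, which no prime contains.\<close>

lemma (in ring_hom_cring) prime_chain_surj:
  assumes surj: "carrier S \<subseteq> h ` carrier R"
  shows "(\<exists>P. prime_chain S P n) \<longleftrightarrow> (\<exists>P. prime_chain R P n \<and> a_kernel R S h \<subseteq> P 0)"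
proof -
  have "\<exists>k::nat. \<exists>r\<in>carrier R. h \<one>\<^bsub>R\<^esub> [^]\<^bsub>S\<^esub> k \<otimes>\<^bsub>S\<^esub> d = h r" if "d \<in> carrier S" for d
    using surj that by (intro exI[of _ 0]) auto
  from prime_chain_correspondence[OF R.one_closed this]
  have "(\<exists>P. prime_chain S P n \<and> h \<one>\<^bsub>R\<^esub> \<notin> P n) \<longleftrightarrow>
    (\<exists>P. prime_chain R P n \<and> a_kernel R S h \<subseteq> P 0 \<and> \<one>\<^bsub>R\<^esub> \<notin> P n)" by blast
  moreover have "h \<one>\<^bsub>R\<^esub> \<notin> P n" if "prime_chain S P n" for P
    using that S.prime_one_notin[of "P n"] by (auto simp: prime_chain_def)
  moreover have "\<one>\<^bsub>R\<^esub> \<notin> P n" if "prime_chain R P n" for P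
    using that R.prime_one_notin[of "P n"] by (auto simp: prime_chain_def)
  ultimately show ?thesis by blast
qed

lemma (in ring_hom_cring) krull_dim_surj_le:
  assumes "carrier S \<subseteq> h ` carrier R"
  shows "krull_dim S \<le> krull_dim R"
  using prime_chain_surj[OF assms] by (intro krull_dim_mono) blast

lemma (in ring_hom_cring) noetherian_ring_surj:
  assumes surj: "carrier S \<subseteq> h ` carrier R" and N: "noetherian_ring R"
  shows "noetherian_ring S"
proof (rule S.noetherian_ringI)
  fix I assume I: "ideal I S"
  define J where "J = {r \<in> carrier R. h r \<in> I}"
  have "ideal J R" unfolding J_def by (rule ring.ideal_vimage[OF I])
  then obtain A where A: "A \<subseteq> carrier R" "finite A" "J = Idl\<^bsub>R\<^esub> A"
    using noetherian_ring.finetely_gen[OF N] by blast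
  have hA: "h ` A \<subseteq> carrier S" using A by auto
  have "h ` A \<subseteq> I" using R.genideal_self[OF A(1)] A(3) unfolding J_def by auto
  then have "Idl\<^bsub>S\<^esub> (h ` A) \<subseteq> I" by (rule S.genideal_minimal[OF I])
  moreover have "I \<subseteq> Idl\<^bsub>S\<^esub> (h ` A)"
  proof
    fix d assume d: "d \<in> I"
    then obtain r where r: "r \<in> carrier R" "d = h r" using surj S.ideal_closed(2)[OF I] by blast
    have "ideal {r \<in> carrier R. h r \<in> Idl\<^bsub>S\<^esub> (h ` A)} R"
      by (rule ring.ideal_vimage[OF S.genideal_ideal[OF hA]])
    moreover have "A \<subseteq> {r \<in> carrier R. h r \<in> Idl\<^bsub>S\<^esub> (h ` A)}"
      using S.genideal_self[OF hA] A(1) by auto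
    ultimately have "J \<subseteq> {r \<in> carrier R. h r \<in> Idl\<^bsub>S\<^esub> (h ` A)}"
      unfolding A(3) by (rule R.genideal_minimal)
    then show "d \<in> Idl\<^bsub>S\<^esub> (h ` A)" using r d unfolding J_def by auto
  qed
  ultimately show "\<exists>A\<subseteq>carrier S. finite A \<and> I = Idl\<^bsub>S\<^esub> A"
    using A(2) hA by (intro exI[of _ "h ` A"]) auto
qed

subsection \<open>Dimension of polynomial rings and simple extensions\<close>

context UP_cring
begin

lemma krull_dim_UP_le:
  assumes "noetherian_ring R"
  shows "krull_dim P \<le> krull_dim R + 1"
proof (rule krull_dim_leI)
  fix n Q assume "prime_chain P Q n"
  then obtain q m where q: "prime_chain R q m" "n \<le> Suc m"
    using prime_chain_contraction[OF assms] by blast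
  have "enat n \<le> enat m + 1" using q(2) by (simp add: one_enat_def)
  also have "\<dots> \<le> krull_dim R + 1" by (intro add_right_mono prime_chain_le_krull_dim[OF q(1)])
  finally show "enat n \<le> krull_dim R + 1" .
qed

lemma coeff_0_ring_hom_cring: "ring_hom_cring P R (\<lambda>f. cf f 0)"
  by (intro ring_hom_cringI R.is_cring P.is_cring) (auto intro!: ring_hom_memI)

lemma prime_chain_UP:
  assumes q: "prime_chain R q n"
  shows "\<exists>Q. prime_chain P Q (Suc n)"
proof -
  \<comment> \<open>The extended primes, with one more prime on top: the polynomials with constant
    term in \<open>q n\<close>, that is \<open>q n\<close> together with X. The indeterminate
    separates the last two.\<close>
  define Q where "Q i = (if i \<le> n then coeff_ideal (q i) else {f \<in> carrier P. cf f 0 \<in> q n})" for i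
  have pr: "primeideal (q i) R" if "i \<le> n" for i using that q by (simp add: prime_chain_def)
  have "primeideal (Q i) P" for i
    using primeideal_coeff_ideal[OF pr] ring_hom_cring.primeideal_vimage[OF coeff_0_ring_hom_cring pr[of n]]
    by (auto simp: Q_def)
  moreover have "Q i \<subset> Q (Suc i)" if "i < Suc n" for i
  proof (cases "i = n")
    case True
    have "mon \<one> 1 \<in> Q (Suc n)" "mon \<one> 1 \<notin> Q n" "Q n \<subseteq> Q (Suc n)"
      using R.prime_one_notin[OF pr[of n]] R.ideal_closed(1)[OF primeideal.axioms(1)[OF pr[of n]]]
      by (auto simp: Q_def coeff_ideal_def)
    then show ?thesis using True by blast
  next
    case False
    then have i: "i < n" using that by simp
    have sub: "q i \<subset> q (Suc i)" using i q by (simp add: prime_chain_def)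
    then obtain a where a: "a \<in> q (Suc i)" "a \<notin> q i" by blast
    then have aR: "a \<in> carrier R" using R.ideal_closed(2)[OF primeideal.axioms(1)[OF pr[of "Suc i"]]] i by simp
    have "mon a 0 \<in> Q (Suc i)" "mon a 0 \<notin> Q i"
      using a aR i R.ideal_closed(1)[OF primeideal.axioms(1)[OF pr[of "Suc i"]]]
      by (auto simp: Q_def coeff_ideal_def)
    moreover have "Q i \<subseteq> Q (Suc i)" using sub i by (auto simp: Q_def coeff_ideal_def)
    ultimately show ?thesis by blast
  qed
  ultimately show ?thesis unfolding prime_chain_def by blast
qed

end

lemma (in UP_domain) krull_dim_UP_ge: "krull_dim R + 1 \<le> krull_dim P"
  by (rule krull_dim_Suc_le[OF R.prime_chain_zero prime_chain_UP])

section \<open>Rings exhausted by Noetherian subrings of bounded dimension\<close>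

text \<open>A substitute for being Noetherian of dimension at most \<open>d\<close>. It bounds the
  Krull dimension from above, passes to homomorphic images, and the bound grows by one with each
  indeterminate, which is all that the Jaffard property asks of it.\<close>

definition locally_noetherian_dim :: "('a, 'm) ring_scheme \<Rightarrow> enat \<Rightarrow> bool" where
  "locally_noetherian_dim T d \<longleftrightarrow> (\<forall>F\<subseteq>carrier T. finite F \<longrightarrow>
     (\<exists>S. subring S T \<and> F \<subseteq> S \<and> noetherian_ring (T\<lparr>carrier := S\<rparr>) \<and> krull_dim (T\<lparr>carrier := S\<rparr>) \<le> d))"

lemma (in cring) subring_cring:
  assumes "subring S R"
  shows "cring (R\<lparr>carrier := S\<rparr>)"
  using subcring_iff[OF subringE(1)[OF assms]] subcringI'[OF assms] by blast

lemma (in cring) subring_inclusion: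
  assumes "subring S R"
  shows "ring_hom_cring (R\<lparr>carrier := S\<rparr>) R (\<lambda>x. x)"
  using subringE(1)[OF assms]
  by (intro ring_hom_cringI subring_cring[OF assms] is_cring) (auto intro!: ring_hom_memI)

lemma (in cring) locally_noetherian_krull_dim:
  assumes "locally_noetherian_dim R d"
  shows "krull_dim R \<le> d"
proof (rule krull_dim_leI)
  fix n P assume P: "prime_chain R P n"
  have pr: "primeideal (P i) R" if "i \<le> n" for i using that P by (simp add: prime_chain_def)
  have "\<forall>i<n. \<exists>a. a \<in> P (Suc i) - P i" using P by (auto simp: prime_chain_def)
  then obtain a where a: "\<And>i. i < n \<Longrightarrow> a i \<in> P (Suc i) - P i" by metis
  have "a ` {..<n} \<subseteq> carrier R"
  proof (intro image_subsetI)
    fix i assume "i \<in> {..<n}"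
    then have "Suc i \<le> n" "a i \<in> P (Suc i)" using a[of i] by auto
    then show "a i \<in> carrier R" using ideal_closed(2)[OF primeideal.axioms(1)[OF pr]] by blast
  qed
  then obtain S where S: "subring S R" "a ` {..<n} \<subseteq> S" "krull_dim (R\<lparr>carrier := S\<rparr>) \<le> d"
    using assms unfolding locally_noetherian_dim_def by (meson finite_imageI finite_lessThan)
  interpret inc: ring_hom_cring "R\<lparr>carrier := S\<rparr>" R "\<lambda>x. x" by (rule subring_inclusion[OF S(1)])
  have "prime_chain (R\<lparr>carrier := S\<rparr>) (\<lambda>i. {r \<in> carrier (R\<lparr>carrier := S\<rparr>). r \<in> P i}) n"
    unfolding prime_chain_def
  proof (intro conjI allI impI)
    fix i assume i: "i < n"
    have "P i \<subseteq> P (Suc i)" using P i by (auto simp: prime_chain_def)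
    moreover have "a i \<in> S" using S(2) i by auto
    ultimately show "{r \<in> carrier (R\<lparr>carrier := S\<rparr>). r \<in> P i} \<subset> {r \<in> carrier (R\<lparr>carrier := S\<rparr>). r \<in> P (Suc i)}"
      using a[OF i] by auto
  qed (rule inc.primeideal_vimage[OF pr])
  from prime_chain_le_krull_dim[OF this] show "enat n \<le> d" using S(3) by (rule order_trans)
qed

lemma (in ring_hom_cring) image_subring_hom:
  assumes "subring K R"
  shows "subring (h ` K) S" "ring_hom_cring (R\<lparr>carrier := K\<rparr>) (S\<lparr>carrier := h ` K\<rparr>) h"
proof -
  show K: "subring (h ` K) S" by (rule ring.img_is_subring[OF assms])
  show "ring_hom_cring (R\<lparr>carrier := K\<rparr>) (S\<lparr>carrier := h ` K\<rparr>) h"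
    using subringE(1)[OF assms]
    by (intro ring_hom_cringI R.subring_cring[OF assms] S.subring_cring[OF K])
      (auto intro!: ring_hom_memI simp: subset_eq)
qed

lemma (in ring_hom_cring) image_subring_dim:
  assumes K: "subring K R" "noetherian_ring (R\<lparr>carrier := K\<rparr>)"
  shows "noetherian_ring (S\<lparr>carrier := h ` K\<rparr>)"
    "krull_dim (S\<lparr>carrier := h ` K\<rparr>) \<le> krull_dim (R\<lparr>carrier := K\<rparr>)"
  using ring_hom_cring.noetherian_ring_surj[OF image_subring_hom(2)[OF K(1)] _ K(2)]
    ring_hom_cring.krull_dim_surj_le[OF image_subring_hom(2)[OF K(1)]] by simp_all

lemma (in ring_hom_cring) locally_noetherian_surj:
  assumes surj: "carrier S \<subseteq> h ` carrier R" and L: "locally_noetherian_dim R d"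
  shows "locally_noetherian_dim S d"
  unfolding locally_noetherian_dim_def
proof (intro allI impI)
  fix F assume "F \<subseteq> carrier S" "finite F"
  then obtain F' where F': "F' \<subseteq> carrier R" "finite F'" "F = h ` F'"
    using finite_subset_image[of F h "carrier R"] surj by blast
  then obtain K where K: "subring K R" "F' \<subseteq> K" "noetherian_ring (R\<lparr>carrier := K\<rparr>)"
      "krull_dim (R\<lparr>carrier := K\<rparr>) \<le> d"
    using L unfolding locally_noetherian_dim_def by blast
  then show "\<exists>K. subring K S \<and> F \<subseteq> K \<and> noetherian_ring (S\<lparr>carrier := K\<rparr>) \<and> krull_dim (S\<lparr>carrier := K\<rparr>) \<le> d"
    using image_subring_hom(1)[OF K(1)] image_subring_dim[OF K(1,3)] F'
    by (intro exI[of _ "h ` K"]) (auto intro: order_trans)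
qed

lemma up_iff_finite:
  "f \<in> up R \<longleftrightarrow> (\<forall>n. f n \<in> carrier R) \<and> finite {n. f n \<noteq> \<zero>\<^bsub>R\<^esub>}"
proof -
  have "(\<exists>n. bound \<zero>\<^bsub>R\<^esub> n f) \<longleftrightarrow> finite {n. f n \<noteq> \<zero>\<^bsub>R\<^esub>}"
    unfolding bound_def finite_nat_set_iff_bounded_le by (auto simp: not_le) (meson not_le)+
  then show ?thesis by (auto simp: up_def)
qed

lemma carrier_UP: "carrier (UP R) = up R" by (simp add: UP_def)

lemma mult_UP:
  "f \<in> up R \<Longrightarrow> g \<in> up R \<Longrightarrow> f \<otimes>\<^bsub>UP R\<^esub> g = (\<lambda>n. \<Oplus>\<^bsub>R\<^esub>i\<in>{..n}. f i \<otimes>\<^bsub>R\<^esub> g (n - i))"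
  by (simp add: UP_def)

lemma add_UP:
  "f \<in> up R \<Longrightarrow> g \<in> up R \<Longrightarrow> f \<oplus>\<^bsub>UP R\<^esub> g = (\<lambda>n. f n \<oplus>\<^bsub>R\<^esub> g n)"
  by (simp add: UP_def)

text \<open>Finitely many polynomials have finitely many coefficients. A good subring of
  \<open>R\<close> containing these yields its polynomial ring, Noetherian and of dimension at most
  one more.\<close>

lemma (in UP_cring) locally_noetherian_UP:
  assumes L: "locally_noetherian_dim R d"
  shows "locally_noetherian_dim P (d + 1)"
  unfolding locally_noetherian_dim_def
proof (intro allI impI)
  fix F assume F: "F \<subseteq> carrier P" "finite F"
  define F' where "F' = (\<Union>f\<in>F. range f)"
  have fup: "\<And>n. f n \<in> carrier R" "finite {n. f n \<noteq> \<zero>}" if "f \<in> F" for f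
    using that F(1) by (auto simp: P_def carrier_UP up_iff_finite)
  have "finite (range f)" if "f \<in> F" for f
  proof -
    have "range f \<subseteq> insert \<zero> (f ` {n. f n \<noteq> \<zero>})" by auto
    then show ?thesis using fup(2)[OF that] by (meson finite_imageI finite_insert finite_subset)
  qed
  then have "finite F'" "F' \<subseteq> carrier R" using F(2) fup(1) unfolding F'_def by auto
  then obtain S where S: "subring S R" "F' \<subseteq> S" "noetherian_ring (R\<lparr>carrier := S\<rparr>)"
      "krull_dim (R\<lparr>carrier := S\<rparr>) \<le> d"
    using L unfolding locally_noetherian_dim_def by blast
  define R' where "R' = R\<lparr>carrier := S\<rparr>"
  interpret inc: ring_hom_cring R' R "\<lambda>x. x" unfolding R'_def by (rule R.subring_inclusion[OF S(1)])
  interpret UR': UP_cring R' "UP R'" by unfold_locales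
  have up: "up R' \<subseteq> up R" using subringE(1)[OF S(1)] by (auto simp: up_iff_finite R'_def)
  \<comment> \<open>Polynomials are coefficient functions, so those over the subring are literally
    polynomials over \<open>R\<close> and the identity serves as inclusion.\<close>
  have "(\<lambda>f. f) \<in> ring_hom (UP R') P"
  proof (rule ring_hom_memI)
    fix f g assume f: "f \<in> carrier (UP R')" and g: "g \<in> carrier (UP R')"
    show "f \<in> carrier P" using f up by (auto simp: P_def carrier_UP)
    have fg: "f \<in> up R'" "g \<in> up R'" "f \<in> up R" "g \<in> up R" using f g up by (auto simp: carrier_UP)
    have s: "finsum R' (\<lambda>i. f i \<otimes>\<^bsub>R'\<^esub> g (n - i)) {..n} = (\<Oplus>i\<in>{..n}. f i \<otimes> g (n - i))" for n
    proof -
      have "(\<lambda>i. f i \<otimes>\<^bsub>R'\<^esub> g (n - i)) \<in> {..n} \<rightarrow> carrier R'"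
        using fg by (intro funcsetI inc.R.m_closed) (auto simp: up_iff_finite)
      from inc.hom_finsum[OF this] show ?thesis by (simp add: R'_def comp_def)
    qed
    then show "f \<otimes>\<^bsub>UP R'\<^esub> g = f \<otimes>\<^bsub>P\<^esub> g"
      unfolding P_def mult_UP[OF fg(1,2)] mult_UP[OF fg(3,4)] by (intro ext)
    show "f \<oplus>\<^bsub>UP R'\<^esub> g = f \<oplus>\<^bsub>P\<^esub> g"
      unfolding P_def add_UP[OF fg(1,2)] add_UP[OF fg(3,4)] by (simp add: R'_def)
  qed (simp add: UP_def P_def R'_def cong: if_cong)
  then interpret incP: ring_hom_cring "UP R'" P "\<lambda>f. f"
    by (intro ring_hom_cringI UR'.P.is_cring P.is_cring)
  have NS: "noetherian_ring (UP R')" using UR'.Hilbert_basis S(3) by (simp add: R'_def)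
  have "subring (carrier (UP R')) P"
    using incP.image_subring_hom(1)[OF UR'.P.carrier_is_subring] by simp
  moreover have "F \<subseteq> carrier (UP R')"
  proof
    fix f assume f: "f \<in> F"
    then have "f n \<in> S" for n using S(2) unfolding F'_def by blast
    then show "f \<in> carrier (UP R')" using fup(2)[OF f] by (simp add: carrier_UP up_iff_finite R'_def)
  qed
  moreover have "noetherian_ring (P\<lparr>carrier := carrier (UP R')\<rparr>)"
     "krull_dim (P\<lparr>carrier := carrier (UP R')\<rparr>) \<le> krull_dim (UP R')"
    using incP.image_subring_dim[OF UR'.P.carrier_is_subring] NS by simp_all
  moreover have "krull_dim (UP R') \<le> d + 1"
    using UR'.krull_dim_UP_le S(3,4) by (metis R'_def add_right_mono order_trans)
  ultimately show "\<exists>S. subring S P \<and> F \<subseteq> S \<and> noetherian_ring (P\<lparr>carrier := S\<rparr>) \<and>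
      krull_dim (P\<lparr>carrier := S\<rparr>) \<le> d + 1" by (meson order_trans)
qed

lemma (in ring) minus_zero_right: "a \<in> carrier R \<Longrightarrow> a \<ominus> \<zero> = a"
  by (simp add: minus_eq)

text \<open>\<open>S'\<close> is the image of S[Z] under evaluation at \<open>z\<close>. In the last
  clause the relation a z = b puts the nonzero polynomial a Z - b into the kernel. Chains of
  \<open>S'\<close> lift to chains of S[Z] above this kernel, below which the zero ideal still fits:
  dim S' + 1 is at most dim S[Z], hence at most dim S + 1.\<close>

lemma (in cring) adjoin_element:
  assumes S: "subring S R" "noetherian_ring (R\<lparr>carrier := S\<rparr>)" and z: "z \<in> carrier R"
  obtains S' where "subring S' R" "S \<subseteq> S'" "z \<in> S'" "noetherian_ring (R\<lparr>carrier := S'\<rparr>)"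
    "krull_dim (R\<lparr>carrier := S'\<rparr>) \<le> krull_dim (R\<lparr>carrier := S\<rparr>) + 1"
    "domain R \<Longrightarrow> (\<exists>a\<in>S. \<exists>b\<in>S. a \<noteq> \<zero> \<and> a \<otimes> z = b) \<Longrightarrow>
      krull_dim (R\<lparr>carrier := S'\<rparr>) \<le> krull_dim (R\<lparr>carrier := S\<rparr>)"
proof -
  have Rc: "cring R" by (rule is_cring)
  have neg: "b \<oplus> \<ominus> b = \<zero>" if "b \<in> S" for b using that subringE(1)[OF S(1)] by (auto intro: r_neg)
  define R' where "R' = R\<lparr>carrier := S\<rparr>"
  interpret inc: ring_hom_cring R' R "\<lambda>x. x" unfolding R'_def by (rule subring_inclusion[OF S(1)])
  interpret UP_pre_univ_prop R' R "\<lambda>x. x" "UP R'" by unfold_locales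
  define ev where "ev = UnivPoly.eval R' R (\<lambda>x. x) z"
  interpret ev: ring_hom_cring "UP R'" R ev
    unfolding ev_def by (intro ring_hom_cringI P.is_cring Rc eval_ring_hom z)
  define S' where "S' = ev ` carrier (UP R')"
  have NU: "noetherian_ring (UP R')" using Hilbert_basis S(2) by (simp add: R'_def)
  have S': "subring S' R" unfolding S'_def by (rule ev.image_subring_hom(1)[OF P.carrier_is_subring])
  interpret on: ring_hom_cring "UP R'" "R\<lparr>carrier := S'\<rparr>" ev
    using ev.image_subring_hom(2)[OF P.carrier_is_subring] by (simp add: S'_def)
  have surj: "carrier (R\<lparr>carrier := S'\<rparr>) \<subseteq> ev ` carrier (UP R')" by (simp add: S'_def)
  have c: "ev (mon r 0) = r" if "r \<in> S" for r
    using that eval_const[OF z, of r] unfolding ev_def by (simp add: R'_def)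
  have "S \<subseteq> S'"
  proof
    fix r assume r: "r \<in> S"
    then have "r \<in> carrier R'" by (simp add: R'_def)
    then have "ev (mon r 0) \<in> S'" unfolding S'_def by (intro imageI monom_closed)
    then show "r \<in> S'" using c[OF r] by simp
  qed
  moreover have "z \<in> S'"
    unfolding S'_def using eval_monom1[OF z] monom_closed[OF inc.R.one_closed, of 1]
    unfolding ev_def by (metis image_eqI)
  moreover have "krull_dim (R\<lparr>carrier := S'\<rparr>) \<le> krull_dim (R\<lparr>carrier := S\<rparr>) + 1"
    unfolding R'_def[symmetric]
    by (rule order_trans[OF on.krull_dim_surj_le[OF surj] krull_dim_UP_le[OF S(2)[folded R'_def]]])
  moreover have "krull_dim (R\<lparr>carrier := S'\<rparr>) \<le> krull_dim (R\<lparr>carrier := S\<rparr>)"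
    if dom: "domain R" and ex: "\<exists>a\<in>S. \<exists>b\<in>S. a \<noteq> \<zero> \<and> a \<otimes> z = b"
  proof -
    obtain a b where ab: "a \<in> S" "b \<in> S" "a \<noteq> \<zero>" "a \<otimes> z = b" using ex by blast
    have abR: "a \<in> carrier R'" "b \<in> carrier R'" using ab by (auto simp: R'_def)
    have "domain R'" using domain.subring_is_domain[OF dom S(1)] by (simp add: R'_def)
    then interpret UD: UP_domain R' "UP R'" by (simp add: UP_domain_def)
    define f where "f = mon a 1 \<ominus>\<^bsub>UP R'\<^esub> mon b 0"
    have f: "f \<in> carrier (UP R')" using abR unfolding f_def by simp
    have "ev (mon a 1) = b"
      using eval_monom[OF abR(1) z, of 1] z ab unfolding ev_def by simp
    then have "ev f = \<zero>" using abR ab c[of b] ev.hom_closed[of "mon b 0"] monom_closed[of b 0]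
      neg[OF ab(2)]
      unfolding f_def by (simp add: P.minus_eq)
    then have fker: "f \<in> a_kernel (UP R') (R\<lparr>carrier := S'\<rparr>) ev"
      using f unfolding a_kernel_def' by simp
    have "cf f 1 = a \<ominus>\<^bsub>R'\<^esub> \<zero>\<^bsub>R'\<^esub>"
      unfolding f_def using abR by (subst coeff_minus) simp_all
    also have "\<dots> = a" using abR(1) by (rule inc.R.minus_zero_right)
    finally have "cf f 1 = a" .
    then have f0: "f \<noteq> \<zero>\<^bsub>UP R'\<^esub>" using ab(3) coeff_zero[of 1] by auto
    have "krull_dim (R\<lparr>carrier := S'\<rparr>) + 1 \<le> krull_dim (UP R')"
    proof (rule krull_dim_Suc_le)
      show "prime_chain (R\<lparr>carrier := S'\<rparr>) (\<lambda>_. {\<zero>\<^bsub>R\<lparr>carrier := S'\<rparr>\<^esub>}) 0"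
        using domain.prime_chain_zero[OF domain.subring_is_domain[OF dom S']] .
      fix n P assume "prime_chain (R\<lparr>carrier := S'\<rparr>) P n"
      then obtain Q where Q: "prime_chain (UP R') Q n" "a_kernel (UP R') (R\<lparr>carrier := S'\<rparr>) ev \<subseteq> Q 0"
        using on.prime_chain_surj[OF surj] by blast
      have "ideal (Q 0) (UP R')" using Q(1) primeideal.axioms(1) by (auto simp: prime_chain_def)
      then have "{\<zero>\<^bsub>UP R'\<^esub>} \<subset> Q 0" using fker Q(2) f0 P.ideal_closed(1) by blast
      then show "\<exists>Q. prime_chain (UP R') Q (Suc n)"
        using prime_chain_Cons[OF Q(1) domain.zeroprimeideal[OF UD.UP_domain]] by blast
    qed
    also have "\<dots> \<le> krull_dim (R\<lparr>carrier := S\<rparr>) + 1"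
      using krull_dim_UP_le S(2) unfolding R'_def by simp
    \<comment> \<open>The summand 1 cancels when dim S is finite; otherwise the bound is
      trivial.\<close>
    finally show ?thesis by (cases "krull_dim (R\<lparr>carrier := S\<rparr>)"; cases "krull_dim (R\<lparr>carrier := S'\<rparr>)") (auto simp: one_enat_def)
  qed
  ultimately show thesis using that[OF S'] on.noetherian_ring_surj[OF surj NU] by blast
qed

subsection \<open>Polynomials in several variables\<close>

text \<open>Here \<open>S\<close> is a bare record of operations, and the homomorphism transports
  the ring laws to it; this is how the polynomial rings in several variables and the graded ring
  become rings. Until then the designated zero of \<open>S\<close> has no relation to its addition,
  so preservation of zero is a premise.\<close>

lemma (in cring) ring_hom_image_cring:
  assumes h: "h \<in> ring_hom R S" "h ` carrier R = carrier S" "h \<zero> = \<zero>\<^bsub>S\<^esub>"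
  shows "cring S" "ring_hom_cring R S h"
proof -
  have "ring S" using ring_hom_imp_img_ring[OF h(1)] by (simp add: h(2,3))
  then interpret S: ring S .
  have "x \<otimes>\<^bsub>S\<^esub> y = y \<otimes>\<^bsub>S\<^esub> x" if xy: "x \<in> carrier S" "y \<in> carrier S" for x y
  proof -
    obtain a b where ab: "a \<in> carrier R" "x = h a" "b \<in> carrier R" "y = h b"
      using xy unfolding h(2)[symmetric] by auto
    show ?thesis unfolding ab(2,4) ring_hom_mult[OF h(1) ab(1,3), symmetric] ring_hom_mult[OF h(1) ab(3,1), symmetric]
      using ab by (simp add: m_comm)
  qed
  then show "cring S" by unfold_locales
  then show "ring_hom_cring R S h" by (intro ring_hom_cringI is_cring h(1))
qed

lemma (in ring_hom_cring) domain_of_surj_inj: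
  assumes "domain R" "h ` carrier R = carrier S" "inj_on h (carrier R)"
  shows "domain S"
proof (rule domain.intro[OF S.is_cring], unfold_locales)
  interpret D: domain R by fact
  have inj: "a = b" if "h a = h b" "a \<in> carrier R" "b \<in> carrier R" for a b
    using assms(3) that by (auto simp: inj_on_def)
  show "\<one>\<^bsub>S\<^esub> \<noteq> \<zero>\<^bsub>S\<^esub>" using inj[of "\<one>\<^bsub>R\<^esub>" "\<zero>\<^bsub>R\<^esub>"] by auto
  fix x y assume xy: "x \<otimes>\<^bsub>S\<^esub> y = \<zero>\<^bsub>S\<^esub>" "x \<in> carrier S" "y \<in> carrier S"
  then obtain a b where ab: "a \<in> carrier R" "x = h a" "b \<in> carrier R" "y = h b"
    unfolding assms(2)[symmetric] by blast
  have "h (a \<otimes>\<^bsub>R\<^esub> b) = h \<zero>\<^bsub>R\<^esub>" using xy ab by simp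
  then have "a \<otimes>\<^bsub>R\<^esub> b = \<zero>\<^bsub>R\<^esub>" by (rule inj) (use ab in auto)
  then show "x = \<zero>\<^bsub>S\<^esub> \<or> y = \<zero>\<^bsub>S\<^esub>" using D.integral[OF _ ab(1,3)] ab by auto
qed

lemma (in ring_hom_cring) krull_dim_le_of_surj_inj:
  assumes "h ` carrier R = carrier S" "inj_on h (carrier R)"
  shows "krull_dim R \<le> krull_dim S"
proof (rule krull_dim_mono)
  fix k P assume P: "prime_chain R P k"
  have "a_kernel R S h \<subseteq> {\<zero>\<^bsub>R\<^esub>}"
  proof
    fix x assume "x \<in> a_kernel R S h"
    then have "x \<in> carrier R" "h x = h \<zero>\<^bsub>R\<^esub>" unfolding a_kernel_def' by auto
    then show "x \<in> {\<zero>\<^bsub>R\<^esub>}" using inj_onD[OF assms(2)] by blast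
  qed
  also have "\<dots> \<subseteq> P 0"
    using R.ideal_closed(1)[OF primeideal.axioms(1), of "P 0"] P by (auto simp: prime_chain_def)
  finally show "\<exists>Q. prime_chain S Q k"
    using prime_chain_surj[of k] P assms(1) by blast
qed

lemma finite_subset_mset: "finite {a. a \<subseteq># m}"
proof (induction m)
  case (add x m)
  have "{a. a \<subseteq># add_mset x m} \<subseteq> {a. a \<subseteq># m} \<union> add_mset x ` {a. a \<subseteq># m}"
  proof
    fix a assume "a \<in> {a. a \<subseteq># add_mset x m}"
    then have a: "a \<subseteq># add_mset x m" by simp
    show "a \<in> {a. a \<subseteq># m} \<union> add_mset x ` {a. a \<subseteq># m}"
    proof (cases "x \<in># a")
      case True
      then obtain b where "a = add_mset x b" by (metis multi_member_split)
      then show ?thesis using a by simp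
    next
      case False
      then show ?thesis using a by (metis UnI1 add_mset_remove_trivial diff_single_trivial mem_Collect_eq subset_eq_diff_conv add_mset_add_single)
    qed
  qed
  then show ?case using add.IH by (meson finite_UnI finite_imageI finite_subset)
qed simp

lemma mpoly_ring_simps:
  "carrier (mpoly_ring R n) = {f. (\<forall>m. f m \<in> carrier R) \<and> finite {m. f m \<noteq> \<zero>\<^bsub>R\<^esub>} \<and>
                   (\<forall>m. f m \<noteq> \<zero>\<^bsub>R\<^esub> \<longrightarrow> set_mset m \<subseteq> {..<n})}"
  "\<zero>\<^bsub>mpoly_ring R n\<^esub> = (\<lambda>m. \<zero>\<^bsub>R\<^esub>)"
  "\<one>\<^bsub>mpoly_ring R n\<^esub> = (\<lambda>m. if m = {#} then \<one>\<^bsub>R\<^esub> else \<zero>\<^bsub>R\<^esub>)"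
  "f \<oplus>\<^bsub>mpoly_ring R n\<^esub> g = (\<lambda>m. f m \<oplus>\<^bsub>R\<^esub> g m)"
  "f \<otimes>\<^bsub>mpoly_ring R n\<^esub> g = (\<lambda>m. \<Oplus>\<^bsub>R\<^esub>a \<in> {a. a \<subseteq># m}. f a \<otimes>\<^bsub>R\<^esub> g (m - a))"
  by (simp_all add: mpoly_ring_def)

lemma (in cring) mpoly_ring_0:
  defines "h \<equiv> \<lambda>a m. if m = {#} then a else \<zero>"
  shows "cring (mpoly_ring R 0)" "ring_hom_cring R (mpoly_ring R 0) h"
    "h ` carrier R = carrier (mpoly_ring R 0)" "inj_on h (carrier R)"
proof -
  show im: "h ` carrier R = carrier (mpoly_ring R 0)"
  proof
    show "h ` carrier R \<subseteq> carrier (mpoly_ring R 0)"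
      by (auto simp: mpoly_ring_simps h_def split: if_splits)
    show "carrier (mpoly_ring R 0) \<subseteq> h ` carrier R"
    proof
      fix f assume f: "f \<in> carrier (mpoly_ring R 0)"
      then have "f = h (f {#})" by (auto simp: mpoly_ring_simps h_def fun_eq_iff)
      moreover have "f {#} \<in> carrier R" using f by (auto simp: mpoly_ring_simps)
      ultimately show "f \<in> h ` carrier R" by blast
    qed
  qed
  have hom: "h \<in> ring_hom R (mpoly_ring R 0)"
  proof (rule ring_hom_memI)
    fix x y assume xy: "x \<in> carrier R" "y \<in> carrier R"
    show "h (x \<otimes> y) = h x \<otimes>\<^bsub>mpoly_ring R 0\<^esub> h y"
    proof
      fix m :: "nat multiset"
      show "h (x \<otimes> y) m = (h x \<otimes>\<^bsub>mpoly_ring R 0\<^esub> h y) m"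
      proof (cases "m = {#}")
        case False
        then have "h x a \<otimes> h y (m - a) = \<zero>" if "a \<subseteq># m" for a
          using xy by (auto simp: h_def)
        then have "(\<Oplus>a \<in> {a. a \<subseteq># m}. h x a \<otimes> h y (m - a)) = (\<Oplus>a \<in> {a. a \<subseteq># m}. \<zero>)"
          by (intro finsum_cong') auto
        then show ?thesis using False by (simp add: mpoly_ring_simps h_def)
      qed (use xy in \<open>simp add: mpoly_ring_simps h_def\<close>)
    qed
  qed (use im in \<open>auto simp: mpoly_ring_simps h_def\<close>)
  have z: "h \<zero> = \<zero>\<^bsub>mpoly_ring R 0\<^esub>" by (auto simp: mpoly_ring_simps h_def)
  show "cring (mpoly_ring R 0)" "ring_hom_cring R (mpoly_ring R 0) h"
    using ring_hom_image_cring[OF hom im z] by auto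
  show "inj_on h (carrier R)" by (rule inj_onI) (metis h_def)
qed

lemma (in cring) mpoly_ring_finsum_apply:
  assumes "cring (mpoly_ring R n)" "finite A" "\<And>i. i \<in> A \<Longrightarrow> F i \<in> carrier (mpoly_ring R n)"
  shows "(finsum (mpoly_ring R n) F A) m = (\<Oplus>i\<in>A. F i m)"
proof -
  interpret M: cring "mpoly_ring R n" by fact
  show ?thesis using assms(2,3)
  proof (induction A)
    case (insert x B)
    then have "F x m \<in> carrier R" "(\<lambda>i. F i m) \<in> B \<rightarrow> carrier R"
      by (auto simp: mpoly_ring_simps)
    then show ?case using insert by (simp add: M.finsum_insert mpoly_ring_simps(4))
  qed (simp add: mpoly_ring_simps)
qed

text \<open>\<open>R[X\<^sub>0, \<dots>, X\<^sub>n] = R[X\<^sub>0, \<dots>, X\<^sub>n\<^sub>-\<^sub>1][X\<^sub>n]\<close>: in a monomial \<open>m\<close>, \<open>count m n\<close> is the exponent of \<open>X\<^sub>n\<close>.\<close>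

lemma (in cring) mpoly_ring_Suc:
  assumes M: "cring (mpoly_ring R n)"
  defines "h \<equiv> \<lambda>f m. f (count m n) (filter_mset (\<lambda>i. i \<noteq> n) m)"
  shows "cring (mpoly_ring R (Suc n))"
    "ring_hom_cring (UP (mpoly_ring R n)) (mpoly_ring R (Suc n)) h"
    "h ` carrier (UP (mpoly_ring R n)) = carrier (mpoly_ring R (Suc n))"
    "inj_on h (carrier (UP (mpoly_ring R n)))"
proof -
  interpret M: cring "mpoly_ring R n" by fact
  interpret U: UP_cring "mpoly_ring R n" "UP (mpoly_ring R n)" by unfold_locales
  let ?M = "mpoly_ring R n" let ?N = "mpoly_ring R (Suc n)" let ?U = "UP (mpoly_ring R n)"
  let ?r = "filter_mset (\<lambda>i. i \<noteq> n)"
  have split: "m = ?r m + replicate_mset (count m n) n" for m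
    by (rule multiset_eqI) auto
  have rrep: "?r (replicate_mset k n) = {#}" for k by (auto intro!: multiset_eqI)
  have rfix: "?r a = a" "count a n = 0" if "n \<notin># a" for a
    using that by (auto intro!: multiset_eqI simp: count_eq_zero_iff)
  have Uc: "f \<in> carrier ?U \<longleftrightarrow> (\<forall>k. f k \<in> carrier ?M) \<and> finite {k. f k \<noteq> (\<lambda>_. \<zero>)}" for f
    by (simp add: carrier_UP up_iff_finite mpoly_ring_simps(2))
  have vanish: "f k a = \<zero>" if "f \<in> carrier ?U" "n \<in># a" for f k a
    using that by (fastforce simp: Uc mpoly_ring_simps)
  have closed: "h f \<in> carrier ?N" if f: "f \<in> carrier ?U" for f
  proof -
    have fk: "f k \<in> carrier ?M" for k using f by (simp add: Uc)
    \<comment> \<open>A monomial in the support splits into its exponent k of the new variable and a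
      monomial in the support of the k-th coefficient; both range over finite sets.\<close>
    have "{m. h f m \<noteq> \<zero>} \<subseteq> (\<Union>k\<in>{k. f k \<noteq> (\<lambda>_. \<zero>)}. (\<lambda>a. a + replicate_mset k n) ` {a. f k a \<noteq> \<zero>})"
    proof
      fix m assume "m \<in> {m. h f m \<noteq> \<zero>}"
      then have "f (count m n) (?r m) \<noteq> \<zero>" by (simp add: h_def)
      then show "m \<in> (\<Union>k\<in>{k. f k \<noteq> (\<lambda>_. \<zero>)}. (\<lambda>a. a + replicate_mset k n) ` {a. f k a \<noteq> \<zero>})"
        using split[of m] by (intro UN_I[of "count m n"] image_eqI[of _ _ "?r m"]) auto
    qed
    moreover have "finite {a. f k a \<noteq> \<zero>}" for k using fk[of k] by (simp add: mpoly_ring_simps)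
    then have "finite (\<Union>k\<in>{k. f k \<noteq> (\<lambda>_. \<zero>)}. (\<lambda>a. a + replicate_mset k n) ` {a. f k a \<noteq> \<zero>})"
      using f by (intro finite_UN_I finite_imageI) (auto simp: Uc)
    ultimately have "finite {m. h f m \<noteq> \<zero>}" by (rule finite_subset)
    moreover have "set_mset m \<subseteq> {..<Suc n}" if "h f m \<noteq> \<zero>" for m
    proof
      fix i assume i: "i \<in># m"
      have "set_mset (?r m) \<subseteq> {..<n}" 
        using that fk[of "count m n"] unfolding mpoly_ring_simps h_def by blast
      then show "i \<in> {..<Suc n}" using i by (cases "i = n") (auto simp: less_Suc_eq)
    qed
    moreover have "h f m \<in> carrier R" for m using fk[of "count m n"] by (simp add: mpoly_ring_simps h_def)
    ultimately show ?thesis by (simp add: mpoly_ring_simps(1))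
  qed
  have mult: "h (f \<otimes>\<^bsub>?U\<^esub> g) = h f \<otimes>\<^bsub>?N\<^esub> h g" if f: "f \<in> carrier ?U" and g: "g \<in> carrier ?U" for f g
  proof
    fix m
    let ?k = "count m n"
    have fk: "f k \<in> carrier ?M" "g k \<in> carrier ?M" for k using f g by (simp_all add: Uc)
    then have fR: "f k a \<in> carrier R" "g k a \<in> carrier R" for k a by (simp_all add: mpoly_ring_simps)
    let ?t = "\<lambda>b. h f b \<otimes> h g (m - b)"
    have t: "?t b \<in> carrier R" for b using fR by (simp add: h_def)
    have "h (f \<otimes>\<^bsub>?U\<^esub> g) m = (finsum ?M (\<lambda>i. f i \<otimes>\<^bsub>?M\<^esub> g (?k - i)) {..?k}) (?r m)"
      using f g by (simp add: mult_UP carrier_UP h_def)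
    also have "\<dots> = (\<Oplus>i\<in>{..?k}. (f i \<otimes>\<^bsub>?M\<^esub> g (?k - i)) (?r m))"
      by (rule mpoly_ring_finsum_apply[OF M]) (use fk in auto)
    \<comment> \<open>The divisors b of the monomial m are grouped by their exponent i of the new
      variable. Within a group, removing that variable is a bijection onto the divisors of the
      remaining monomial, which gives the product of the coefficients of degrees i and
      \<open>?k - i\<close>.\<close>
    also have "\<dots> = (\<Oplus>i\<in>{..?k}. \<Oplus>b\<in>{b. b \<subseteq># m \<and> count b n = i}. ?t b)"
    proof (rule finsum_cong'[OF refl])
      fix i assume i: "i \<in> {..?k}"
      let ?e = "\<lambda>a. a + replicate_mset i n"
      have e: "?e ` {a. a \<subseteq># ?r m} = {b. b \<subseteq># m \<and> count b n = i}"
      proof safe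
        fix a assume a: "a \<subseteq># ?r m"
        then have na: "n \<notin># a" using mset_subset_eqD[OF a, of n] by auto
        have "a + replicate_mset i n \<subseteq># ?r m + replicate_mset ?k n"
          using a i by (intro subset_mset.add_mono) (auto simp: replicate_mset_msubseteq_iff)
        then show "?e a \<subseteq># m" using split[of m] by simp
        show "count (?e a) n = i" using na by (simp add: not_in_iff)
      next
        fix b assume b: "b \<subseteq># m" "i = count b n"
        show "b \<in> (\<lambda>a. a + replicate_mset (count b n) n) ` {a. a \<subseteq># ?r m}"
          using split[of b] b by (intro image_eqI[of _ _ "?r b"]) (auto intro: multiset_filter_mono)
      qed
      have "inj_on ?e {a. a \<subseteq># ?r m}" by (auto simp: inj_on_def)
      then have "(\<Oplus>b\<in>{b. b \<subseteq># m \<and> count b n = i}. ?t b) = (\<Oplus>a\<in>{a. a \<subseteq># ?r m}. ?t (?e a))"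
        unfolding e[symmetric] by (intro add.finprod_reindex) (use t in auto)
      also have "\<dots> = (\<Oplus>a\<in>{a. a \<subseteq># ?r m}. f i a \<otimes> g (?k - i) (?r m - a))"
      proof (rule finsum_cong'[OF refl])
        fix a assume "a \<in> {a. a \<subseteq># ?r m}"
        then have na: "n \<notin># a" using mset_subset_eqD[of a "?r m" n] by auto
        then show "?t (?e a) = f i a \<otimes> g (?k - i) (?r m - a)"
          using rfix[OF na] by (simp add: h_def rrep)
      qed (use fR in auto)
      also have "\<dots> = (f i \<otimes>\<^bsub>?M\<^esub> g (?k - i)) (?r m)" by (simp add: mpoly_ring_simps)
      finally show "(f i \<otimes>\<^bsub>?M\<^esub> g (?k - i)) (?r m) = (\<Oplus>b\<in>{b. b \<subseteq># m \<and> count b n = i}. ?t b)" ..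
    qed (use t in auto)
    also have "\<dots> = (\<Oplus>b\<in>(\<Union>i\<in>{..?k}. {b. b \<subseteq># m \<and> count b n = i}). ?t b)"
      by (rule add.finprod_UN_disjoint[symmetric])
        (use t in \<open>auto simp: pairwise_def disjnt_def intro: finite_subset[OF _ finite_subset_mset[of m]]\<close>)
    also have "(\<Union>i\<in>{..?k}. {b. b \<subseteq># m \<and> count b n = i}) = {b. b \<subseteq># m}"
      by (auto intro: mset_subset_eq_count)
    finally show "h (f \<otimes>\<^bsub>?U\<^esub> g) m = (h f \<otimes>\<^bsub>?N\<^esub> h g) m" by (simp add: mpoly_ring_simps)
  qed
  have hom: "h \<in> ring_hom ?U ?N"
  proof (rule ring_hom_memI)
    fix f g assume "f \<in> carrier ?U" "g \<in> carrier ?U"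
    then show "h (f \<oplus>\<^bsub>?U\<^esub> g) = h f \<oplus>\<^bsub>?N\<^esub> h g"
      by (simp add: add_UP carrier_UP mpoly_ring_simps h_def)
  next
    have one: "\<one>\<^bsub>?U\<^esub> k = (if k = 0 then \<one>\<^bsub>?M\<^esub> else \<zero>\<^bsub>?M\<^esub>)" for k by (simp add: UP_def)
    have "h \<one>\<^bsub>?U\<^esub> m = \<one>\<^bsub>?N\<^esub> m" for m
    proof (cases "count m n = 0 \<and> ?r m = {#}")
      case True
      then have "m = {#}" using split[of m] by (metis add.right_neutral replicate_mset_0)
      then show ?thesis by (simp add: h_def one mpoly_ring_simps(3))
    next
      case False
      then have "m \<noteq> {#}" by auto
      then show ?thesis using False
        unfolding h_def one mpoly_ring_simps(2,3) by (cases "count m n = 0") (simp_all only: if_False if_True HOL.simp_thms)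
    qed
    then show "h \<one>\<^bsub>?U\<^esub> = \<one>\<^bsub>?N\<^esub>" by (rule ext)
  qed (use closed mult in auto)
  have z: "h \<zero>\<^bsub>?U\<^esub> = \<zero>\<^bsub>?N\<^esub>" by (simp add: UP_def mpoly_ring_simps h_def)
  show im: "h ` carrier ?U = carrier ?N"
  proof
    show "carrier ?N \<subseteq> h ` carrier ?U"
    proof
      fix g assume g: "g \<in> carrier ?N"
      \<comment> \<open>The coefficients must be polynomials in the first \<open>n\<close>
        variables, hence zero on monomials that contain the new one.\<close>
      define f where "f k a = (if n \<in># a then \<zero> else g (a + replicate_mset k n))" for k a
      have gR: "g m \<in> carrier R" "finite {m. g m \<noteq> \<zero>}" "g m \<noteq> \<zero> \<Longrightarrow> set_mset m \<subseteq> {..<Suc n}" for m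
        using g by (simp_all add: mpoly_ring_simps(1))
      have "f k \<in> carrier ?M" for k
        unfolding mpoly_ring_simps(1)
      proof (intro CollectI conjI allI impI)
        have "{a. f k a \<noteq> \<zero>} \<subseteq> (\<lambda>a. a + replicate_mset k n) -` {m. g m \<noteq> \<zero>}" by (auto simp: f_def)
        moreover have "finite ((\<lambda>a. a + replicate_mset k n) -` {m. g m \<noteq> \<zero>})"
          by (rule finite_vimageI[OF gR(2)]) (auto simp: inj_on_def)
        ultimately show "finite {a. f k a \<noteq> \<zero>}" by (rule finite_subset)
        fix a assume "f k a \<noteq> \<zero>"
        then have a: "n \<notin># a" "g (a + replicate_mset k n) \<noteq> \<zero>" by (auto simp: f_def split: if_splits)
        then have "set_mset a \<subseteq> {..<Suc n}" using gR(3)[OF a(2)] by auto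
        then show "set_mset a \<subseteq> {..<n}" using a(1) by (force simp: less_Suc_eq)
      qed (use gR in \<open>simp add: f_def\<close>)
      moreover have "{k. f k \<noteq> (\<lambda>_. \<zero>)} \<subseteq> (\<lambda>m. count m n) ` {m. g m \<noteq> \<zero>}"
      proof
        fix k assume "k \<in> {k. f k \<noteq> (\<lambda>_. \<zero>)}"
        then obtain a where "f k a \<noteq> \<zero>" by (auto simp: fun_eq_iff)
        then have "n \<notin># a" "g (a + replicate_mset k n) \<noteq> \<zero>" by (auto simp: f_def split: if_splits)
        then show "k \<in> (\<lambda>m. count m n) ` {m. g m \<noteq> \<zero>}"
          by (intro image_eqI[of _ _ "a + replicate_mset k n"]) (auto simp: not_in_iff)
      qed
      then have "finite {k. f k \<noteq> (\<lambda>_. \<zero>)}" using gR(2) by (meson finite_imageI finite_subset)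
      ultimately have "f \<in> carrier ?U" by (simp add: Uc)
      moreover have "h f = g"
      proof
        fix m show "h f m = g m" using split[of m] by (simp add: h_def f_def)
      qed
      ultimately show "g \<in> h ` carrier ?U" by blast
    qed
  qed (use closed in auto)
  show "cring ?N" "ring_hom_cring ?U ?N h"
    using U.P.ring_hom_image_cring[OF hom im z] by auto
  show "inj_on h (carrier ?U)"
  proof (rule inj_onI)
    fix f g assume fg: "f \<in> carrier ?U" "g \<in> carrier ?U" "h f = h g"
    have "f k a = g k a" for k a
    proof (cases "n \<in># a")
      case False
      then show ?thesis using fun_cong[OF fg(3), of "a + replicate_mset k n"] rfix[OF False] rrep
        by (simp add: h_def)
    qed (simp add: vanish[OF fg(1)] vanish[OF fg(2)])
    then show "f = g" by (intro ext)
  qed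
qed

text \<open>The induction carries the three claims together: the ring must be a domain for the lower
  bound to gain one with each variable, and the local bound, from which the upper one will follow,
  gains one as well.\<close>

lemma (in domain) mpoly_ring_domain:
  assumes "locally_noetherian_dim R d"
  shows "domain (mpoly_ring R n) \<and> locally_noetherian_dim (mpoly_ring R n) (d + enat n) \<and>
    krull_dim R + enat n \<le> krull_dim (mpoly_ring R n)"
proof (induction n)
  case 0
  interpret h: ring_hom_cring R "mpoly_ring R 0" "\<lambda>a m. if m = {#} then a else \<zero>"
    by (rule mpoly_ring_0)
  have "krull_dim R \<le> krull_dim (mpoly_ring R 0)"
    by (rule h.krull_dim_le_of_surj_inj[OF mpoly_ring_0(3,4)])
  then show ?case
    using h.domain_of_surj_inj[OF domain_axioms mpoly_ring_0(3,4)]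
      h.locally_noetherian_surj[OF _ assms] mpoly_ring_0(3) by (simp add: zero_enat_def[symmetric])
next
  case (Suc n)
  let ?M = "mpoly_ring R n" let ?N = "mpoly_ring R (Suc n)"
  interpret M: domain ?M using Suc by simp
  interpret U: UP_domain ?M "UP ?M" by unfold_locales
  note S = mpoly_ring_Suc[OF M.is_cring]
  interpret h: ring_hom_cring "UP ?M" ?N "\<lambda>f m. f (count m n) (filter_mset (\<lambda>i. i \<noteq> n) m)"
    by (rule S(2))
  have "krull_dim (UP ?M) \<le> krull_dim ?N"
    by (rule h.krull_dim_le_of_surj_inj[OF S(3,4)])
  moreover have "krull_dim R + enat (Suc n) \<le> krull_dim ?M + 1"
    using Suc add_right_mono[of "krull_dim R + enat n" "krull_dim ?M" 1]
    by (simp add: ac_simps one_enat_def) 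
  moreover have "krull_dim ?M + 1 \<le> krull_dim (UP ?M)" by (rule U.krull_dim_UP_ge)
  moreover have "locally_noetherian_dim ?N (d + enat n + 1)"
    using h.locally_noetherian_surj[OF _ U.locally_noetherian_UP] Suc S(3) by simp
  moreover have "domain ?N" by (rule h.domain_of_surj_inj[OF U.UP_domain S(3,4)])
  ultimately show ?case by (auto simp: one_enat_def ac_simps)
qed

text \<open>With the dimension itself as local bound, the upper and lower estimates for each
  polynomial ring coincide.\<close>

lemma (in domain) jaffard_domainI:
  assumes "locally_noetherian_dim R (krull_dim R)" "krull_dim R < \<infinity>"
  shows "jaffard_domain R"
  unfolding jaffard_domain_def
proof (intro conjI allI impI domain_axioms assms(2))
  fix n :: nat
  note m = mpoly_ring_domain[OF assms(1), of n]
  interpret M: domain "mpoly_ring R n" using m by simp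
  show "krull_dim (mpoly_ring R n) = enat n + krull_dim R"
    using m M.locally_noetherian_krull_dim by (auto simp: add.commute intro: antisym)
qed

subsection \<open>Localization of a domain\<close>

locale domain_localization = "domain" R for R (structure) +
  fixes S
  assumes S_closed: "\<And>s. s \<in> S \<Longrightarrow> s \<in> carrier R" and S_nonzero: "\<zero> \<notin> S"
    and S_one: "\<one> \<in> S" and S_mult: "\<And>s t. s \<in> S \<Longrightarrow> t \<in> S \<Longrightarrow> s \<otimes> t \<in> S"
begin

abbreviation "fraction \<equiv> loc_frac R S"
abbreviation "L \<equiv> localization R S"

text \<open>In a domain the auxiliary factor from \<open>S\<close> is nonzero and cancels, so
  equality of fractions is cross-multiplication.\<close>

lemma loc_rel_iff:
  "((a, s), (b, t)) \<in> loc_rel R S \<longleftrightarrow>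
    a \<in> carrier R \<and> s \<in> S \<and> b \<in> carrier R \<and> t \<in> S \<and> a \<otimes> t = b \<otimes> s"
proof -
  have "w \<otimes> (a \<otimes> t) = w \<otimes> (b \<otimes> s) \<longleftrightarrow> a \<otimes> t = b \<otimes> s"
    if "w \<in> S" "a \<in> carrier R" "s \<in> S" "b \<in> carrier R" "t \<in> S" for w
    using that S_closed S_nonzero by (subst m_lcancel) auto
  then show ?thesis unfolding loc_rel_def using S_one by blast
qed

lemma equiv_loc_rel: "equiv (carrier R \<times> S) (loc_rel R S)"
proof (rule equivI)
  show "trans (loc_rel R S)"
  proof (rule transI, clarify)
    fix a s b t c w
    assume "((a, s), (b, t)) \<in> loc_rel R S" "((b, t), (c, w)) \<in> loc_rel R S"
    then have h: "a \<in> carrier R" "s \<in> S" "b \<in> carrier R" "t \<in> S" "c \<in> carrier R" "w \<in> S"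
      "a \<otimes> t = b \<otimes> s" "b \<otimes> w = c \<otimes> t" by (auto simp: loc_rel_iff)
    then have c: "s \<in> carrier R" "t \<in> carrier R" "w \<in> carrier R" "t \<noteq> \<zero>" using S_closed S_nonzero by auto
    have "t \<otimes> (a \<otimes> w) = (a \<otimes> t) \<otimes> w" using h(1) c(2,3) by algebra
    also have "\<dots> = (b \<otimes> w) \<otimes> s" unfolding h(7) using h(3) c(1,3) by algebra
    also have "\<dots> = t \<otimes> (c \<otimes> s)" unfolding h(8) using h(5) c(1,2) by algebra
    finally have "a \<otimes> w = c \<otimes> s" using c h m_lcancel[of t "a \<otimes> w" "c \<otimes> s"] by auto
    then show "((a, s), (c, w)) \<in> loc_rel R S" using h by (simp add: loc_rel_iff)
  qed
qed (auto simp: refl_on_def sym_def loc_rel_iff)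

lemma frac_eq_iff:
  assumes "a \<in> carrier R" "s \<in> S" "b \<in> carrier R" "t \<in> S"
  shows "fraction a s = fraction b t \<longleftrightarrow> a \<otimes> t = b \<otimes> s"
  unfolding loc_frac_def using eq_equiv_class_iff[OF equiv_loc_rel] assms
  by (simp add: loc_rel_iff)

lemma carrier_L: "carrier L = {fraction a s | a s. a \<in> carrier R \<and> s \<in> S}"
  by (simp add: localization_def)

lemma frac_closed: "a \<in> carrier R \<Longrightarrow> s \<in> S \<Longrightarrow> fraction a s \<in> carrier L"
  unfolding carrier_L by blast

lemma L_cases:
  assumes "x \<in> carrier L"
  obtains a s where "a \<in> carrier R" "s \<in> S" "x = fraction a s"
  using assms unfolding carrier_L by blast

lemma zero_L: "\<zero>\<^bsub>L\<^esub> = fraction \<zero> \<one>" and one_L: "\<one>\<^bsub>L\<^esub> = fraction \<one> \<one>"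
  by (simp_all add: localization_def)

lemma frac_memD:
  assumes "(b, t) \<in> fraction a s" "a \<in> carrier R" "s \<in> S"
  shows "b \<in> carrier R" "t \<in> S" "fraction b t = fraction a s"
  using assms frac_eq_iff[of b t a s] unfolding loc_frac_def by (auto simp: loc_rel_iff)

lemma frac_self: "a \<in> carrier R \<Longrightarrow> s \<in> S \<Longrightarrow> (a, s) \<in> fraction a s"
  by (simp add: loc_frac_def loc_rel_iff)

text \<open>The operations of \<open>localization\<close> are unions over all representatives; such
  a union collapses to one term once the value is independent of the representatives.\<close>

lemma frac_union:
  assumes "a \<in> carrier R" "s \<in> S" "b \<in> carrier R" "t \<in> S"
    and "\<And>a' s' b' t'. (a', s') \<in> fraction a s \<Longrightarrow> (b', t') \<in> fraction b t \<Longrightarrow> F a' s' b' t' = F a s b t"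
  shows "(\<Union>(a', s')\<in>fraction a s. \<Union>(b', t')\<in>fraction b t. F a' s' b' t') = F a s b t"
proof -
  have "(\<Union>(a', s')\<in>fraction a s. \<Union>(b', t')\<in>fraction b t. F a' s' b' t')
    = (\<Union>z\<in>fraction a s. \<Union>w\<in>fraction b t. F a s b t)"
    using assms(5) by (intro SUP_cong) auto
  also have "\<dots> = F a s b t" using frac_self assms(1-4) by auto
  finally show ?thesis .
qed

lemma mult_L:
  assumes "a \<in> carrier R" "s \<in> S" "b \<in> carrier R" "t \<in> S"
  shows "fraction a s \<otimes>\<^bsub>L\<^esub> fraction b t = fraction (a \<otimes> b) (s \<otimes> t)"
proof -
  have "fraction (a' \<otimes> b') (s' \<otimes> t') = fraction (a \<otimes> b) (s \<otimes> t)"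
    if "(a', s') \<in> fraction a s" "(b', t') \<in> fraction b t" for a' s' b' t'
  proof -
    note A = frac_memD[OF that(1) assms(1,2)] and B = frac_memD[OF that(2) assms(3,4)]
    have e: "a' \<otimes> s = a \<otimes> s'" "b' \<otimes> t = b \<otimes> t'"
      using A(3) B(3) frac_eq_iff A(1,2) B(1,2) assms by simp_all
    have c: "s \<in> carrier R" "t \<in> carrier R" "s' \<in> carrier R" "t' \<in> carrier R" using S_closed assms A B by auto
    have "a' \<otimes> b' \<otimes> (s \<otimes> t) = (a' \<otimes> s) \<otimes> (b' \<otimes> t)" using A(1) B(1) c by algebra
    also have "\<dots> = a \<otimes> b \<otimes> (s' \<otimes> t')" unfolding e using assms(1,3) c by algebra
    finally show ?thesis using A B assms S_mult by (simp add: frac_eq_iff)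
  qed
  then show ?thesis
    unfolding localization_def monoid.simps by (rule frac_union[OF assms])
qed

lemma add_L:
  assumes "a \<in> carrier R" "s \<in> S" "b \<in> carrier R" "t \<in> S"
  shows "fraction a s \<oplus>\<^bsub>L\<^esub> fraction b t = fraction (a \<otimes> t \<oplus> b \<otimes> s) (s \<otimes> t)"
proof -
  have "fraction (a' \<otimes> t' \<oplus> b' \<otimes> s') (s' \<otimes> t') = fraction (a \<otimes> t \<oplus> b \<otimes> s) (s \<otimes> t)"
    if "(a', s') \<in> fraction a s" "(b', t') \<in> fraction b t" for a' s' b' t'
  proof -
    note A = frac_memD[OF that(1) assms(1,2)] and B = frac_memD[OF that(2) assms(3,4)]
    have e: "a' \<otimes> s = a \<otimes> s'" "b' \<otimes> t = b \<otimes> t'"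
      using A(3) B(3) frac_eq_iff A(1,2) B(1,2) assms by simp_all
    have c: "s \<in> carrier R" "t \<in> carrier R" "s' \<in> carrier R" "t' \<in> carrier R" using S_closed assms A B by auto
    have "(a' \<otimes> t' \<oplus> b' \<otimes> s') \<otimes> (s \<otimes> t) = (a' \<otimes> s) \<otimes> (t' \<otimes> t) \<oplus> (b' \<otimes> t) \<otimes> (s' \<otimes> s)"
      using A(1) B(1) c by algebra
    also have "\<dots> = (a \<otimes> t \<oplus> b \<otimes> s) \<otimes> (s' \<otimes> t')" unfolding e using assms(1,3) c by algebra
    finally show ?thesis using A B assms S_mult c by (simp add: frac_eq_iff)
  qed
  then show ?thesis
    unfolding localization_def ring.simps by (rule frac_union[OF assms])
qed

lemma cring_L: "cring L"
proof (rule cringI)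
  show "abelian_group L"
  proof (rule abelian_groupI)
    show "\<zero>\<^bsub>L\<^esub> \<in> carrier L" unfolding zero_L by (simp add: frac_closed S_one)
  next
    fix x assume "x \<in> carrier L"
    then obtain a s where x: "a \<in> carrier R" "s \<in> S" "x = fraction a s" by (rule L_cases)
    have sc: "s \<in> carrier R" using S_closed x by auto
    show "\<zero>\<^bsub>L\<^esub> \<oplus>\<^bsub>L\<^esub> x = x"
      unfolding zero_L x(3) using x(1,2) sc S_one by (simp add: add_L)
    have "fraction (\<ominus> a) s \<oplus>\<^bsub>L\<^esub> x = \<zero>\<^bsub>L\<^esub>"
      unfolding zero_L x(3) using x(1,2) sc S_one S_mult
      by (simp add: add_L frac_eq_iff l_minus l_neg)
    then show "\<exists>y\<in>carrier L. y \<oplus>\<^bsub>L\<^esub> x = \<zero>\<^bsub>L\<^esub>"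
      using x(1,2) by (intro bexI[of _ "fraction (\<ominus> a) s"]) (auto intro!: frac_closed)
  next
    fix x y assume "x \<in> carrier L" "y \<in> carrier L"
    then obtain a s b t where x: "a \<in> carrier R" "s \<in> S" "x = fraction a s"
      and y: "b \<in> carrier R" "t \<in> S" "y = fraction b t" by (metis L_cases)
    have c: "s \<in> carrier R" "t \<in> carrier R" using S_closed x y by auto
    show "x \<oplus>\<^bsub>L\<^esub> y \<in> carrier L" unfolding x(3) y(3) using x(1,2) y(1,2) c
      by (simp add: add_L frac_closed S_mult)
    show "x \<oplus>\<^bsub>L\<^esub> y = y \<oplus>\<^bsub>L\<^esub> x" unfolding x(3) y(3) using x(1,2) y(1,2) c
      by (simp add: add_L a_comm m_comm)
    fix z assume "z \<in> carrier L"
    then obtain d w where z: "d \<in> carrier R" "w \<in> S" "z = fraction d w" by (rule L_cases)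
    have wc: "w \<in> carrier R" using S_closed z by auto
    have "(a \<otimes> t \<oplus> b \<otimes> s) \<otimes> w \<oplus> d \<otimes> (s \<otimes> t) = a \<otimes> (t \<otimes> w) \<oplus> (b \<otimes> w \<oplus> d \<otimes> t) \<otimes> s"
      using x(1) y(1) z(1) c wc by algebra
    then show "x \<oplus>\<^bsub>L\<^esub> y \<oplus>\<^bsub>L\<^esub> z = x \<oplus>\<^bsub>L\<^esub> (y \<oplus>\<^bsub>L\<^esub> z)"
      unfolding x(3) y(3) z(3) using x(1,2) y(1,2) z(1,2) c wc
      by (simp add: add_L S_mult m_assoc)
  qed
  show "comm_monoid L"
  proof (rule comm_monoidI)
    show "\<one>\<^bsub>L\<^esub> \<in> carrier L" unfolding one_L by (simp add: frac_closed S_one)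
  next
    fix x assume "x \<in> carrier L"
    then obtain a s where x: "a \<in> carrier R" "s \<in> S" "x = fraction a s" by (rule L_cases)
    have sc: "s \<in> carrier R" using S_closed x by auto
    show "\<one>\<^bsub>L\<^esub> \<otimes>\<^bsub>L\<^esub> x = x"
      unfolding one_L x(3) using x(1,2) sc S_one by (simp add: mult_L)
  next
    fix x y assume "x \<in> carrier L" "y \<in> carrier L"
    then obtain a s b t where x: "a \<in> carrier R" "s \<in> S" "x = fraction a s"
      and y: "b \<in> carrier R" "t \<in> S" "y = fraction b t" by (metis L_cases)
    have c: "s \<in> carrier R" "t \<in> carrier R" using S_closed x y by auto
    show "x \<otimes>\<^bsub>L\<^esub> y \<in> carrier L" unfolding x(3) y(3) using x(1,2) y(1,2) c
      by (simp add: mult_L frac_closed S_mult)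
    show "x \<otimes>\<^bsub>L\<^esub> y = y \<otimes>\<^bsub>L\<^esub> x" unfolding x(3) y(3) using x(1,2) y(1,2) c
      by (simp add: mult_L m_comm)
    fix z assume "z \<in> carrier L"
    then obtain d w where z: "d \<in> carrier R" "w \<in> S" "z = fraction d w" by (rule L_cases)
    have wc: "w \<in> carrier R" using S_closed z by auto
    show "x \<otimes>\<^bsub>L\<^esub> y \<otimes>\<^bsub>L\<^esub> z = x \<otimes>\<^bsub>L\<^esub> (y \<otimes>\<^bsub>L\<^esub> z)"
      unfolding x(3) y(3) z(3) using x(1,2) y(1,2) z(1,2) c wc
      by (simp add: mult_L S_mult m_assoc)
  qed
  fix x y z assume "x \<in> carrier L" "y \<in> carrier L" "z \<in> carrier L"
  then obtain a s b t d w where x: "a \<in> carrier R" "s \<in> S" "x = fraction a s"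
    and y: "b \<in> carrier R" "t \<in> S" "y = fraction b t"
    and z: "d \<in> carrier R" "w \<in> S" "z = fraction d w" by (metis L_cases)
  have c: "s \<in> carrier R" "t \<in> carrier R" "w \<in> carrier R" using S_closed x y z by auto
  have "(a \<otimes> t \<oplus> b \<otimes> s) \<otimes> d \<otimes> ((s \<otimes> w) \<otimes> (t \<otimes> w))
     = ((a \<otimes> d) \<otimes> (t \<otimes> w) \<oplus> (b \<otimes> d) \<otimes> (s \<otimes> w)) \<otimes> ((s \<otimes> t) \<otimes> w)"
    using x(1) y(1) z(1) c by algebra
  then show "(x \<oplus>\<^bsub>L\<^esub> y) \<otimes>\<^bsub>L\<^esub> z = x \<otimes>\<^bsub>L\<^esub> z \<oplus>\<^bsub>L\<^esub> y \<otimes>\<^bsub>L\<^esub> z"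
    unfolding x(3) y(3) z(3) using x(1,2) y(1,2) z(1,2) c
    by (simp add: add_L mult_L S_mult frac_eq_iff)
qed

lemma frac_eq_zero: "a \<in> carrier R \<Longrightarrow> s \<in> S \<Longrightarrow> fraction a s = \<zero>\<^bsub>L\<^esub> \<longleftrightarrow> a = \<zero>"
  unfolding zero_L using S_closed S_one by (subst frac_eq_iff) auto

lemma domain_L: "domain L"
proof (rule domain.intro[OF cring_L], unfold_locales)
  show "\<one>\<^bsub>L\<^esub> \<noteq> \<zero>\<^bsub>L\<^esub>" unfolding one_L using frac_eq_zero[of \<one> \<one>] S_one by simp
  fix x y assume h: "x \<otimes>\<^bsub>L\<^esub> y = \<zero>\<^bsub>L\<^esub>" "x \<in> carrier L" "y \<in> carrier L"
  then obtain a s b t where x: "a \<in> carrier R" "s \<in> S" "x = fraction a s"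
    and y: "b \<in> carrier R" "t \<in> S" "y = fraction b t" by (metis L_cases)
  have "a \<otimes> b = \<zero>" using h(1) x(1,2) y(1,2) unfolding x(3) y(3) by (simp add: mult_L frac_eq_zero S_mult)
  then show "x = \<zero>\<^bsub>L\<^esub> \<or> y = \<zero>\<^bsub>L\<^esub>"
    using integral[of a b] x(1,2) y(1,2) unfolding x(3) y(3) by (auto simp: frac_eq_zero)
qed

sublocale L: "domain" L by (rule domain_L)

definition emb :: "'a \<Rightarrow> ('a \<times> 'a) set" where "emb a = fraction a \<one>"

lemma emb_hom: "ring_hom_cring R L emb"
  by (intro ring_hom_cringI is_cring cring_L ring_hom_memI)
    (auto simp: emb_def frac_closed mult_L add_L S_one one_L)

sublocale emb: ring_hom_cring R L emb by (rule emb_hom)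

lemma emb_eq_iff: "a \<in> carrier R \<Longrightarrow> b \<in> carrier R \<Longrightarrow> emb a = emb b \<longleftrightarrow> a = b"
  by (simp add: emb_def frac_eq_iff S_one)

lemma emb_mult_frac: "a \<in> carrier R \<Longrightarrow> s \<in> S \<Longrightarrow> emb s \<otimes>\<^bsub>L\<^esub> fraction a s = emb a"
  using S_closed by (simp add: emb_def mult_L S_one frac_eq_iff m_comm)

lemma frac_eq_mult: "a \<in> carrier R \<Longrightarrow> s \<in> S \<Longrightarrow> fraction a s = fraction \<one> s \<otimes>\<^bsub>L\<^esub> emb a"
  using S_closed by (simp add: emb_def mult_L S_one)

lemma extended_ideal:
  assumes I: "ideal I R"
  shows "Idl\<^bsub>L\<^esub> (emb ` I) = {fraction a s | a s. a \<in> I \<and> s \<in> S}"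
proof
  note Ic = ideal_closed[OF I]
  have sub: "emb ` I \<subseteq> carrier L" using Ic by auto
  have "ideal {fraction a s | a s. a \<in> I \<and> s \<in> S} L"
  proof (rule L.ideal_intro)
    show "{fraction a s | a s. a \<in> I \<and> s \<in> S} \<subseteq> carrier L" using Ic by (auto intro: frac_closed)
    show "\<zero>\<^bsub>L\<^esub> \<in> {fraction a s | a s. a \<in> I \<and> s \<in> S}" unfolding zero_L using Ic S_one by blast
    fix x assume "x \<in> {fraction a s | a s. a \<in> I \<and> s \<in> S}"
    then obtain a s where x: "a \<in> I" "s \<in> S" "x = fraction a s" by blast
    show "x \<oplus>\<^bsub>L\<^esub> y \<in> {fraction a s | a s. a \<in> I \<and> s \<in> S}" if yI: "y \<in> {fraction a s | a s. a \<in> I \<and> s \<in> S}" for y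
    proof -
      obtain b t where y: "b \<in> I" "t \<in> S" "y = fraction b t" using yI by blast
      have "x \<oplus>\<^bsub>L\<^esub> y = fraction (a \<otimes> t \<oplus> b \<otimes> s) (s \<otimes> t)"
        unfolding x y using x(1,2) y(1,2) Ic by (intro add_L) auto
      moreover have "a \<otimes> t \<oplus> b \<otimes> s \<in> I" "s \<otimes> t \<in> S" using x y Ic S_closed S_mult by auto
      ultimately show ?thesis by blast
    qed
    show "r \<otimes>\<^bsub>L\<^esub> x \<in> {fraction a s | a s. a \<in> I \<and> s \<in> S}" if rL: "r \<in> carrier L" for r
    proof -
      obtain b t where r: "b \<in> carrier R" "t \<in> S" "r = fraction b t" using L_cases[OF rL] by blast
      have "r \<otimes>\<^bsub>L\<^esub> x = fraction (b \<otimes> a) (t \<otimes> s)"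
        unfolding x r using x(1,2) r(1,2) Ic by (intro mult_L) auto
      moreover have "b \<otimes> a \<in> I" "t \<otimes> s \<in> S" using x r Ic S_mult by auto
      ultimately show ?thesis by blast
    qed
  qed
  moreover have "emb ` I \<subseteq> {fraction a s | a s. a \<in> I \<and> s \<in> S}" unfolding emb_def using S_one by blast
  ultimately show "Idl\<^bsub>L\<^esub> (emb ` I) \<subseteq> {fraction a s | a s. a \<in> I \<and> s \<in> S}" by (rule L.genideal_minimal)
  have "fraction a s \<in> Idl\<^bsub>L\<^esub> (emb ` I)" if "a \<in> I" "s \<in> S" for a s
  proof -
    have "emb a \<in> Idl\<^bsub>L\<^esub> (emb ` I)" using L.genideal_self[OF sub] that by auto
    then show ?thesis
      using L.ideal_closed(6)[OF L.genideal_ideal[OF sub], of "emb a" "fraction \<one> s"] frac_eq_mult[of a s] that Ic(2)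
      by (simp add: frac_closed)
  qed
  then show "{fraction a s | a s. a \<in> I \<and> s \<in> S} \<subseteq> Idl\<^bsub>L\<^esub> (emb ` I)" by blast
qed

lemma emb_mem_extended_ideal:
  assumes I: "ideal I R" and a: "a \<in> carrier R"
  shows "emb a \<in> Idl\<^bsub>L\<^esub> (emb ` I) \<longleftrightarrow> (\<exists>s\<in>S. s \<otimes> a \<in> I)"
proof
  note Ic = ideal_closed[OF I]
  assume "emb a \<in> Idl\<^bsub>L\<^esub> (emb ` I)"
  then obtain b s where b: "b \<in> I" "s \<in> S" "emb a = fraction b s" unfolding extended_ideal[OF I] by blast
  then have "a \<otimes> s = b" using a Ic unfolding emb_def by (simp add: frac_eq_iff S_one)
  then show "\<exists>s\<in>S. s \<otimes> a \<in> I" using b a S_closed by (metis m_comm)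
next
  note Ic = ideal_closed[OF I]
  assume "\<exists>s\<in>S. s \<otimes> a \<in> I"
  then obtain s where s: "s \<in> S" "s \<otimes> a \<in> I" by blast
  have "emb a = fraction (s \<otimes> a) s" using a s S_closed unfolding emb_def by (simp add: frac_eq_iff S_one m_comm)
  then show "emb a \<in> Idl\<^bsub>L\<^esub> (emb ` I)" unfolding extended_ideal[OF I] using s by blast
qed

end

text \<open>The correspondence applied to the embedding into the localization: its kernel is zero,
  and the image of \<open>v\<close> is a unit, contained in no prime.\<close>

lemma (in "domain") prime_chain_localization_powers:
  assumes v: "v \<in> carrier R" "v \<noteq> \<zero>"
  shows "(\<exists>P. prime_chain (localization R (powers R v)) P n) \<longleftrightarrow> (\<exists>P. prime_chain R P n \<and> v \<notin> P n)"
proof -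
  have nz: "v [^] (k::nat) \<noteq> \<zero>" for k using v by (induction k) (auto simp: integral_iff)
  interpret loc: domain_localization R "powers R v"
  proof unfold_locales
    show "\<one> \<in> powers R v" unfolding powers_def using nat_pow_0[of v] by (metis (mono_tags, lifting) mem_Collect_eq)
    show "\<zero> \<notin> powers R v" using nz unfolding powers_def by force
    fix s assume "s \<in> powers R v"
    then obtain k :: nat where k: "s = v [^] k" unfolding powers_def by blast
    then show "s \<in> carrier R" using v by simp
    fix t assume "t \<in> powers R v"
    then obtain l :: nat where l: "t = v [^] l" unfolding powers_def by blast
    have "s \<otimes> t = v [^] (k + l)" unfolding k l using v by (simp add: nat_pow_mult)
    then show "s \<otimes> t \<in> powers R v" unfolding powers_def by blast
  qed
  have vS: "v \<in> powers R v" unfolding powers_def using nat_pow_eone[OF v(1)] by (metis (mono_tags, lifting) mem_Collect_eq)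
  have "\<exists>k::nat. \<exists>r\<in>carrier R. loc.emb v [^]\<^bsub>loc.L\<^esub> k \<otimes>\<^bsub>loc.L\<^esub> d = loc.emb r" if d: "d \<in> carrier loc.L" for d
  proof -
    obtain a s where a: "a \<in> carrier R" "s \<in> powers R v" "d = loc.fraction a s" using loc.L_cases[OF d] .
    obtain k :: nat where k: "s = v [^] k" using a(2) unfolding powers_def by blast
    have "loc.emb v [^]\<^bsub>loc.L\<^esub> k \<otimes>\<^bsub>loc.L\<^esub> d = loc.emb a"
      using loc.emb_mult_frac[OF a(1,2)] v unfolding a(3) k by simp
    then show ?thesis using a by blast
  qed
  note corr = loc.emb.prime_chain_correspondence[OF v(1) this, of n]
  have "loc.emb v \<notin> P n" if P: "prime_chain loc.L P n" for P
  proof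
    assume "loc.emb v \<in> P n"
    have pr: "primeideal (P n) loc.L" using P by (simp add: prime_chain_def)
    have "loc.fraction \<one> v \<otimes>\<^bsub>loc.L\<^esub> loc.emb v \<in> P n"
      using loc.L.ideal_closed(6)[OF primeideal.axioms(1)[OF pr] \<open>loc.emb v \<in> P n\<close>] loc.frac_closed[OF one_closed vS] by blast
    moreover have "loc.fraction \<one> v \<otimes>\<^bsub>loc.L\<^esub> loc.emb v = \<one>\<^bsub>loc.L\<^esub>"
      using loc.emb_mult_frac[OF one_closed vS] v loc.frac_closed[OF one_closed vS] by (simp add: loc.L.m_comm)
    ultimately show False using loc.L.prime_one_notin[OF pr] by simp
  qed
  moreover have "a_kernel R loc.L loc.emb \<subseteq> P 0" if P: "prime_chain R P n" for P
  proof
    fix x assume "x \<in> a_kernel R loc.L loc.emb"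
    then have "x \<in> carrier R" "loc.emb x = loc.emb \<zero>" unfolding a_kernel_def' by auto
    then have "x = \<zero>" using loc.emb_eq_iff[of x \<zero>] by blast
    then show "x \<in> P 0" using ideal_closed(1)[OF primeideal.axioms(1), of "P 0"] P by (auto simp: prime_chain_def)
  qed
  ultimately show ?thesis using corr by blast
qed

subsection \<open>The associated graded ring as a quotient of the Rees ring\<close>

lemma UP_coeff: "f \<in> carrier (UP R) \<Longrightarrow> up_ring.coeff (UP R) f = f"
  by (simp add: UP_def)

lemma UP_monom: "a \<in> carrier R \<Longrightarrow> up_ring.monom (UP R) a n = (\<lambda>i. if i = n then a else \<zero>\<^bsub>R\<^esub>)"
  by (simp add: UP_def fun_eq_iff)

lemma UP_one: "\<one>\<^bsub>UP R\<^esub> = (\<lambda>i. if i = 0 then \<one>\<^bsub>R\<^esub> else \<zero>\<^bsub>R\<^esub>)"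
  and UP_zero: "\<zero>\<^bsub>UP R\<^esub> = (\<lambda>i. \<zero>\<^bsub>R\<^esub>)"
  by (simp_all add: UP_def)

locale ideal_filtration = cring R for R (structure) +
  fixes I :: "nat \<Rightarrow> 'a set"
  assumes I_ideal: "ideal (I n) R" and I_0: "I 0 = carrier R" and I_Suc: "I (Suc n) \<subseteq> I n"
    and I_mult: "x \<in> I i \<Longrightarrow> y \<in> I j \<Longrightarrow> x \<otimes> y \<in> I (i + j)"
begin

sublocale U: UP_cring R "UP R" by unfold_locales

lemmas I_closed = ideal_closed[OF I_ideal]

text \<open>The Rees ring, the sum of the I n X^n inside R[X]. Its ring laws are those of R[X], and
  the graded ring inherits them as an image.\<close>

definition rees_carrier :: "(nat \<Rightarrow> 'a) set" where
  "rees_carrier = {f \<in> carrier (UP R). \<forall>n. f n \<in> I n}"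

abbreviation "Rees \<equiv> (UP R)\<lparr>carrier := rees_carrier\<rparr>"
abbreviation "G \<equiv> assoc_graded R I"

definition initial_forms :: "(nat \<Rightarrow> 'a) \<Rightarrow> (nat \<Rightarrow> 'a set)" where
  "initial_forms f = (\<lambda>n. I (Suc n) +> f n)"

lemma rees_memI: "(\<And>n. f n \<in> I n) \<Longrightarrow> finite {n. f n \<noteq> \<zero>} \<Longrightarrow> f \<in> rees_carrier"
  using I_closed(2) unfolding rees_carrier_def carrier_UP up_iff_finite by blast

lemma rees_memD:
  assumes "f \<in> rees_carrier"
  shows "f \<in> carrier (UP R)" "f \<in> up R" "f n \<in> I n" "f n \<in> carrier R" "finite {n. f n \<noteq> \<zero>}"
  using assms by (auto simp: rees_carrier_def carrier_UP up_iff_finite)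

lemma subring_rees: "subring rees_carrier (UP R)"
proof (rule U.P.subringI)
  show "\<one>\<^bsub>UP R\<^esub> \<in> rees_carrier" 
    using I_closed(1) U.UP_one_closed by (auto simp: rees_carrier_def UP_one I_0)
  fix f assume f: "f \<in> rees_carrier"
  have "(\<ominus>\<^bsub>UP R\<^esub> f) n = \<ominus> f n" for n
    using U.coeff_a_inv[of f n] UP_coeff[of f R] UP_coeff[of "\<ominus>\<^bsub>UP R\<^esub> f" R] rees_memD(1)[OF f]
    by simp
  then show "\<ominus>\<^bsub>UP R\<^esub> f \<in> rees_carrier"
    using f I_closed(5) by (simp add: rees_carrier_def)
  fix g assume g: "g \<in> rees_carrier"
  show "f \<oplus>\<^bsub>UP R\<^esub> g \<in> rees_carrier"
    using f g I_closed(3) U.P.a_closed[of f g] by (auto simp: rees_carrier_def add_UP carrier_UP)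
  have "f i \<otimes> g (n - i) \<in> I n" if "i \<le> n" for i n
    using I_mult[of "f i" i "g (n - i)" "n - i"] rees_memD[OF f] rees_memD[OF g] that by simp
  then have "(f \<otimes>\<^bsub>UP R\<^esub> g) n \<in> I n" for n
    unfolding mult_UP[OF rees_memD(2)[OF f] rees_memD(2)[OF g]]
    by (intro ideal_finsum_closed[OF I_ideal]) auto
  then show "f \<otimes>\<^bsub>UP R\<^esub> g \<in> rees_carrier"
    using U.P.m_closed f g by (auto simp: rees_carrier_def)
qed (auto simp: rees_carrier_def)

sublocale Rees: cring Rees
  by (rule U.P.subring_cring[OF subring_rees])

lemma graded_prod_cosets:
  assumes x: "x \<in> I i" and y: "y \<in> I j" and n: "n = i + j"
  shows "graded_prod R I n (I (Suc i) +> x) (I (Suc j) +> y) = I (Suc n) +> (x \<otimes> y)"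
proof -
  have "I (Suc n) +> (x' \<otimes> y') = I (Suc n) +> (x \<otimes> y)"
    if x': "x' \<in> I (Suc i) +> x" and y': "y' \<in> I (Suc j) +> y" for x' y'
  proof -
    obtain h k where h: "h \<in> I (Suc i)" "x' = h \<oplus> x" and k: "k \<in> I (Suc j)" "y' = k \<oplus> y"
      using x' y' by (auto simp: a_r_coset_def')
    have c: "h \<in> carrier R" "k \<in> carrier R" "x \<in> carrier R" "y \<in> carrier R"
      using h k x y I_closed(2) by blast+
    \<comment> \<open>In each error term one factor lies one step deeper in the filtration than its
      degree requires, so the term lies in \<open>I (Suc n)\<close>.\<close>
    have "x' \<otimes> y' \<ominus> x \<otimes> y = h \<otimes> (k \<oplus> y) \<oplus> x \<otimes> k" unfolding h k using c by algebra
    moreover have "k \<oplus> y \<in> I j" using I_closed(3) k(1) y I_Suc by blast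
    then have "h \<otimes> (k \<oplus> y) \<in> I (Suc n)" "x \<otimes> k \<in> I (Suc n)"
      using I_mult[OF h(1), of "k \<oplus> y" j] I_mult[OF x k(1)] n by auto
    ultimately have "x' \<otimes> y' \<ominus> x \<otimes> y \<in> I (Suc n)" using I_closed(3) by simp
    then show ?thesis
      using quotient_eq_iff_same_a_r_cos[OF I_ideal, of "x' \<otimes> y'" "x \<otimes> y"] c h k by auto
  qed
  moreover have "x \<in> I (Suc i) +> x" "y \<in> I (Suc j) +> y"
    using I_closed(1)[of "Suc i"] I_closed(1)[of "Suc j"] I_closed(2)[OF x] I_closed(2)[OF y]
    by (auto simp: a_r_coset_def' intro!: bexI[of _ \<zero>])
  ultimately show ?thesis unfolding graded_prod_def by blast
qed

lemma G_simps:
  "carrier G = {f. (\<forall>n. \<exists>a\<in>I n. f n = I (Suc n) +> a) \<and> finite {n. f n \<noteq> I (Suc n)}}"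
  "f \<otimes>\<^bsub>G\<^esub> g = (\<lambda>n. \<Oplus>\<^bsub>R Quot I (Suc n)\<^esub>i \<in> {..n}. graded_prod R I n (f i) (g (n - i)))"
  "\<one>\<^bsub>G\<^esub> = homogeneous_form R I 0 \<one>" "\<zero>\<^bsub>G\<^esub> = (\<lambda>n. I (Suc n))"
  "f \<oplus>\<^bsub>G\<^esub> g = (\<lambda>n. f n \<oplus>\<^bsub>R Quot I (Suc n)\<^esub> g n)"
  by (simp_all add: assoc_graded_def)

lemma coset_eq_zero_iff: "a \<in> carrier R \<Longrightarrow> I n +> a = I n \<longleftrightarrow> a \<in> I n"
  using a_rcos_zero[OF I_ideal] ideal.rcos_const_imp_mem[OF I_ideal] by blast

lemma coset_hom: "ring_hom_cring R (R Quot I n) ((+>) (I n))"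
  by (rule ideal.rcos_ring_hom_cring[OF I_ideal is_cring])

lemma initial_forms_hom: "initial_forms \<in> ring_hom Rees G"
proof (rule ring_hom_memI)
  fix f assume "f \<in> carrier Rees"
  then have f: "f \<in> rees_carrier" by simp
  have "{n. initial_forms f n \<noteq> I (Suc n)} \<subseteq> {n. f n \<noteq> \<zero>}"
    unfolding initial_forms_def using coset_eq_zero_iff[OF zero_closed] I_closed(1) by auto
  then have "finite {n. initial_forms f n \<noteq> I (Suc n)}" using rees_memD(5)[OF f] by (rule finite_subset)
  then show "initial_forms f \<in> carrier G"
    using rees_memD(3)[OF f] by (auto simp: G_simps initial_forms_def)
  fix g assume "g \<in> carrier Rees"
  then have g: "g \<in> rees_carrier" by simp
  show "initial_forms (f \<oplus>\<^bsub>Rees\<^esub> g) = initial_forms f \<oplus>\<^bsub>G\<^esub> initial_forms g"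
  proof
    fix n
    interpret q: ring_hom_cring R "R Quot I (Suc n)" "(+>) (I (Suc n))" by (rule coset_hom)
    show "initial_forms (f \<oplus>\<^bsub>Rees\<^esub> g) n = (initial_forms f \<oplus>\<^bsub>G\<^esub> initial_forms g) n"
      using q.hom_add rees_memD(2,4)[OF f] rees_memD(2,4)[OF g]
      by (simp add: initial_forms_def add_UP G_simps)
  qed
  show "initial_forms (f \<otimes>\<^bsub>Rees\<^esub> g) = initial_forms f \<otimes>\<^bsub>G\<^esub> initial_forms g"
  proof
    fix n
    interpret q: ring_hom_cring R "R Quot I (Suc n)" "(+>) (I (Suc n))" by (rule coset_hom)
    have c: "(\<lambda>i. f i \<otimes> g (n - i)) \<in> {..n} \<rightarrow> carrier R"
      using rees_memD(4)[OF f] rees_memD(4)[OF g] by auto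
    have "initial_forms (f \<otimes>\<^bsub>Rees\<^esub> g) n = (\<Oplus>\<^bsub>R Quot I (Suc n)\<^esub>i\<in>{..n}. I (Suc n) +> (f i \<otimes> g (n - i)))"
      using q.hom_finsum[OF c] rees_memD(2)[OF f] rees_memD(2)[OF g]
      by (simp add: initial_forms_def mult_UP comp_def)
    also have "\<dots> = (\<Oplus>\<^bsub>R Quot I (Suc n)\<^esub>i\<in>{..n}. graded_prod R I n (initial_forms f i) (initial_forms g (n - i)))"
    proof (rule q.S.finsum_cong'[OF refl])
      have e: "graded_prod R I n (initial_forms f i) (initial_forms g (n - i)) = I (Suc n) +> (f i \<otimes> g (n - i))"
        if "i \<in> {..n}" for i
        unfolding initial_forms_def
        by (rule graded_prod_cosets) (use rees_memD(3)[OF f] rees_memD(3)[OF g] that in auto)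
      then show "I (Suc n) +> (f i \<otimes> g (n - i)) = graded_prod R I n (initial_forms f i) (initial_forms g (n - i))"
        if "i \<in> {..n}" for i using that by simp
      show "(\<lambda>i. graded_prod R I n (initial_forms f i) (initial_forms g (n - i))) \<in> {..n} \<rightarrow> carrier (R Quot I (Suc n))"
        using c by (intro funcsetI) (simp only: e, intro q.hom_closed, auto)
    qed
    finally show "initial_forms (f \<otimes>\<^bsub>Rees\<^esub> g) n = (initial_forms f \<otimes>\<^bsub>G\<^esub> initial_forms g) n"
      by (simp add: G_simps)
  qed
next
  have "initial_forms \<one>\<^bsub>Rees\<^esub> n = \<one>\<^bsub>G\<^esub> n" for n
    using coset_eq_zero_iff[OF zero_closed, of "Suc n"] I_closed(1)[of "Suc n"]
    by (auto simp: initial_forms_def G_simps homogeneous_form_def UP_one)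
  then show "initial_forms \<one>\<^bsub>Rees\<^esub> = \<one>\<^bsub>G\<^esub>" by (rule ext)
qed

lemma initial_forms_surj: "initial_forms ` carrier Rees = carrier G"
proof
  show "initial_forms ` carrier Rees \<subseteq> carrier G"
    using ring_hom_closed[OF initial_forms_hom] by blast
  show "carrier G \<subseteq> initial_forms ` carrier Rees"
  proof
    fix g assume g: "g \<in> carrier G"
    \<comment> \<open>Zero components are lifted to zero; arbitrary representatives could have
      infinite support.\<close>
    have "\<forall>n. \<exists>a\<in>I n. g n = I (Suc n) +> a \<and> (g n = I (Suc n) \<longrightarrow> a = \<zero>)"
    proof
      fix n
      obtain a where a: "a \<in> I n" "g n = I (Suc n) +> a" using g by (auto simp: G_simps)
      have "I (Suc n) +> \<zero> = I (Suc n)" using coset_eq_zero_iff[OF zero_closed] I_closed(1) by simp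
      then show "\<exists>a\<in>I n. g n = I (Suc n) +> a \<and> (g n = I (Suc n) \<longrightarrow> a = \<zero>)"
        using a I_closed(1)[of n] by (cases "g n = I (Suc n)") auto
    qed
    then obtain f where f: "\<And>n. f n \<in> I n" "\<And>n. g n = I (Suc n) +> f n" "\<And>n. g n = I (Suc n) \<Longrightarrow> f n = \<zero>"
      by metis
    have "{n. f n \<noteq> \<zero>} \<subseteq> {n. g n \<noteq> I (Suc n)}" using f(3) by auto
    then have "finite {n. f n \<noteq> \<zero>}" using g by (auto simp: G_simps intro: finite_subset)
    then have "f \<in> carrier Rees" using rees_memI f(1) by simp
    moreover have "initial_forms f = g" using f(2) by (simp add: initial_forms_def fun_eq_iff)
    ultimately show "g \<in> initial_forms ` carrier Rees" by blast
  qed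
qed

lemma initial_forms_zero: "initial_forms \<zero>\<^bsub>Rees\<^esub> = \<zero>\<^bsub>G\<^esub>"
  using coset_eq_zero_iff[OF zero_closed] I_closed(1)
  by (auto simp: initial_forms_def G_simps UP_zero)

sublocale G: cring G
  by (rule Rees.ring_hom_image_cring(1)[OF initial_forms_hom initial_forms_surj initial_forms_zero])

sublocale forms: ring_hom_cring Rees G initial_forms
  by (rule Rees.ring_hom_image_cring(2)[OF initial_forms_hom initial_forms_surj initial_forms_zero])

lemma initial_forms_eq_zero_iff:
  assumes "f \<in> rees_carrier"
  shows "initial_forms f = \<zero>\<^bsub>G\<^esub> \<longleftrightarrow> (\<forall>n. f n \<in> I (Suc n))"
  using coset_eq_zero_iff rees_memD(4)[OF assms]
  by (simp add: initial_forms_def G_simps fun_eq_iff)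

definition single :: "'a \<Rightarrow> nat \<Rightarrow> nat \<Rightarrow> 'a" where
  "single a n = (\<lambda>i. if i = n then a else \<zero>)"

lemma single_rees: "a \<in> I n \<Longrightarrow> single a n \<in> rees_carrier"
  by (rule rees_memI) (auto simp: single_def I_closed(1))

lemma single_monom: "a \<in> carrier R \<Longrightarrow> single a n = up_ring.monom (UP R) a n"
  by (simp add: single_def UP_monom)

lemma single_mult: "a \<in> carrier R \<Longrightarrow> b \<in> carrier R \<Longrightarrow> single a n \<otimes>\<^bsub>Rees\<^esub> single b m = single (a \<otimes> b) (n + m)"
  by (simp add: single_monom U.monom_mult)

lemma single_pow: "a \<in> carrier R \<Longrightarrow> single a n [^]\<^bsub>UP R\<^esub> (k::nat) = single (a [^] k) (n * k)"
  by (simp add: single_monom U.monom_pow)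

lemma initial_forms_single: "initial_forms (single a n) = homogeneous_form R I n a"
  using coset_eq_zero_iff[OF zero_closed] I_closed(1)
  by (auto simp: initial_forms_def single_def homogeneous_form_def fun_eq_iff)

lemma Rees_pow: "f \<in> rees_carrier \<Longrightarrow> f [^]\<^bsub>Rees\<^esub> (k::nat) = f [^]\<^bsub>UP R\<^esub> k"
  by (induction k) (simp_all add: nat_pow_def)

end

subsection \<open>Symbolic powers and the residue field\<close>

text \<open>The discrete valuation ring enters in the form of a nonzero \<open>u\<close> generating
  the extended prime. That \<open>R\<close> is Noetherian is a separate premise of the dimension
  results.\<close>

locale uniformized_prime = "domain" R for R (structure) +
  fixes p u
  assumes prime: "primeideal p R" and u_mem: "u \<in> p" and u_nonzero: "u \<noteq> \<zero>"
    and uniformizer: "extend_at_prime R p p = PIdl\<^bsub>loc_at_prime R p\<^esub> (to_loc_at_prime R p u)"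
begin

lemmas p_closed = ideal_closed[OF primeideal.axioms(1)[OF prime]]

lemma u_closed: "u \<in> carrier R" using p_closed(2)[OF u_mem] .

sublocale loc: domain_localization R "carrier R - p"
  using prime_one_notin[OF prime] p_closed(1) prime_mult_notin[OF prime] by unfold_locales auto

abbreviation "L \<equiv> loc.L"
abbreviation "M \<equiv> extend_at_prime R p p"
abbreviation "K \<equiv> residue_field R p"
abbreviation "J \<equiv> symbolic_power R p"

lemma L_def: "loc_at_prime R p = L" by (simp add: loc_at_prime_def)

lemma emb_eq: "to_loc_at_prime R p = loc.emb"
  by (simp add: to_loc_at_prime_def loc.emb_def fun_eq_iff)

lemma M_eq_fractions: "M = {loc.fraction a s | a s. a \<in> p \<and> s \<in> carrier R - p}"
  unfolding extend_at_prime_def emb_eq L_def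
  by (rule loc.extended_ideal[OF primeideal.axioms(1)[OF prime]])

lemma M_eq_multiples: "M = {x \<otimes>\<^bsub>L\<^esub> loc.emb u | x. x \<in> carrier L}"
  unfolding uniformizer emb_eq L_def cgenideal_def by blast

lemma prime_generator:
  assumes a: "a \<in> p"
  shows "\<exists>s\<in>carrier R - p. \<exists>c\<in>carrier R. s \<otimes> a = c \<otimes> u"
proof -
  have "loc.emb a \<in> M"
    unfolding M_eq_fractions loc.emb_def using a prime_one_notin[OF prime] by blast
  then obtain x where x: "x \<in> carrier L" "loc.emb a = x \<otimes>\<^bsub>L\<^esub> loc.emb u" unfolding M_eq_multiples by blast
  obtain c s where c: "c \<in> carrier R" "s \<in> carrier R - p" "x = loc.fraction c s"
    using x(1) loc.L_cases unfolding L_def by blast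
  have "loc.emb s \<otimes>\<^bsub>L\<^esub> loc.emb a = loc.emb s \<otimes>\<^bsub>L\<^esub> x \<otimes>\<^bsub>L\<^esub> loc.emb u"
    unfolding x(2) using c x u_closed by (simp add: loc.L.m_assoc)
  also have "loc.emb s \<otimes>\<^bsub>L\<^esub> x = loc.emb c" unfolding c(3) L_def using c by (intro loc.emb_mult_frac)
  finally have "loc.emb (s \<otimes> a) = loc.emb (c \<otimes> u)" using c a p_closed(2) u_closed by simp
  then have "s \<otimes> a = c \<otimes> u"
    by (rule iffD1[OF loc.emb_eq_iff, rotated 2]) (use c a p_closed(2) u_closed in auto)
  then show ?thesis using c by blast
qed

lemma u_pow_nonzero: "u [^] (n::nat) \<noteq> \<zero>"
  using u_closed u_nonzero by (induction n) (auto simp: integral_iff)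

text \<open>The ordinary power contains u^n, and up to factors outside \<open>p\<close> its members
  are multiples of u^n; so it generates the same ideal of the localization as u^n. This turns
  membership in a symbolic power into an equation in \<open>R\<close>.\<close>

lemma power_p:
  "ideal (p [^]\<^bsub>ideals_set R\<^esub> (n::nat)) R \<and> u [^] n \<in> p [^]\<^bsub>ideals_set R\<^esub> n \<and>
   (\<forall>a\<in>p [^]\<^bsub>ideals_set R\<^esub> n. \<exists>s\<in>carrier R - p. \<exists>c\<in>carrier R. s \<otimes> a = c \<otimes> u [^] n)"
proof (induction n)
  case 0
  have "p [^]\<^bsub>ideals_set R\<^esub> (0::nat) = carrier R" by (simp add: nat_pow_def ideals_set_def)
  moreover have "\<one> \<in> carrier R - p" using prime_one_notin[OF prime] by simp
  ultimately show ?case using oneideal by (auto intro!: bexI[of _ "\<one>"])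
next
  case (Suc n)
  let ?q = "p [^]\<^bsub>ideals_set R\<^esub> n"
  have e: "p [^]\<^bsub>ideals_set R\<^esub> Suc n = ?q \<cdot> p" by (simp add: nat_pow_def ideals_set_def)
  have qi: "ideal ?q R" using Suc by blast
  have "\<exists>s\<in>carrier R - p. \<exists>c\<in>carrier R. s \<otimes> a = c \<otimes> u [^] Suc n" if "a \<in> ?q \<cdot> p" for a
    using that
  proof (induction rule: ideal_prod.induct)
    case (prod i j)
    obtain s c where s: "s \<in> carrier R - p" "c \<in> carrier R" "s \<otimes> i = c \<otimes> u [^] n"
      using Suc prod by blast
    obtain t d where t: "t \<in> carrier R - p" "d \<in> carrier R" "t \<otimes> j = d \<otimes> u"
      using prime_generator[OF prod(2)] by blast
    have cl: "i \<in> carrier R" "j \<in> carrier R" "s \<in> carrier R" "t \<in> carrier R" "u [^] n \<in> carrier R"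
      using ideal_closed(2)[OF qi prod(1)] p_closed(2)[OF prod(2)] s t u_closed by auto
    have "s \<otimes> t \<otimes> (i \<otimes> j) = (s \<otimes> i) \<otimes> (t \<otimes> j)" using cl by algebra
    also have "\<dots> = c \<otimes> d \<otimes> (u [^] n \<otimes> u)" unfolding s(3) t(3) using s(2) t(2) cl u_closed by algebra
    finally have "s \<otimes> t \<otimes> (i \<otimes> j) = c \<otimes> d \<otimes> u [^] Suc n" by simp
    moreover have "s \<otimes> t \<in> carrier R - p" using loc.S_mult s t by blast
    ultimately show ?case using s t by blast
  next
    case (sum a b)
    obtain s c where s: "s \<in> carrier R - p" "c \<in> carrier R" "s \<otimes> a = c \<otimes> u [^] Suc n"
      using sum by blast
    obtain t d where t: "t \<in> carrier R - p" "d \<in> carrier R" "t \<otimes> b = d \<otimes> u [^] Suc n"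
      using sum by blast
    define w where "w = u [^] Suc n"
    have cl: "a \<in> carrier R" "b \<in> carrier R" "s \<in> carrier R" "t \<in> carrier R" "w \<in> carrier R"
      using ideal_prod_in_carrier[OF qi primeideal.axioms(1)[OF prime]] sum(1,2) s t u_closed
      unfolding w_def by auto
    have "s \<otimes> t \<otimes> (a \<oplus> b) = t \<otimes> (s \<otimes> a) \<oplus> s \<otimes> (t \<otimes> b)" using cl by algebra
    also have "\<dots> = (t \<otimes> c \<oplus> s \<otimes> d) \<otimes> w" unfolding s(3) t(3) w_def[symmetric] using s(2) t(2) cl by algebra
    finally have "s \<otimes> t \<otimes> (a \<oplus> b) = (t \<otimes> c \<oplus> s \<otimes> d) \<otimes> u [^] Suc n" unfolding w_def .
    moreover have "s \<otimes> t \<in> carrier R - p" "t \<otimes> c \<oplus> s \<otimes> d \<in> carrier R" using loc.S_mult s t by auto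
    ultimately show ?case by blast
  qed
  moreover have "u [^] Suc n \<in> ?q \<cdot> p" using ideal_prod.prod[of "u [^] n" ?q u p R] Suc u_mem by simp
  ultimately show ?case unfolding e using ideal_prod_is_ideal[OF qi primeideal.axioms(1)[OF prime]] by blast
qed

lemma symbolic_power_iff:
  "a \<in> J n \<longleftrightarrow> a \<in> carrier R \<and> (\<exists>s\<in>carrier R - p. \<exists>c\<in>carrier R. s \<otimes> a = c \<otimes> u [^] n)"
proof -
  let ?q = "p [^]\<^bsub>ideals_set R\<^esub> n"
  have q: "ideal ?q R" "u [^] n \<in> ?q"
    "\<And>a. a \<in> ?q \<Longrightarrow> \<exists>s\<in>carrier R - p. \<exists>c\<in>carrier R. s \<otimes> a = c \<otimes> u [^] n"
    using power_p[of n] by auto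
  have "(\<exists>s\<in>carrier R - p. s \<otimes> a \<in> ?q) \<longleftrightarrow> (\<exists>s\<in>carrier R - p. \<exists>c\<in>carrier R. s \<otimes> a = c \<otimes> u [^] n)"
    if a: "a \<in> carrier R"
  proof
    assume "\<exists>s\<in>carrier R - p. s \<otimes> a \<in> ?q"
    then obtain s where s: "s \<in> carrier R - p" "s \<otimes> a \<in> ?q" by blast
    then obtain t c where t: "t \<in> carrier R - p" "c \<in> carrier R" "t \<otimes> (s \<otimes> a) = c \<otimes> u [^] n" using q(3) by blast
    then have "t \<otimes> s \<otimes> a = c \<otimes> u [^] n" using s a by (simp add: m_assoc)
    then show "\<exists>s\<in>carrier R - p. \<exists>c\<in>carrier R. s \<otimes> a = c \<otimes> u [^] n"
      using loc.S_mult[OF t(1) s(1)] t(2) by blast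
  next
    assume "\<exists>s\<in>carrier R - p. \<exists>c\<in>carrier R. s \<otimes> a = c \<otimes> u [^] n"
    then show "\<exists>s\<in>carrier R - p. s \<otimes> a \<in> ?q" using ideal_closed(6)[OF q(1,2)] by metis
  qed
  then show ?thesis
    unfolding symbolic_power_def extend_at_prime_def emb_eq L_def
    using loc.emb_mem_extended_ideal[OF q(1)] by blast
qed

text \<open>If s y = c u^n, then c/s is the quotient of y by u^n. In this form, closure of the
  filtration under sums and products becomes an identity between fractions.\<close>

lemma symbolic_power_fraction:
  "y \<in> J n \<longleftrightarrow> y \<in> carrier R \<and> (\<exists>x\<in>carrier loc.L. x \<otimes>\<^bsub>L\<^esub> loc.emb u [^]\<^bsub>L\<^esub> n = loc.emb y)"
proof (cases "y \<in> carrier R")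
  case y: True
  have "(\<exists>s\<in>carrier R - p. \<exists>c\<in>carrier R. s \<otimes> y = c \<otimes> u [^] n) \<longleftrightarrow>
    (\<exists>x\<in>carrier loc.L. x \<otimes>\<^bsub>L\<^esub> loc.emb u [^]\<^bsub>L\<^esub> n = loc.emb y)"
  proof
    assume "\<exists>s\<in>carrier R - p. \<exists>c\<in>carrier R. s \<otimes> y = c \<otimes> u [^] n"
    then obtain s c where s: "s \<in> carrier R - p" "c \<in> carrier R" "s \<otimes> y = c \<otimes> u [^] n" by blast
    have xL: "loc.fraction c s \<in> carrier L" using s loc.frac_closed unfolding L_def by blast
    have "loc.emb s \<otimes>\<^bsub>L\<^esub> (loc.fraction c s \<otimes>\<^bsub>L\<^esub> loc.emb u [^]\<^bsub>L\<^esub> n) = loc.emb c \<otimes>\<^bsub>L\<^esub> loc.emb (u [^] n)"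
      using xL s u_closed loc.emb_mult_frac[OF s(2,1)] by (simp add: loc.L.m_assoc[symmetric] L_def)
    also have "\<dots> = loc.emb s \<otimes>\<^bsub>L\<^esub> loc.emb y"
      using s u_closed y loc.emb.hom_mult[of s y] loc.emb.hom_mult[of c "u [^] n"] by simp
    finally have "loc.fraction c s \<otimes>\<^bsub>L\<^esub> loc.emb u [^]\<^bsub>L\<^esub> n = loc.emb y"
      using loc.L.m_lcancel[of "loc.emb s"] xL s u_closed y loc.emb_eq_iff[of s \<zero>] p_closed(1) loc.emb.hom_zero by auto
    then show "\<exists>x\<in>carrier loc.L. x \<otimes>\<^bsub>L\<^esub> loc.emb u [^]\<^bsub>L\<^esub> n = loc.emb y" using xL by blast
  next
    assume "\<exists>x\<in>carrier loc.L. x \<otimes>\<^bsub>L\<^esub> loc.emb u [^]\<^bsub>L\<^esub> n = loc.emb y"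
    then obtain x where x: "x \<in> carrier L" "x \<otimes>\<^bsub>L\<^esub> loc.emb u [^]\<^bsub>L\<^esub> n = loc.emb y" by blast
    obtain c s where c: "c \<in> carrier R" "s \<in> carrier R - p" "x = loc.fraction c s"
      using x(1) loc.L_cases unfolding L_def by blast
    have "loc.emb (s \<otimes> y) = (loc.emb s \<otimes>\<^bsub>L\<^esub> x) \<otimes>\<^bsub>L\<^esub> loc.emb u [^]\<^bsub>L\<^esub> n"
      using c y x u_closed by (simp add: loc.L.m_assoc)
    also have "loc.emb s \<otimes>\<^bsub>L\<^esub> x = loc.emb c" unfolding c(3) L_def using c by (intro loc.emb_mult_frac)
    finally have "loc.emb (s \<otimes> y) = loc.emb (c \<otimes> u [^] n)" using c u_closed by simp
    then have "s \<otimes> y = c \<otimes> u [^] n"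
      by (rule iffD1[OF loc.emb_eq_iff, rotated 2]) (use c y u_closed in auto)
    then show "\<exists>s\<in>carrier R - p. \<exists>c\<in>carrier R. s \<otimes> y = c \<otimes> u [^] n" using c by blast
  qed
  then show ?thesis using symbolic_power_iff y by blast
qed (simp add: symbolic_power_iff)

lemma emb_u_pow: "loc.emb u [^]\<^bsub>L\<^esub> (n::nat) \<in> carrier L" "loc.emb u [^]\<^bsub>L\<^esub> n \<noteq> \<zero>\<^bsub>L\<^esub>"
  using u_closed u_pow_nonzero[of n] loc.emb_eq_iff[of "u [^] n" \<zero>] loc.emb.hom_zero loc.emb.hom_pow[OF u_closed, of n] by auto

text \<open>The fraction \<open>y/u\<^sup>n\<close>, meaningful only for \<open>y\<close> in the \<open>n\<close>th symbolic power.\<close>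

definition quot :: "nat \<Rightarrow> 'a \<Rightarrow> ('a \<times> 'a) set" where
  "quot n y = (THE x. x \<in> carrier L \<and> x \<otimes>\<^bsub>L\<^esub> loc.emb u [^]\<^bsub>L\<^esub> n = loc.emb y)"

lemma quot_eqI:
  assumes "x \<in> carrier L" "x \<otimes>\<^bsub>L\<^esub> loc.emb u [^]\<^bsub>L\<^esub> n = loc.emb y"
  shows "quot n y = x"
  unfolding quot_def
proof (rule the_equality)
  fix x' assume "x' \<in> carrier L \<and> x' \<otimes>\<^bsub>L\<^esub> loc.emb u [^]\<^bsub>L\<^esub> n = loc.emb y"
  then show "x' = x" using assms loc.L.m_rcancel[of "loc.emb u [^]\<^bsub>L\<^esub> n" x' x] emb_u_pow[of n] by simp
qed (use assms in blast)

lemma quot: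
  assumes "y \<in> J n"
  shows "quot n y \<in> carrier L" "quot n y \<otimes>\<^bsub>L\<^esub> loc.emb u [^]\<^bsub>L\<^esub> n = loc.emb y"
proof -
  obtain x where "x \<in> carrier L" "x \<otimes>\<^bsub>L\<^esub> loc.emb u [^]\<^bsub>L\<^esub> n = loc.emb y"
    using assms symbolic_power_fraction by blast
  then show "quot n y \<in> carrier L" "quot n y \<otimes>\<^bsub>L\<^esub> loc.emb u [^]\<^bsub>L\<^esub> n = loc.emb y"
    using quot_eqI by auto
qed

lemma symbolic_power_closed: "y \<in> J n \<Longrightarrow> y \<in> carrier R"
  by (simp add: symbolic_power_iff)

lemma symbolic_power_mult:
  assumes "y \<in> J i" "z \<in> J j"
  shows "y \<otimes> z \<in> J (i + j)" "quot (i + j) (y \<otimes> z) = quot i y \<otimes>\<^bsub>L\<^esub> quot j z"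
proof -
  define U V where "U = loc.emb u [^]\<^bsub>L\<^esub> i" and "V = loc.emb u [^]\<^bsub>L\<^esub> j"
  have c: "U \<in> carrier L" "V \<in> carrier L" using emb_u_pow unfolding U_def V_def by auto
  note y = quot[OF assms(1)] and z = quot[OF assms(2)]
  have UV: "loc.emb u [^]\<^bsub>L\<^esub> (i + j) = U \<otimes>\<^bsub>L\<^esub> V" unfolding U_def V_def using u_closed by (simp add: loc.L.nat_pow_mult)
  have "(quot i y \<otimes>\<^bsub>L\<^esub> quot j z) \<otimes>\<^bsub>L\<^esub> (U \<otimes>\<^bsub>L\<^esub> V) = (quot i y \<otimes>\<^bsub>L\<^esub> U) \<otimes>\<^bsub>L\<^esub> (quot j z \<otimes>\<^bsub>L\<^esub> V)"
    using y(1) z(1) c by (simp add: loc.L.m_ac)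
  also have "\<dots> = loc.emb (y \<otimes> z)"
    using y(2) z(2) assms symbolic_power_closed unfolding U_def V_def by simp
  finally have e: "(quot i y \<otimes>\<^bsub>L\<^esub> quot j z) \<otimes>\<^bsub>L\<^esub> loc.emb u [^]\<^bsub>L\<^esub> (i + j) = loc.emb (y \<otimes> z)" unfolding UV .
  then show "y \<otimes> z \<in> J (i + j)"
    using assms symbolic_power_closed y z by (auto simp: symbolic_power_fraction)
  show "quot (i + j) (y \<otimes> z) = quot i y \<otimes>\<^bsub>L\<^esub> quot j z"
    using y z by (intro quot_eqI[OF _ e]) simp
qed

lemma symbolic_power_add:
  assumes "y \<in> J n" "z \<in> J n"
  shows "y \<oplus> z \<in> J n" "quot n (y \<oplus> z) = quot n y \<oplus>\<^bsub>L\<^esub> quot n z"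
proof -
  note y = quot[OF assms(1)] and z = quot[OF assms(2)]
  have e: "(quot n y \<oplus>\<^bsub>L\<^esub> quot n z) \<otimes>\<^bsub>L\<^esub> loc.emb u [^]\<^bsub>L\<^esub> n = loc.emb (y \<oplus> z)"
    using y z emb_u_pow(1)[of n] assms symbolic_power_closed by (simp add: loc.L.l_distr)
  then show "y \<oplus> z \<in> J n"
    using assms symbolic_power_closed y z by (auto simp: symbolic_power_fraction)
  show "quot n (y \<oplus> z) = quot n y \<oplus>\<^bsub>L\<^esub> quot n z"
    using y z by (intro quot_eqI[OF _ e]) simp
qed

lemma carrier_eq_symbolic_power_0: "J 0 = carrier R"
  by (auto simp: symbolic_power_fraction)

lemma quot_0: "y \<in> carrier R \<Longrightarrow> quot 0 y = loc.emb y"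
  by (intro quot_eqI) auto

text \<open>Multiplication by u raises the degree and leaves the fraction unchanged. It stands for
  multiplication by \<open>v\<close> in the graded ring and by X among polynomials over
  \<open>D\<close>.\<close>

lemma symbolic_power_u: "y \<in> J n \<Longrightarrow> y \<otimes> u \<in> J (Suc n)"
  and quot_u: "y \<in> J n \<Longrightarrow> quot (Suc n) (y \<otimes> u) = quot n y"
proof -
  assume y: "y \<in> J n"
  have u1: "u \<in> J 1" using u_closed by (auto simp: symbolic_power_fraction intro!: bexI[of _ "\<one>\<^bsub>L\<^esub>"])
  have q1: "quot 1 u = \<one>\<^bsub>L\<^esub>" using u_closed by (intro quot_eqI) auto
  show "y \<otimes> u \<in> J (Suc n)" using symbolic_power_mult(1)[OF y u1] by simp
  show "quot (Suc n) (y \<otimes> u) = quot n y" using symbolic_power_mult(2)[OF y u1] q1 quot(1)[OF y] by simp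
qed

lemma zero_symbolic_power: "\<zero> \<in> J n" "quot n \<zero> = \<zero>\<^bsub>L\<^esub>"
proof -
  have e: "\<zero>\<^bsub>L\<^esub> \<otimes>\<^bsub>L\<^esub> loc.emb u [^]\<^bsub>L\<^esub> n = loc.emb \<zero>" using emb_u_pow(1)[of n] by simp
  show "quot n \<zero> = \<zero>\<^bsub>L\<^esub>" by (rule quot_eqI[OF _ e]) simp
  show "\<zero> \<in> J n" using e by (auto simp: symbolic_power_fraction)
qed

text \<open>\<open>M\<close> consists of the multiples of u, so the fraction lies in
  \<open>M\<close> when y can be divided by u once more. Thus the kernel in degree n is exactly the
  next symbolic power.\<close>

lemma quot_mem_M:
  assumes y: "y \<in> J n"
  shows "quot n y \<in> M \<longleftrightarrow> y \<in> J (Suc n)"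
proof
  have yR: "y \<in> carrier R" using y symbolic_power_closed by blast
  assume "quot n y \<in> M"
  then obtain x where x: "x \<in> carrier L" "quot n y = x \<otimes>\<^bsub>L\<^esub> loc.emb u" unfolding M_eq_multiples by blast
  have "x \<otimes>\<^bsub>L\<^esub> loc.emb u [^]\<^bsub>L\<^esub> (Suc n) = loc.emb y"
    using quot(2)[OF y] x emb_u_pow(1)[of n] u_closed unfolding x(2) by (simp add: loc.L.m_ac)
  then show "y \<in> J (Suc n)" using x yR by (auto simp: symbolic_power_fraction)
next
  assume s: "y \<in> J (Suc n)"
  have "(quot (Suc n) y \<otimes>\<^bsub>L\<^esub> loc.emb u) \<otimes>\<^bsub>L\<^esub> loc.emb u [^]\<^bsub>L\<^esub> n = loc.emb y"
    using quot[OF s] u_closed emb_u_pow(1)[of n] by (simp add: loc.L.m_ac)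
  then have "quot n y = quot (Suc n) y \<otimes>\<^bsub>L\<^esub> loc.emb u"
    using quot(1)[OF s] u_closed by (intro quot_eqI) auto
  then show "quot n y \<in> M" unfolding M_eq_multiples using quot(1)[OF s] by blast
qed

lemma symbolic_power_1: "J 1 = p"
proof
  show "J 1 \<subseteq> p"
  proof
    fix a assume "a \<in> J 1"
    then obtain s c where s: "a \<in> carrier R" "s \<in> carrier R - p" "c \<in> carrier R" "s \<otimes> a = c \<otimes> u"
      using u_closed by (auto simp: symbolic_power_iff)
    then have "s \<otimes> a \<in> p" using p_closed(6)[OF u_mem s(3)] by simp
    then show "a \<in> p" using primeideal.I_prime[OF prime, of s a] s by auto
  qed
  show "p \<subseteq> J 1" using prime_generator p_closed(2) u_closed by (auto simp: symbolic_power_iff)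
qed

sublocale filt: ideal_filtration R J
proof (intro ideal_filtration.intro ideal_filtration_axioms.intro is_cring)
  show "ideal (J n) R" for n
  proof (rule ideal_intro)
    fix a r assume "a \<in> J n" "r \<in> carrier R"
    then show "r \<otimes> a \<in> J n"
      using symbolic_power_mult(1)[of r 0 a n] by (simp add: carrier_eq_symbolic_power_0)
  qed (use symbolic_power_closed zero_symbolic_power symbolic_power_add in auto)
  show "J (Suc n) \<subseteq> J n" for n
  proof
    fix y assume y: "y \<in> J (Suc n)"
    have "(quot (Suc n) y \<otimes>\<^bsub>L\<^esub> loc.emb u) \<otimes>\<^bsub>L\<^esub> loc.emb u [^]\<^bsub>L\<^esub> n = loc.emb y"
      using quot[OF y] u_closed emb_u_pow(1)[of n] by (simp add: loc.L.m_ac)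
    then show "y \<in> J n" using quot(1)[OF y] symbolic_power_closed[OF y] u_closed
      by (auto simp: symbolic_power_fraction)
  qed
qed (use carrier_eq_symbolic_power_0 symbolic_power_mult in auto)

lemma prime_M: "primeideal M L"
proof (rule primeidealI[OF _ loc.L.is_cring])
  have "loc.emb ` p \<subseteq> carrier L" using p_closed(2) by auto
  then show Mi: "ideal M L"
    unfolding extend_at_prime_def emb_eq L_def by (rule loc.L.genideal_ideal)
  have "\<one>\<^bsub>L\<^esub> \<notin> M"
  proof
    assume "\<one>\<^bsub>L\<^esub> \<in> M"
    then have "\<one> \<in> p" using quot_mem_M[of \<one> 0] quot_0[of \<one>] carrier_eq_symbolic_power_0 symbolic_power_1 by simp
    then show False using prime_one_notin[OF prime] by simp
  qed
  then show "carrier L \<noteq> M" using loc.L.one_closed by auto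
  fix x y assume h: "x \<in> carrier L" "y \<in> carrier L" "x \<otimes>\<^bsub>L\<^esub> y \<in> M"
  obtain a s where x: "a \<in> carrier R" "s \<in> carrier R - p" "x = loc.fraction a s"
    using h(1) loc.L_cases unfolding L_def by blast
  obtain b t where y: "b \<in> carrier R" "t \<in> carrier R - p" "y = loc.fraction b t"
    using h(2) loc.L_cases unfolding L_def by blast
  have "loc.emb (a \<otimes> b) = (loc.emb s \<otimes>\<^bsub>L\<^esub> x) \<otimes>\<^bsub>L\<^esub> (loc.emb t \<otimes>\<^bsub>L\<^esub> y)"
    using loc.emb_mult_frac[OF x(1,2)] loc.emb_mult_frac[OF y(1,2)] x(1) y(1) unfolding x(3) y(3) L_def by simp
  also have "\<dots> = (loc.emb s \<otimes>\<^bsub>L\<^esub> loc.emb t) \<otimes>\<^bsub>L\<^esub> (x \<otimes>\<^bsub>L\<^esub> y)"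
    using h(1,2) x(2) y(2) by (simp add: loc.L.m_ac)
  also have "\<dots> \<in> M" using loc.L.ideal_closed(6)[OF Mi h(3)] x(2) y(2) by simp
  finally have "a \<otimes> b \<in> p"
    using quot_mem_M[of "a \<otimes> b" 0] quot_0[of "a \<otimes> b"] x(1) y(1) carrier_eq_symbolic_power_0 symbolic_power_1 by simp
  then have "a \<in> p \<or> b \<in> p" using primeideal.I_prime[OF prime x(1) y(1)] by simp
  then show "x \<in> M \<or> y \<in> M" unfolding M_eq_fractions using x y by blast
qed

sublocale K: "domain" K
  unfolding residue_field_def L_def by (rule primeideal.quotient_is_domain[OF prime_M])

sublocale proj: ring_hom_cring L K "(+>\<^bsub>L\<^esub>) M"
  unfolding residue_field_def L_def by (rule primeideal.rcos_ring_hom_cring[OF prime_M])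

definition res :: "nat \<Rightarrow> 'a \<Rightarrow> ('a \<times> 'a) set set" where
  "res n y = M +>\<^bsub>L\<^esub> quot n y"

lemma res_closed: "y \<in> J n \<Longrightarrow> res n y \<in> carrier K"
  unfolding res_def using quot by simp

lemma res_add: "y \<in> J n \<Longrightarrow> z \<in> J n \<Longrightarrow> res n (y \<oplus> z) = res n y \<oplus>\<^bsub>K\<^esub> res n z"
  unfolding res_def using quot symbolic_power_add by simp

lemma res_mult: "y \<in> J i \<Longrightarrow> z \<in> J j \<Longrightarrow> res (i + j) (y \<otimes> z) = res i y \<otimes>\<^bsub>K\<^esub> res j z"
  unfolding res_def using quot symbolic_power_mult by simp

lemma res_u: "y \<in> J n \<Longrightarrow> res (Suc n) (y \<otimes> u) = res n y"
  unfolding res_def by (simp add: quot_u)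

lemma res_eq_zero_iff: "y \<in> J n \<Longrightarrow> res n y = \<zero>\<^bsub>K\<^esub> \<longleftrightarrow> y \<in> J (Suc n)"
proof -
  assume y: "y \<in> J n"
  have "res n y = \<zero>\<^bsub>K\<^esub> \<longleftrightarrow> quot n y \<in> M"
    unfolding res_def residue_field_def L_def
    using quot(1)[OF y] loc.L.a_rcos_zero[OF primeideal.axioms(1)[OF prime_M]]
      ideal.rcos_const_imp_mem[OF primeideal.axioms(1)[OF prime_M]] by (auto simp: FactRing_def)
  then show ?thesis using quot_mem_M[OF y] by simp
qed

text \<open>An x with x u^n = y in \<open>R\<close> is the fraction of this y, which then lies in
  \<open>J n\<close>; so \<open>E_set\<close> in degree n consists of the fractions of degree
  n.\<close>

lemma carrier_D: "carrier (D_ring R p u) = {res n y | n y. y \<in> J n}"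
proof -
  have "F_set R p u n = res n ` J n" for n
  proof -
    have "E_set R p u n = quot n ` J n"
    proof
      show "E_set R p u n \<subseteq> quot n ` J n"
      proof
        fix x assume "x \<in> E_set R p u n"
        then obtain y where y: "x \<in> carrier L" "y \<in> carrier R" "x \<otimes>\<^bsub>L\<^esub> loc.emb u [^]\<^bsub>L\<^esub> n = loc.emb y"
          unfolding E_set_def emb_eq L_def by blast
        then have "x = quot n y" "y \<in> J n" using quot_eqI by (auto simp: symbolic_power_fraction)
        then show "x \<in> quot n ` J n" by blast
      qed
      show "quot n ` J n \<subseteq> E_set R p u n"
        unfolding E_set_def emb_eq L_def using quot symbolic_power_closed by auto
    qed
    then show ?thesis unfolding F_set_def res_def L_def by auto
  qed
  then show ?thesis by (auto simp: D_ring_def)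
qed

text \<open>The sets \<open>F_set\<close> increase with the degree. Hence two elements of their
  union can be represented in a common degree and added there.\<close>

lemma res_raise: "y \<in> J n \<Longrightarrow> \<exists>z\<in>J (n + k). res (n + k) z = res n y"
proof (induction k)
  case (Suc k)
  then obtain z where "z \<in> J (n + k)" "res (n + k) z = res n y" by blast
  then show ?case using symbolic_power_u[of z "n + k"] res_u[of z "n + k"] by auto
qed auto

lemma subring_D: "subring (carrier (D_ring R p u)) K"
proof (rule K.subringI)
  show "carrier (D_ring R p u) \<subseteq> carrier K" unfolding carrier_D using res_closed by blast
  have "res 0 \<one> = \<one>\<^bsub>K\<^esub>" unfolding res_def by (simp add: quot_0)
  then show "\<one>\<^bsub>K\<^esub> \<in> carrier (D_ring R p u)" unfolding carrier_D using carrier_eq_symbolic_power_0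
    by (metis (mono_tags, lifting) mem_Collect_eq one_closed)
  fix a assume "a \<in> carrier (D_ring R p u)"
  then obtain n y where a: "y \<in> J n" "a = res n y" unfolding carrier_D by blast
  have m: "\<ominus> y \<in> J n" using filt.I_closed(5)[OF a(1)] .
  have "res n (\<ominus> y) \<oplus>\<^bsub>K\<^esub> a = res n (\<ominus> y \<oplus> y)" using res_add[OF m a(1)] a by simp
  also have "\<dots> = \<zero>\<^bsub>K\<^esub>" using symbolic_power_closed[OF a(1)] res_eq_zero_iff[OF zero_symbolic_power(1), of n] zero_symbolic_power(1)
    by (simp add: l_neg)
  finally have "\<ominus>\<^bsub>K\<^esub> a = res n (\<ominus> y)" using res_closed[OF m] res_closed[OF a(1)] a K.minus_equality by simp
  then show "\<ominus>\<^bsub>K\<^esub> a \<in> carrier (D_ring R p u)" unfolding carrier_D using m by blast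
  fix b assume "b \<in> carrier (D_ring R p u)"
  then obtain m z where b: "z \<in> J m" "b = res m z" unfolding carrier_D by blast
  show "a \<otimes>\<^bsub>K\<^esub> b \<in> carrier (D_ring R p u)"
    unfolding a b res_mult[OF a(1) b(1), symmetric] carrier_D using symbolic_power_mult(1)[OF a(1) b(1)] by blast
  obtain y' z' where "y' \<in> J (n + m)" "res (n + m) y' = a" "z' \<in> J (m + n)" "res (m + n) z' = b"
    using res_raise[OF a(1), of m] res_raise[OF b(1), of n] a b by auto
  then have y': "y' \<in> J (n + m)" "a = res (n + m) y'" "z' \<in> J (n + m)" "b = res (n + m) z'"
    by (simp_all add: add.commute)
  show "a \<oplus>\<^bsub>K\<^esub> b \<in> carrier (D_ring R p u)"
    unfolding y'(2,4) res_add[OF y'(1,3), symmetric] carrier_D using symbolic_power_add(1)[OF y'(1,3)] by blast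
qed

lemma D_ring_eq: "D_ring R p u = K\<lparr>carrier := carrier (D_ring R p u)\<rparr>"
  by (simp add: D_ring_def)

lemma domain_D: "domain (D_ring R p u)"
  using K.subring_is_domain[OF subring_D] D_ring_eq by simp

abbreviation "D \<equiv> D_ring R p u"

sublocale UD: UP_domain D "UP D"
  by (simp add: UP_domain_def domain_D)

sublocale inc: ring_hom_cring D K "\<lambda>x. x"
  using K.subring_inclusion[OF subring_D] D_ring_eq by simp

text \<open>On y X^n this is the residue class of y/u^n times X^n: a second homomorphism out of the
  Rees ring, beside \<open>initial_forms\<close>, with values in polynomials over
  \<open>D\<close>.\<close>

definition residues :: "(nat \<Rightarrow> 'a) \<Rightarrow> nat \<Rightarrow> ('a \<times> 'a) set set" where
  "residues f = (\<lambda>n. res n (f n))"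

lemma D_ops: "x \<otimes>\<^bsub>D\<^esub> y = x \<otimes>\<^bsub>K\<^esub> y" "x \<oplus>\<^bsub>D\<^esub> y = x \<oplus>\<^bsub>K\<^esub> y" "\<one>\<^bsub>D\<^esub> = \<one>\<^bsub>K\<^esub>" "\<zero>\<^bsub>D\<^esub> = \<zero>\<^bsub>K\<^esub>"
  by (simp_all add: D_ring_def)

lemma residues_up:
  assumes f: "f \<in> filt.rees_carrier"
  shows "residues f \<in> up D"
proof -
  have "res n \<zero> = \<zero>\<^bsub>K\<^esub>" for n using res_eq_zero_iff[OF zero_symbolic_power(1)] zero_symbolic_power(1) by simp
  then have "{n. residues f n \<noteq> \<zero>\<^bsub>D\<^esub>} \<subseteq> {n. f n \<noteq> \<zero>}" by (auto simp: residues_def D_ops)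
  then have "finite {n. residues f n \<noteq> \<zero>\<^bsub>D\<^esub>}" using filt.rees_memD(5)[OF f] by (rule finite_subset)
  moreover have "residues f n \<in> carrier D" for n
    unfolding residues_def carrier_D using filt.rees_memD(3)[OF f] by blast
  ultimately show ?thesis by (simp add: up_iff_finite)
qed

lemma quot_finsum:
  assumes "\<And>i. i \<in> A \<Longrightarrow> y i \<in> J n" "finite A"
  shows "finsum R y A \<in> J n \<and> res n (finsum R y A) = (\<Oplus>\<^bsub>K\<^esub>i\<in>A. res n (y i))"
  using assms(2,1)
proof (induction A)
  case empty
  then show ?case using zero_symbolic_power(1) res_eq_zero_iff[OF zero_symbolic_power(1)] by simp
next
  case (insert a A)
  have m: "y i \<in> J n" if "i \<in> A" for i using insert.prems that by simp
  have "(\<lambda>i. res n (y i)) \<in> A \<rightarrow> carrier K" "y \<in> A \<rightarrow> carrier R"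
    using res_closed[OF m] symbolic_power_closed[OF m] by blast+
  moreover have "y a \<in> J n" "finsum R y A \<in> J n" using insert by auto
  ultimately show ?case
    using insert symbolic_power_add[of "y a" n "finsum R y A"] res_add[of "y a" n "finsum R y A"]
      res_closed[of "y a" n] symbolic_power_closed[of "y a" n]
    by (simp add: K.finsum_insert finsum_insert)
qed

lemma residues_hom: "ring_hom_cring filt.Rees (UP D) residues"
proof (intro ring_hom_cringI filt.Rees.is_cring UD.P.is_cring ring_hom_memI)
  fix f assume "f \<in> carrier filt.Rees"
  then have f: "f \<in> filt.rees_carrier" by simp
  show "residues f \<in> carrier (UP D)" using residues_up[OF f] by (simp add: carrier_UP)
  fix g assume "g \<in> carrier filt.Rees"
  then have g: "g \<in> filt.rees_carrier" by simp
  note fm = filt.rees_memD[OF f] and gm = filt.rees_memD[OF g]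
  show "residues (f \<oplus>\<^bsub>filt.Rees\<^esub> g) = residues f \<oplus>\<^bsub>UP D\<^esub> residues g"
    unfolding add_UP[OF residues_up[OF f] residues_up[OF g]]
    using res_add[OF fm(3) gm(3)] by (simp add: add_UP[OF fm(2) gm(2)] residues_def D_ops)
  have "res n (\<Oplus>i\<in>{..n}. f i \<otimes> g (n - i)) = (\<Oplus>\<^bsub>D\<^esub>i\<in>{..n}. res i (f i) \<otimes>\<^bsub>D\<^esub> res (n - i) (g (n - i)))" for n
  proof -
    have m: "f i \<otimes> g (n - i) \<in> J n" "res n (f i \<otimes> g (n - i)) = res i (f i) \<otimes>\<^bsub>D\<^esub> res (n - i) (g (n - i))" if "i \<in> {..n}" for i
      using symbolic_power_mult(1)[OF fm(3)[of i] gm(3)[of "n - i"]] res_mult[OF fm(3)[of i] gm(3)[of "n - i"]] that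
      by (auto simp: D_ops)
    have "res n (\<Oplus>i\<in>{..n}. f i \<otimes> g (n - i)) = (\<Oplus>\<^bsub>K\<^esub>i\<in>{..n}. res n (f i \<otimes> g (n - i)))"
      using quot_finsum[OF m(1), of "{..n}" "\<lambda>i. i"] quot_finsum[of "{..n}" "\<lambda>i. f i \<otimes> g (n - i)" n] m(1) by blast
    also have "\<dots> = (\<Oplus>\<^bsub>K\<^esub>i\<in>{..n}. res i (f i) \<otimes>\<^bsub>D\<^esub> res (n - i) (g (n - i)))"
      by (rule K.finsum_cong') (use m(2) res_closed[OF fm(3)] res_closed[OF gm(3)] in \<open>auto simp: D_ops\<close>)
    also have "\<dots> = (\<Oplus>\<^bsub>D\<^esub>i\<in>{..n}. res i (f i) \<otimes>\<^bsub>D\<^esub> res (n - i) (g (n - i)))"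
    proof -
      have "res i (f i) \<in> carrier D" "res i (g i) \<in> carrier D" for i
        using fm(3) gm(3) unfolding carrier_D by blast+
      then have "(\<lambda>i. res i (f i) \<otimes>\<^bsub>D\<^esub> res (n - i) (g (n - i))) \<in> {..n} \<rightarrow> carrier D"
        by (intro funcsetI UD.R.m_closed)
      from inc.hom_finsum[OF this] show ?thesis by (simp add: comp_def)
    qed
    finally show ?thesis .
  qed
  then show "residues (f \<otimes>\<^bsub>filt.Rees\<^esub> g) = residues f \<otimes>\<^bsub>UP D\<^esub> residues g"
    unfolding mult_UP[OF residues_up[OF f] residues_up[OF g]]
    by (simp add: mult_UP[OF fm(2) gm(2)] residues_def)
next
  have "residues \<one>\<^bsub>filt.Rees\<^esub> n = \<one>\<^bsub>UP D\<^esub> n" for n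
    using res_eq_zero_iff[OF zero_symbolic_power(1), of n] zero_symbolic_power(1)
    by (cases n) (simp_all add: residues_def UP_one D_ops, simp_all add: res_def quot_0)
  then show "residues \<one>\<^bsub>filt.Rees\<^esub> = \<one>\<^bsub>UP D\<^esub>" by (rule ext)
qed

sublocale residues: ring_hom_cring filt.Rees "UP D" residues by (rule residues_hom)

lemma residues_eq_zero_iff:
  assumes "f \<in> filt.rees_carrier"
  shows "residues f = \<zero>\<^bsub>UP D\<^esub> \<longleftrightarrow> filt.initial_forms f = \<zero>\<^bsub>filt.G\<^esub>"
  using res_eq_zero_iff[OF filt.rees_memD(3)[OF assms]] filt.initial_forms_eq_zero_iff[OF assms]
  by (simp add: residues_def UP_zero D_ops fun_eq_iff)

text \<open>In each degree both maps kill exactly the next symbolic power. The graded ring is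
  thereby compared with the polynomials over \<open>D\<close> without inverting either map.\<close>

lemma kernels_eq: "a_kernel filt.Rees (UP D) residues = a_kernel filt.Rees filt.G filt.initial_forms"
  unfolding a_kernel_def' using residues_eq_zero_iff by auto

lemma u_symbolic_1: "u \<in> J 1" using symbolic_power_1 u_mem by simp

lemma res_1_u: "res 1 u = \<one>\<^bsub>K\<^esub>"
  using res_u[of \<one> 0] carrier_eq_symbolic_power_0 u_closed by (simp add: res_def quot_0)

lemma residues_u: "residues (filt.single u 1) = up_ring.monom (UP D) \<one>\<^bsub>D\<^esub> 1"
proof -
  have "residues (filt.single u 1) n = up_ring.monom (UP D) \<one>\<^bsub>D\<^esub> 1 n" for n
    unfolding UP_monom[OF UD.R.one_closed]
    using res_1_u res_eq_zero_iff[OF zero_symbolic_power(1), of n] zero_symbolic_power(1)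
    by (simp add: residues_def filt.single_def D_ops)
  then show ?thesis by (intro ext)
qed

text \<open>Each coefficient of d comes from some degree \<open>j n\<close>, possibly larger than n.
  Multiplication by X^k moves it to degree n + k, where it has a representative as soon as k is at
  least \<open>j n\<close>; the finite support of d allows one k for all.\<close>

lemma residues_surj_up_to_powers:
  assumes d: "d \<in> carrier (UP D)"
  shows "\<exists>k::nat. \<exists>f\<in>carrier filt.Rees.
    residues (filt.single u 1) [^]\<^bsub>UP D\<^esub> k \<otimes>\<^bsub>UP D\<^esub> d = residues f"
proof -
  have dD: "d n \<in> carrier D" "finite {n. d n \<noteq> \<zero>\<^bsub>D\<^esub>}" for n
    using d by (auto simp: carrier_UP up_iff_finite)
  have "\<exists>j y. y \<in> J j \<and> d n = res j y" for n using dD(1)[of n] unfolding carrier_D by blast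
  then obtain j y where y: "\<And>n. y n \<in> J (j n)" "\<And>n. d n = res (j n) (y n)" by metis
  \<comment> \<open>Any common bound of the \<open>j n\<close> on the support would do; the sum is
    one.\<close>
  define k where "k = (\<Sum>n\<in>{n. d n \<noteq> \<zero>\<^bsub>D\<^esub>}. j n)"
  have jk: "j n \<le> k" if "d n \<noteq> \<zero>\<^bsub>D\<^esub>" for n
    unfolding k_def using dD(2) that by (intro member_le_sum) auto
  \<comment> \<open>Zero coefficients get the representative zero, so that the lifted family has
    finite support.\<close>
  have "\<exists>z\<in>J (n + k). res (n + k) z = d n \<and> (d n = \<zero>\<^bsub>D\<^esub> \<longrightarrow> z = \<zero>)" for n
  proof (cases "d n = \<zero>\<^bsub>D\<^esub>")
    case True
    then show ?thesis using zero_symbolic_power(1) res_eq_zero_iff[OF zero_symbolic_power(1)]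
      by (intro bexI[of _ \<zero>]) (auto simp: D_ops)
  next
    case False
    then show ?thesis using res_raise[OF y(1), of n "n + k - j n"] y(2)[of n] jk[OF False] by auto
  qed
  then obtain z where z: "\<And>n. z n \<in> J (n + k)" "\<And>n. res (n + k) (z n) = d n" "\<And>n. d n = \<zero>\<^bsub>D\<^esub> \<Longrightarrow> z n = \<zero>"
    by metis
  define f where "f i = (if i < k then \<zero> else z (i - k))" for i
  have f: "f \<in> filt.rees_carrier"
  proof (rule filt.rees_memI)
    show "f i \<in> J i" for i
      using z(1)[of "i - k"] zero_symbolic_power(1) by (cases "i < k") (simp_all add: f_def)
    have "{i. f i \<noteq> \<zero>} \<subseteq> (\<lambda>n. n + k) ` {n. d n \<noteq> \<zero>\<^bsub>D\<^esub>}"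
    proof
      fix i assume "i \<in> {i. f i \<noteq> \<zero>}"
      then have "i \<ge> k" "d (i - k) \<noteq> \<zero>\<^bsub>D\<^esub>" using z(3) by (auto simp: f_def split: if_splits)
      then show "i \<in> (\<lambda>n. n + k) ` {n. d n \<noteq> \<zero>\<^bsub>D\<^esub>}" by (intro image_eqI[of _ _ "i - k"]) auto
    qed
    then show "finite {i. f i \<noteq> \<zero>}" using dD(2) by (meson finite_imageI finite_subset)
  qed
  let ?X = "up_ring.monom (UP D) \<one>\<^bsub>D\<^esub>"
  have Xc: "?X k \<in> carrier (UP D)" by (rule UD.monom_closed[OF UD.R.one_closed])
  have p: "residues (filt.single u 1) [^]\<^bsub>UP D\<^esub> k = ?X k"
    unfolding residues_u by (rule UD.monom_pow[OF UD.R.one_closed, of 1 k, unfolded UD.R.nat_pow_one mult_1])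
  have c: "(?X k \<otimes>\<^bsub>UP D\<^esub> d) i = up_ring.coeff (UP D) (?X k \<otimes>\<^bsub>UP D\<^esub> d) i" for i
    using UP_coeff[OF UD.P.m_closed[OF Xc d]] by simp
  have "(?X k \<otimes>\<^bsub>UP D\<^esub> d) i = residues f i" for i
  proof (cases "i < k")
    case True
    have "up_ring.coeff (UP D) (?X k \<otimes>\<^bsub>UP D\<^esub> d) i
        = (\<Oplus>\<^bsub>D\<^esub>l\<in>{..i}. up_ring.coeff (UP D) (?X k) l \<otimes>\<^bsub>D\<^esub> up_ring.coeff (UP D) d (i - l))"
      by (rule UD.coeff_mult[OF Xc d])
    also have "\<dots> = (\<Oplus>\<^bsub>D\<^esub>l\<in>{..i}. \<zero>\<^bsub>D\<^esub>)"
    proof (rule UD.R.finsum_cong'[OF refl])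
      fix l assume "l \<in> {..i}"
      then have "up_ring.coeff (UP D) (?X k) l = \<zero>\<^bsub>D\<^esub>"
        using UD.coeff_monom[OF UD.R.one_closed, of k l] True by simp
      then show "up_ring.coeff (UP D) (?X k) l \<otimes>\<^bsub>D\<^esub> up_ring.coeff (UP D) d (i - l) = \<zero>\<^bsub>D\<^esub>"
        using UD.R.l_null[OF UD.coeff_closed[OF d]] by simp
    qed (rule funcsetI, rule UD.R.zero_closed)
    also have "\<dots> = \<zero>\<^bsub>D\<^esub>" by (rule UD.R.finsum_zero)
    also have "\<dots> = residues f i"
      using True res_eq_zero_iff[OF zero_symbolic_power(1), of i] zero_symbolic_power(1)[of "Suc i"]
      by (simp only: residues_def f_def D_ops if_True eq_True)
    finally show ?thesis using c[of i] by (rule trans[rotated])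
  next
    case False
    then have "i - k + k = i" by simp
    with UD.coeff_monom_mult[OF UD.R.one_closed d, of k "i - k"]
    have "(?X k \<otimes>\<^bsub>UP D\<^esub> d) i = \<one>\<^bsub>D\<^esub> \<otimes>\<^bsub>D\<^esub> up_ring.coeff (UP D) d (i - k)"
      by (simp only: c)
    also have "\<dots> = d (i - k)" unfolding UP_coeff[OF d] by (rule UD.R.l_one[OF dD(1)])
    also have "\<dots> = residues f i" using False z(2)[of "i - k"] by (simp add: residues_def f_def)
    finally show ?thesis .
  qed
  then have "residues (filt.single u 1) [^]\<^bsub>UP D\<^esub> k \<otimes>\<^bsub>UP D\<^esub> d = residues f"
    unfolding p by (rule ext)
  moreover have "f \<in> carrier filt.Rees" using f by simp
  ultimately show ?thesis by blast
qed

end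

text \<open>If a chain ends in a prime containing \<open>X\<close>, then its image under \<open>X \<mapsto> X + 1\<close> does not.\<close>

lemma (in UP_cring) prime_chain_avoiding_indeterminate:
  "(\<exists>Q. prime_chain P Q n \<and> mon \<one> 1 \<notin> Q n) \<longleftrightarrow> (\<exists>Q. prime_chain P Q n)"
proof
  let ?X = "mon \<one> 1"
  interpret c: UP_pre_univ_prop R P "\<lambda>a. mon a 0" P
    by (intro UP_pre_univ_prop.intro const_ring_hom_cring UP_cring_axioms) (rule P_def)
  have X: "?X \<in> carrier P" "?X \<oplus>\<^bsub>P\<^esub> \<one>\<^bsub>P\<^esub> \<in> carrier P" "?X \<ominus>\<^bsub>P\<^esub> \<one>\<^bsub>P\<^esub> \<in> carrier P"
    by simp_all
  define h where "h = UnivPoly.eval R P (\<lambda>a. mon a 0) (?X \<oplus>\<^bsub>P\<^esub> \<one>\<^bsub>P\<^esub>)"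
  interpret h: ring_hom_cring P P h
    unfolding h_def by (intro ring_hom_cringI P.is_cring c.eval_ring_hom X)
  have hX: "h ?X = ?X \<oplus>\<^bsub>P\<^esub> \<one>\<^bsub>P\<^esub>" unfolding h_def by (rule c.eval_monom1[OF X(2)])
  have hc: "h (mon a 0) = mon a 0" if "a \<in> carrier R" for a
    unfolding h_def by (rule c.eval_const[OF X(2) that])
  have "(?X \<oplus>\<^bsub>P\<^esub> \<one>\<^bsub>P\<^esub>) \<ominus>\<^bsub>P\<^esub> \<one>\<^bsub>P\<^esub> = ?X" using X(1) by algebra
  then have hX1: "h (?X \<ominus>\<^bsub>P\<^esub> \<one>\<^bsub>P\<^esub>) = ?X" using hX X(1) by (simp add: P.minus_eq)
  have surj: "\<exists>r\<in>carrier P. d = h r" if d: "d \<in> carrier P" for d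
  proof -
    \<comment> \<open>The preimage of the polynomial d is d(X - 1), assembled from its
      coefficients.\<close>
    let ?g = "\<lambda>i. mon (cf d i) 0 \<otimes>\<^bsub>P\<^esub> (?X \<ominus>\<^bsub>P\<^esub> \<one>\<^bsub>P\<^esub>) [^]\<^bsub>P\<^esub> i"
    have g: "?g i \<in> carrier P" for i
      using X(3) d by (intro P.m_closed P.nat_pow_closed monom_closed coeff_closed)
    have hg: "h (?g i) = mon (cf d i) i" for i
    proof -
      have "h (?g i) = h (mon (cf d i) 0) \<otimes>\<^bsub>P\<^esub> h ((?X \<ominus>\<^bsub>P\<^esub> \<one>\<^bsub>P\<^esub>) [^]\<^bsub>P\<^esub> i)"
        by (rule h.hom_mult[OF monom_closed[OF coeff_closed[OF d]] P.nat_pow_closed[OF X(3)]])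
      also have "\<dots> = mon (cf d i) 0 \<otimes>\<^bsub>P\<^esub> ?X [^]\<^bsub>P\<^esub> i"
        unfolding hc[OF coeff_closed[OF d]] h.hom_pow[OF X(3)] hX1 ..
      also have "?X [^]\<^bsub>P\<^esub> i = mon \<one> i" using monom_pow[OF R.one_closed, of 1 i] by simp
      also have "mon (cf d i) 0 \<otimes>\<^bsub>P\<^esub> mon \<one> i = mon (cf d i) i"
        using monom_mult[of "cf d i" \<one> 0 i] d by simp
      finally show ?thesis .
    qed
    have "h (\<Oplus>\<^bsub>P\<^esub>i\<in>{..deg R d}. ?g i) = (\<Oplus>\<^bsub>P\<^esub>i\<in>{..deg R d}. h (?g i))"
      using h.hom_finsum[of ?g "{..deg R d}"] g by (simp only: comp_def Pi_I)
    also have "\<dots> = d" unfolding hg by (rule up_repr[OF d])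
    finally have "d = h (\<Oplus>\<^bsub>P\<^esub>i\<in>{..deg R d}. ?g i)" ..
    moreover have "(\<Oplus>\<^bsub>P\<^esub>i\<in>{..deg R d}. ?g i) \<in> carrier P" by (rule P.finsum_closed[OF Pi_I[OF g]])
    ultimately show ?thesis by blast
  qed
  assume "\<exists>Q. prime_chain P Q n"
  then obtain Q where Q: "prime_chain P Q n" by blast
  show "\<exists>Q. prime_chain P Q n \<and> ?X \<notin> Q n"
  proof (cases "?X \<in> Q n")
    case True
    have pr: "primeideal (Q n) P" using Q by (simp add: prime_chain_def)
    \<comment> \<open>The prime \<open>Q n\<close> contains X and would otherwise contain X + 1,
      hence 1. Pulling the chain back along \<open>h\<close> turns this into avoidance of X.\<close>
    have "h ?X \<notin> Q n"
    proof
      assume "h ?X \<in> Q n"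
      then have "\<one>\<^bsub>P\<^esub> \<in> Q n"
        using P.ideal_mem_cancel[OF primeideal.axioms(1)[OF pr] _ True, of "\<one>\<^bsub>P\<^esub>"] hX by simp
      then show False using P.prime_one_notin[OF pr] by simp
    qed
    moreover have "\<exists>k::nat. \<exists>r\<in>carrier P. h ?X [^]\<^bsub>P\<^esub> k \<otimes>\<^bsub>P\<^esub> d = h r" if "d \<in> carrier P" for d
      using surj[OF that] that by (intro exI[of _ 0]) simp
    from h.prime_chain_correspondence[OF X(1) this, of n]
    have "(\<exists>Q. prime_chain P Q n \<and> h ?X \<notin> Q n) \<Longrightarrow> \<exists>Q. prime_chain P Q n \<and> ?X \<notin> Q n" by blast
    ultimately show ?thesis using Q by blast
  qed (use Q in blast)
qed blast

lemma (in ring) a_kernel_coset: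
  assumes "ideal I R"
  shows "a_kernel R (R Quot I) ((+>) I) = I"
proof -
  have "x \<in> carrier R \<and> I +> x = I \<longleftrightarrow> x \<in> I" for x
    using a_rcos_zero[OF assms] ideal.rcos_const_imp_mem[OF assms] ideal.Icarr[OF assms] by blast
  then show ?thesis unfolding a_kernel_def' by (simp add: FactRing_def)
qed

lemma (in ring) carrier_Quot_subset: "carrier (R Quot I) \<subseteq> (+>) I ` carrier R"
  by (auto simp: FactRing_def A_RCOSETS_def')

section \<open>The dimensions of the graded ring, of its quotient by \<open>v\<close> and of its
  localization at \<open>v\<close>\<close>

context uniformized_prime
begin

abbreviation "G \<equiv> filt.G"
abbreviation "B \<equiv> R Quot p"
abbreviation "v \<equiv> filt.initial_forms (filt.single u 1)"
abbreviation "const_form a \<equiv> filt.initial_forms (filt.single a 0)"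

lemma single_u: "filt.single u 1 \<in> carrier filt.Rees"
  using filt.single_rees[OF u_symbolic_1] by simp

lemma v_closed: "v \<in> carrier G"
  using filt.forms.hom_closed[OF single_u] .

text \<open>Vanishing in \<open>G\<close> can be tested on the residues of a lift to the Rees ring,
  and these lie in a polynomial ring over a domain.\<close>

lemma domain_G: "domain G"
proof (rule domain.intro[OF filt.G.is_cring], unfold_locales)
  have z: "filt.initial_forms f = \<zero>\<^bsub>G\<^esub> \<longleftrightarrow> residues f = \<zero>\<^bsub>UP D\<^esub>" if "f \<in> carrier filt.Rees" for f
    using residues_eq_zero_iff that by simp
  show "\<one>\<^bsub>G\<^esub> \<noteq> \<zero>\<^bsub>G\<^esub>"
    using z[OF filt.Rees.one_closed] filt.forms.hom_one residues.hom_one UD.UP_one_not_zero by simp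
  fix a b assume h: "a \<otimes>\<^bsub>G\<^esub> b = \<zero>\<^bsub>G\<^esub>" "a \<in> carrier G" "b \<in> carrier G"
  obtain f g where f: "f \<in> carrier filt.Rees" "a = filt.initial_forms f"
    and g: "g \<in> carrier filt.Rees" "b = filt.initial_forms g"
    using h(2,3) filt.initial_forms_surj by blast
  have "filt.initial_forms (f \<otimes>\<^bsub>filt.Rees\<^esub> g) = \<zero>\<^bsub>G\<^esub>"
    using h(1) filt.forms.hom_mult[OF f(1) g(1)] f(2) g(2) by simp
  then have "residues f \<otimes>\<^bsub>UP D\<^esub> residues g = \<zero>\<^bsub>UP D\<^esub>"
    using z[OF filt.Rees.m_closed[OF f(1) g(1)]] residues.hom_mult[OF f(1) g(1)] by simp
  then show "a = \<zero>\<^bsub>G\<^esub> \<or> b = \<zero>\<^bsub>G\<^esub>"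
    using UD.UP_integral[OF _ residues.hom_closed[OF f(1)] residues.hom_closed[OF g(1)]]
      z[OF f(1)] z[OF g(1)] f(2) g(2) by blast
qed

lemma v_nonzero: "v \<noteq> \<zero>\<^bsub>G\<^esub>"
proof
  assume "v = \<zero>\<^bsub>G\<^esub>"
  then have "filt.single u 1 1 \<in> J (Suc 1)"
    using filt.initial_forms_eq_zero_iff[of "filt.single u 1"] single_u by simp
  then have "u \<in> J (Suc 1)" by (simp add: filt.single_def)
  then have "res 1 u = \<zero>\<^bsub>K\<^esub>" using res_eq_zero_iff[OF u_symbolic_1] by simp
  then show False using res_1_u by simp
qed

lemma domain_B: "domain B"
  by (rule primeideal.quotient_is_domain[OF prime])

lemma coset_p_hom: "ring_hom_cring R B ((+>) p)"
  by (rule primeideal.rcos_ring_hom_cring[OF prime])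

lemma initial_forms_0: "filt.initial_forms f 0 = p +> f 0"
  using symbolic_power_1 by (simp add: filt.initial_forms_def)

lemma degree_0_hom: "ring_hom_cring G B (\<lambda>g. g 0)"
proof (intro ring_hom_cringI filt.G.is_cring domain.axioms(1)[OF domain_B] ring_hom_memI)
  interpret q: ring_hom_cring R B "(+>) p" by (rule coset_p_hom)
  fix a assume "a \<in> carrier G"
  then obtain f where f: "f \<in> filt.rees_carrier" "a = filt.initial_forms f"
    unfolding filt.initial_forms_surj[symmetric] by auto
  note fm = filt.rees_memD[OF f(1)]
  show "a 0 \<in> carrier B" unfolding f(2) initial_forms_0 by (rule q.hom_closed[OF fm(4)])
  fix b assume "b \<in> carrier G"
  then obtain g where g: "g \<in> filt.rees_carrier" "b = filt.initial_forms g"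
    unfolding filt.initial_forms_surj[symmetric] by auto
  note gm = filt.rees_memD[OF g(1)]
  have "a \<otimes>\<^bsub>G\<^esub> b = filt.initial_forms (f \<otimes>\<^bsub>filt.Rees\<^esub> g)" "a \<oplus>\<^bsub>G\<^esub> b = filt.initial_forms (f \<oplus>\<^bsub>filt.Rees\<^esub> g)"
    unfolding f(2) g(2) using f(1) g(1) filt.forms.hom_mult[of f g] filt.forms.hom_add[of f g] by simp_all
  moreover have "(f \<otimes>\<^bsub>filt.Rees\<^esub> g) 0 = f 0 \<otimes> g 0" "(f \<oplus>\<^bsub>filt.Rees\<^esub> g) 0 = f 0 \<oplus> g 0"
    using fm(4)[of 0] gm(4)[of 0] mult_UP[OF fm(2) gm(2)] add_UP[OF fm(2) gm(2)] by simp_all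
  ultimately show "(a \<otimes>\<^bsub>G\<^esub> b) 0 = a 0 \<otimes>\<^bsub>B\<^esub> b 0" "(a \<oplus>\<^bsub>G\<^esub> b) 0 = a 0 \<oplus>\<^bsub>B\<^esub> b 0"
    using q.hom_mult[OF fm(4)[of 0] gm(4)[of 0]] q.hom_add[OF fm(4)[of 0] gm(4)[of 0]]
    by (simp_all only: f(2) g(2) initial_forms_0)
next
  interpret q: ring_hom_cring R B "(+>) p" by (rule coset_p_hom)
  have "\<one>\<^bsub>G\<^esub> 0 = filt.initial_forms \<one>\<^bsub>filt.Rees\<^esub> 0" using filt.forms.hom_one by simp
  also have "\<dots> = p +> \<one>" unfolding initial_forms_0 by (simp add: UP_one)
  finally show "\<one>\<^bsub>G\<^esub> 0 = \<one>\<^bsub>B\<^esub>" using q.hom_one by simp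
qed

lemma v_in_kernel: "v \<in> a_kernel G B (\<lambda>g. g 0)"
proof -
  have "v 0 = p" unfolding initial_forms_0
    using a_rcos_zero[OF primeideal.axioms(1)[OF prime] p_closed(1)] by (simp add: filt.single_def)
  then show ?thesis using v_closed unfolding a_kernel_def' by (simp add: FactRing_def)
qed

lemma single_0: "a \<in> carrier R \<Longrightarrow> filt.single a 0 \<in> carrier filt.Rees"
  using filt.single_rees[of a 0] carrier_eq_symbolic_power_0 by simp

text \<open>The forms of degree 0 are the image of \<open>R\<close> under a map with kernel
  \<open>p\<close>, so they are a copy of \<open>B\<close> inside \<open>G\<close>. Taking
  \<open>R\<close> as the source avoids choosing representatives of cosets.\<close>

lemma const_form_hom: "ring_hom_cring R G (\<lambda>a. const_form a)"
proof (intro ring_hom_cringI is_cring filt.G.is_cring ring_hom_memI)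
  fix a assume a: "a \<in> carrier R"
  show "const_form a \<in> carrier G" using filt.forms.hom_closed[OF single_0[OF a]] .
  fix b assume b: "b \<in> carrier R"
  show "const_form (a \<otimes> b) = const_form a \<otimes>\<^bsub>G\<^esub> const_form b"
    using filt.forms.hom_mult[OF single_0[OF a] single_0[OF b]] filt.single_mult[OF a b, of 0 0] by simp
  have "filt.single a 0 \<in> up R" "filt.single b 0 \<in> up R"
    using filt.rees_memD(2) single_0[OF a] single_0[OF b] by simp_all
  from add_UP[OF this] have "filt.single a 0 \<oplus>\<^bsub>filt.Rees\<^esub> filt.single b 0 = filt.single (a \<oplus> b) 0"
    by (simp add: filt.single_def fun_eq_iff)
  then show "const_form (a \<oplus> b) = const_form a \<oplus>\<^bsub>G\<^esub> const_form b"
    using filt.forms.hom_add[OF single_0[OF a] single_0[OF b]] by simp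
next
  have "filt.single \<one> 0 = \<one>\<^bsub>filt.Rees\<^esub>" by (simp add: filt.single_def UP_one)
  then show "const_form \<one> = \<one>\<^bsub>G\<^esub>" using filt.forms.hom_one by simp
qed

lemma const_form_eq_zero_iff:
  assumes "a \<in> carrier R"
  shows "const_form a = \<zero>\<^bsub>G\<^esub> \<longleftrightarrow> a \<in> p"
proof -
  have "(\<forall>n. filt.single a 0 n \<in> J (Suc n)) \<longleftrightarrow> a \<in> J (Suc 0)"
    using zero_symbolic_power(1) by (auto simp: filt.single_def dest: spec[of _ 0])
  then show ?thesis
    using filt.initial_forms_eq_zero_iff[of "filt.single a 0"] single_0[OF assms] symbolic_power_1 by simp
qed

lemma prime_chain_B: "(\<exists>P. prime_chain B P n) \<longleftrightarrow> (\<exists>P. prime_chain R P n \<and> p \<subseteq> P 0)"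
proof -
  interpret q: ring_hom_cring R B "(+>) p" by (rule coset_p_hom)
  have i: "ideal p R" by (rule primeideal.axioms(1)[OF prime])
  show ?thesis
    using q.prime_chain_surj[OF carrier_Quot_subset, of n] unfolding a_kernel_coset[OF i] .
qed

text \<open>A chain of the subring of constants pulls back to a chain of \<open>R\<close> above the
  kernel, thus above \<open>p\<close>, and the latter descends to \<open>B\<close>.\<close>

lemma krull_dim_constants:
  "krull_dim (G\<lparr>carrier := (\<lambda>a. const_form a) ` carrier R\<rparr>) \<le> krull_dim B"
proof (rule krull_dim_mono)
  let ?C = "G\<lparr>carrier := (\<lambda>a. const_form a) ` carrier R\<rparr>"
  interpret k: ring_hom_cring R G "\<lambda>a. const_form a" by (rule const_form_hom)
  interpret k': ring_hom_cring R ?C "\<lambda>a. const_form a"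
    using k.image_subring_hom(2)[OF carrier_is_subring] by simp
  fix n P assume P: "prime_chain ?C P n"
  have "carrier ?C \<subseteq> (\<lambda>a. const_form a) ` carrier R" by simp
  from k'.prime_chain_surj[OF this] P
  obtain Q where Q: "prime_chain R Q n" "a_kernel R ?C (\<lambda>a. const_form a) \<subseteq> Q 0"
    by blast
  have "p \<subseteq> a_kernel R ?C (\<lambda>a. const_form a)"
  proof
    fix a assume a: "a \<in> p"
    then show "a \<in> a_kernel R ?C (\<lambda>a. const_form a)"
      using const_form_eq_zero_iff[of a] p_closed(2)[OF a] unfolding a_kernel_def' by simp
  qed
  then have "p \<subseteq> Q 0" using Q(2) by (rule order_trans)
  then show "\<exists>Q. prime_chain B Q n" using prime_chain_B Q(1) by blast
qed

text \<open>The invariant of the successive adjunctions. Constants and \<open>v\<close> are included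
  because the relation satisfied by a form has its coefficients among constants times powers of
  \<open>v\<close>.\<close>

definition admissible :: "(nat \<Rightarrow> 'a set) set \<Rightarrow> bool" where
  "admissible S \<longleftrightarrow> subring S G \<and> noetherian_ring (G\<lparr>carrier := S\<rparr>) \<and>
     krull_dim (G\<lparr>carrier := S\<rparr>) \<le> krull_dim B + 1 \<and> (\<lambda>a. const_form a) ` carrier R \<subseteq> S \<and> v \<in> S"

text \<open>The one dimension allowed beyond \<open>B\<close> is spent here, on adjoining
  \<open>v\<close> to the constants.\<close>

lemma exists_admissible:
  assumes "noetherian_ring R"
  shows "\<exists>S. admissible S"
proof -
  interpret k: ring_hom_cring R G "\<lambda>a. const_form a" by (rule const_form_hom)
  let ?S = "(\<lambda>a. const_form a) ` carrier R"
  have S: "subring ?S G" using k.image_subring_hom(1)[OF carrier_is_subring] .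
  have N: "noetherian_ring (G\<lparr>carrier := ?S\<rparr>)"
    using k.image_subring_dim(1)[OF carrier_is_subring] assms by simp
  obtain S' where S': "subring S' G" "?S \<subseteq> S'" "v \<in> S'" "noetherian_ring (G\<lparr>carrier := S'\<rparr>)"
    "krull_dim (G\<lparr>carrier := S'\<rparr>) \<le> krull_dim (G\<lparr>carrier := ?S\<rparr>) + 1"
    by (rule filt.G.adjoin_element[OF S N v_closed])
  have "krull_dim (G\<lparr>carrier := S'\<rparr>) \<le> krull_dim B + 1"
    using S'(5) add_right_mono[OF krull_dim_constants] by (rule order_trans)
  then show ?thesis unfolding admissible_def using S'(1-4) by blast
qed

text \<open>A form of degree \<open>n\<close> lies in the fraction field of \<open>B[v]\<close>, so adjoining it does not raise the dimension.\<close>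

lemma admissible_adjoin_form:
  assumes S: "admissible S" and y: "y \<in> J n"
  shows "\<exists>S'. admissible S' \<and> S \<subseteq> S' \<and> filt.initial_forms (filt.single y n) \<in> S'"
proof -
  have S': "subring S G" "noetherian_ring (G\<lparr>carrier := S\<rparr>)"
    "krull_dim (G\<lparr>carrier := S\<rparr>) \<le> krull_dim B + 1" "(\<lambda>a. const_form a) ` carrier R \<subseteq> S" "v \<in> S"
    using S unfolding admissible_def by blast+
  let ?z = "filt.initial_forms (filt.single y n)"
  have yR: "filt.single y n \<in> carrier filt.Rees" "y \<in> carrier R"
    using filt.single_rees[OF y] symbolic_power_closed[OF y] by simp_all
  have z: "?z \<in> carrier G" using filt.forms.hom_closed[OF yR(1)] .
  \<comment> \<open>Read in degree n, this equation says that the constant s times the form of y is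
    the constant c times v^n. As s lies outside \<open>p\<close>, its constant form is
    nonzero.\<close>
  obtain s c where s: "s \<in> carrier R" "s \<notin> p" "c \<in> carrier R" "s \<otimes> y = c \<otimes> u [^] n"
    using y symbolic_power_iff by blast
  have un: "u [^] n \<in> J n" "u [^] n \<in> carrier R"
    using u_closed prime_one_notin[OF prime] by (auto simp: symbolic_power_iff intro!: bexI[of _ \<one>])
  have "const_form s \<otimes>\<^bsub>G\<^esub> ?z = filt.initial_forms (filt.single s 0 \<otimes>\<^bsub>filt.Rees\<^esub> filt.single y n)"
    by (rule filt.forms.hom_mult[OF single_0[OF s(1)] yR(1), symmetric])
  also have "\<dots> = filt.initial_forms (filt.single (s \<otimes> y) n)"
    unfolding filt.single_mult[OF s(1) yR(2)] by simp
  also have "\<dots> = filt.initial_forms (filt.single c 0 \<otimes>\<^bsub>filt.Rees\<^esub> filt.single (u [^] n) n)"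
    unfolding filt.single_mult[OF s(3) un(2)] s(4) by simp
  also have "\<dots> = const_form c \<otimes>\<^bsub>G\<^esub> filt.initial_forms (filt.single (u [^] n) n)"
    using filt.forms.hom_mult[OF single_0[OF s(3)]] filt.single_rees[OF un(1)] by simp
  also have "filt.initial_forms (filt.single (u [^] n) n) = v [^]\<^bsub>G\<^esub> n"
    using filt.forms.hom_pow[OF single_u, of n] filt.Rees_pow[of "filt.single u 1" n]
      filt.single_pow[OF u_closed, of 1 n] single_u by simp
  finally have e: "const_form s \<otimes>\<^bsub>G\<^esub> ?z = const_form c \<otimes>\<^bsub>G\<^esub> v [^]\<^bsub>G\<^esub> n" .
  have vp: "v [^]\<^bsub>G\<^esub> n \<in> S"
  proof (induction n)
    case 0
    then show ?case using subringE(3)[OF S'(1)] by (simp add: nat_pow_def)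
  next
    case (Suc n)
    then show ?case using subringE(6)[OF S'(1) _ S'(5)] by (simp add: nat_pow_def)
  qed
  have cs: "const_form c \<in> S" "const_form s \<in> S" using S'(4) s(1,3) by blast+
  have "const_form s \<noteq> \<zero>\<^bsub>G\<^esub>" using const_form_eq_zero_iff[OF s(1)] s(2) by simp
  then have "const_form s \<noteq> \<zero>\<^bsub>G\<^esub> \<and> const_form s \<otimes>\<^bsub>G\<^esub> ?z = const_form c \<otimes>\<^bsub>G\<^esub> v [^]\<^bsub>G\<^esub> n"
    using e by (rule conjI)
  then have ex: "\<exists>a\<in>S. \<exists>b\<in>S. a \<noteq> \<zero>\<^bsub>G\<^esub> \<and> a \<otimes>\<^bsub>G\<^esub> ?z = b"
    by - (rule bexI[OF bexI[where x = "const_form c \<otimes>\<^bsub>G\<^esub> v [^]\<^bsub>G\<^esub> n", OF _ subringE(6)[OF S'(1) cs(1) vp]] cs(2)])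
  obtain T where T: "subring T G" "S \<subseteq> T" "?z \<in> T" "noetherian_ring (G\<lparr>carrier := T\<rparr>)"
    and T': "domain G \<Longrightarrow> (\<exists>a\<in>S. \<exists>b\<in>S. a \<noteq> \<zero>\<^bsub>G\<^esub> \<and> a \<otimes>\<^bsub>G\<^esub> ?z = b) \<Longrightarrow>
      krull_dim (G\<lparr>carrier := T\<rparr>) \<le> krull_dim (G\<lparr>carrier := S\<rparr>)"
    by (rule filt.G.adjoin_element[OF S'(1,2) z], rule that) simp_all
  have "krull_dim (G\<lparr>carrier := T\<rparr>) \<le> krull_dim B + 1"
    by (rule order_trans[OF T'[OF domain_G ex] S'(3)])
  then have "admissible T" unfolding admissible_def using S'(4,5) T(1,2,4) by blast
  then show ?thesis using T(2,3) by blast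
qed

text \<open>An element of the graded ring is a finite sum of forms; they are adjoined one at a time,
  in increasing degree.\<close>

lemma admissible_adjoin:
  assumes "admissible S" "f \<in> filt.rees_carrier" "\<And>k. k \<ge> N \<Longrightarrow> f k = \<zero>"
  shows "\<exists>S'. admissible S' \<and> S \<subseteq> S' \<and> filt.initial_forms f \<in> S'"
  using assms(2,3)
proof (induction N arbitrary: f)
  case 0
  then have "f = \<zero>\<^bsub>filt.Rees\<^esub>" by (simp add: UP_zero fun_eq_iff)
  then have "filt.initial_forms f = \<zero>\<^bsub>G\<^esub>" using filt.forms.hom_zero by simp
  moreover have "\<zero>\<^bsub>G\<^esub> \<in> S" using assms(1) subringE(2) unfolding admissible_def by blast
  ultimately show ?case using assms(1) by (intro exI[of _ S]) simp
next
  case (Suc N)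
  note fm = filt.rees_memD[OF Suc.prems(1)]
  define g where "g = f(N := \<zero>)"
  have g: "g \<in> filt.rees_carrier"
  proof (rule filt.rees_memI)
    show "g n \<in> J n" for n using fm(3) zero_symbolic_power(1) by (simp add: g_def)
    show "finite {n. g n \<noteq> \<zero>}" using fm(5) by (rule rev_finite_subset) (auto simp: g_def)
  qed
  have "g k = \<zero>" if "k \<ge> N" for k using Suc.prems(2)[of k] that by (simp add: g_def)
  from Suc.IH[OF g this] obtain S' where S': "admissible S'" "S \<subseteq> S'" "filt.initial_forms g \<in> S'" by blast
  obtain T where T: "admissible T" "S' \<subseteq> T" "filt.initial_forms (filt.single (f N) N) \<in> T"
    using admissible_adjoin_form[OF S'(1) fm(3)] by blast
  have s: "filt.single (f N) N \<in> filt.rees_carrier" by (rule filt.single_rees[OF fm(3)])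
  have "g \<oplus>\<^bsub>filt.Rees\<^esub> filt.single (f N) N = f"
    using add_UP[OF filt.rees_memD(2)[OF g] filt.rees_memD(2)[OF s]] fm(4)
    by (simp add: g_def filt.single_def fun_eq_iff)
  then have "filt.initial_forms f = filt.initial_forms g \<oplus>\<^bsub>G\<^esub> filt.initial_forms (filt.single (f N) N)"
    using filt.forms.hom_add[of g "filt.single (f N) N"] g s by simp
  also have "\<dots> \<in> T"
    by (rule subringE(7)[OF _ subsetD[OF T(2) S'(3)] T(3)]) (use T(1) in \<open>simp add: admissible_def\<close>)
  finally show ?case using T(1,2) S'(2) by blast
qed

lemma locally_noetherian_G:
  assumes "noetherian_ring R"
  shows "locally_noetherian_dim G (krull_dim B + 1)"
proof -
  have ex: "\<exists>S. admissible S \<and> F \<subseteq> S" if "finite F" "F \<subseteq> carrier G" for F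
    using that
  proof (induction F)
    case empty
    then show ?case using exists_admissible[OF assms] by simp
  next
    case (insert a F)
    then obtain S where S: "admissible S" "F \<subseteq> S" by auto
    obtain f where f: "f \<in> filt.rees_carrier" "a = filt.initial_forms f"
      using insert.prems unfolding filt.initial_forms_surj[symmetric] by auto
    obtain N where N: "\<forall>n\<in>{n. f n \<noteq> \<zero>}. n < N"
      using filt.rees_memD(5)[OF f(1)] unfolding finite_nat_set_iff_bounded by blast
    have "f k = \<zero>" if "k \<ge> N" for k using N that by force
    from admissible_adjoin[OF S(1) f(1) this] show ?case using S f by blast
  qed
  show ?thesis unfolding locally_noetherian_dim_def
  proof (intro allI impI)
    fix F assume "F \<subseteq> carrier G" "finite F"
    then obtain S where "admissible S" "F \<subseteq> S" using ex by blast
    then show "\<exists>S. subring S G \<and> F \<subseteq> S \<and> noetherian_ring (G\<lparr>carrier := S\<rparr>) \<and>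
        krull_dim (G\<lparr>carrier := S\<rparr>) \<le> krull_dim B + 1"
      unfolding admissible_def by (intro exI[of _ S]) simp
  qed
qed

text \<open>The chain is pulled back along the projection to degree 0, whose kernel contains
  \<open>v\<close>. Keeping \<open>v\<close> in the first prime serves twice: the zero ideal fits
  below it, and the chain passes to the quotient by \<open>v\<close>.\<close>

lemma prime_chain_G_above:
  assumes "prime_chain B P n"
  shows "\<exists>Q. prime_chain G Q n \<and> v \<in> Q 0"
proof -
  interpret e: ring_hom_cring G B "\<lambda>g. g 0" by (rule degree_0_hom)
  have "carrier B \<subseteq> (\<lambda>g. g 0) ` carrier G"
  proof
    fix b assume "b \<in> carrier B"
    then obtain a where a: "a \<in> carrier R" "b = p +> a" by (auto simp: FactRing_def A_RCOSETS_def')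
    then have "b = const_form a 0" unfolding initial_forms_0 by (simp add: filt.single_def)
    moreover have "const_form a \<in> carrier G" using filt.forms.hom_closed[OF single_0[OF a(1)]] .
    ultimately show "b \<in> (\<lambda>g. g 0) ` carrier G" by (rule image_eqI)
  qed
  from e.prime_chain_surj[OF this] assms
  obtain Q where "prime_chain G Q n" "a_kernel G B (\<lambda>g. g 0) \<subseteq> Q 0" by blast
  then show ?thesis using v_in_kernel by blast
qed

lemma prime_chain_Cons_zero:
  assumes "prime_chain G Q n" "v \<in> Q 0"
  shows "\<exists>Q. prime_chain G Q (Suc n)"
proof -
  have "ideal (Q 0) G" using assms(1) primeideal.axioms(1) by (auto simp: prime_chain_def)
  then have "{\<zero>\<^bsub>G\<^esub>} \<subset> Q 0" using v_nonzero assms(2) filt.G.ideal_closed(1) by blast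
  then show ?thesis using prime_chain_Cons[OF assms(1) domain.zeroprimeideal[OF domain_G]] by blast
qed

lemma krull_dim_G:
  assumes "noetherian_ring R"
  shows "krull_dim G = krull_dim B + 1"
proof (rule antisym)
  show "krull_dim G \<le> krull_dim B + 1"
    by (rule filt.G.locally_noetherian_krull_dim[OF locally_noetherian_G[OF assms]])
  show "krull_dim B + 1 \<le> krull_dim G"
  proof (rule krull_dim_Suc_le[OF domain.prime_chain_zero[OF domain_B]])
    fix n P assume "prime_chain B P n"
    then show "\<exists>Q. prime_chain G Q (Suc n)" using prime_chain_G_above prime_chain_Cons_zero by blast
  qed
qed

text \<open>Chains of the quotient lift to chains of \<open>G\<close> whose primes contain
  \<open>v\<close>, below which the zero ideal fits, so the dimension drops by at least one. Chains
  of \<open>B\<close>, pulled back to \<open>G\<close>, contain \<open>v\<close> and descend to the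
  quotient; so it drops by no more.\<close>

lemma krull_dim_G_Quot:
  assumes "noetherian_ring R"
  shows "krull_dim (G Quot (PIdl\<^bsub>G\<^esub> v)) = krull_dim B"
proof -
  let ?I = "PIdl\<^bsub>G\<^esub> v"
  have I: "ideal ?I G" by (rule filt.G.cgenideal_ideal[OF v_closed])
  interpret q: ring_hom_cring G "G Quot ?I" "(+>\<^bsub>G\<^esub>) ?I"
    by (rule ideal.rcos_ring_hom_cring[OF I filt.G.is_cring])
  have corr: "(\<exists>P. prime_chain (G Quot ?I) P n) \<longleftrightarrow> (\<exists>P. prime_chain G P n \<and> ?I \<subseteq> P 0)" for n
    using q.prime_chain_surj[OF filt.G.carrier_Quot_subset, of n] unfolding filt.G.a_kernel_coset[OF I] .
  have vI: "v \<in> ?I" by (rule filt.G.cgenideal_self[OF v_closed])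
  have ge: "\<exists>Q. prime_chain (G Quot ?I) Q n" if P: "prime_chain B P n" for P n
  proof -
    obtain Q where Q: "prime_chain G Q n" "v \<in> Q 0" using prime_chain_G_above[OF P] by blast
    then have "ideal (Q 0) G" using primeideal.axioms(1) by (auto simp: prime_chain_def)
    then have "?I \<subseteq> Q 0" using Q(2) by (rule filt.G.cgenideal_minimal)
    then show ?thesis using corr Q(1) by blast
  qed
  \<comment> \<open>This shows the quotient to be nonzero, which the comparison of dimensions
    requires.\<close>
  obtain P0 where P0: "prime_chain (G Quot ?I) P0 0" using ge[OF domain.prime_chain_zero[OF domain_B]] by blast
  have "krull_dim (G Quot ?I) + 1 \<le> krull_dim G"
  proof (rule krull_dim_Suc_le[OF P0])
    fix n P assume "prime_chain (G Quot ?I) P n"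
    then obtain Q where "prime_chain G Q n" "?I \<subseteq> Q 0" using corr by blast
    then show "\<exists>Q. prime_chain G Q (Suc n)" using prime_chain_Cons_zero vI by blast
  qed
  then have "krull_dim (G Quot ?I) + 1 \<le> krull_dim B + 1" unfolding krull_dim_G[OF assms] .
  then have "krull_dim (G Quot ?I) \<le> krull_dim B"
    by (cases "krull_dim (G Quot ?I)"; cases "krull_dim B") (simp_all add: one_enat_def)
  moreover have "krull_dim B \<le> krull_dim (G Quot ?I)" by (rule krull_dim_mono[OF ge])
  ultimately show ?thesis by (rule antisym)
qed

text \<open>Both rings are compared through the Rees ring: by \<open>kernels_eq\<close> the same
  chains there account for the primes of \<open>G\<close> avoiding \<open>v\<close> and for the
  primes of the polynomial ring over \<open>D\<close> avoiding the indeterminate.\<close>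

lemma krull_dim_G_localization:
  "krull_dim (localization G (powers G v)) = krull_dim (UP D)"
proof -
  have eq: "(\<exists>P. prime_chain (localization G (powers G v)) P n) \<longleftrightarrow> (\<exists>P. prime_chain (UP D) P n)" for n
  proof -
    have surj: "\<exists>k::nat. \<exists>r\<in>carrier filt.Rees. v [^]\<^bsub>G\<^esub> k \<otimes>\<^bsub>G\<^esub> d = filt.initial_forms r" if d: "d \<in> carrier G" for d
    proof -
      have "v [^]\<^bsub>G\<^esub> (0::nat) \<otimes>\<^bsub>G\<^esub> d = d" using d by simp
      moreover obtain r where "r \<in> carrier filt.Rees" "d = filt.initial_forms r"
        using d unfolding filt.initial_forms_surj[symmetric] by blast
      ultimately show ?thesis by metis
    qed
    have G: "(\<exists>P. prime_chain G P n \<and> v \<notin> P n) \<longleftrightarrow>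
        (\<exists>P. prime_chain filt.Rees P n \<and> a_kernel filt.Rees G filt.initial_forms \<subseteq> P 0 \<and> filt.single u 1 \<notin> P n)"
      by (rule filt.forms.prime_chain_correspondence[OF single_u]) (rule surj)
    have D: "(\<exists>P. prime_chain (UP D) P n \<and> residues (filt.single u 1) \<notin> P n) \<longleftrightarrow>
        (\<exists>P. prime_chain filt.Rees P n \<and> a_kernel filt.Rees (UP D) residues \<subseteq> P 0 \<and> filt.single u 1 \<notin> P n)"
      by (rule residues.prime_chain_correspondence[OF single_u]) (rule residues_surj_up_to_powers)
    have "(\<exists>P. prime_chain (localization G (powers G v)) P n) \<longleftrightarrow> (\<exists>P. prime_chain G P n \<and> v \<notin> P n)"
      by (rule domain.prime_chain_localization_powers[OF domain_G v_closed v_nonzero])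
    also have "\<dots> \<longleftrightarrow> (\<exists>P. prime_chain (UP D) P n \<and> residues (filt.single u 1) \<notin> P n)"
      unfolding D kernels_eq by (rule G)
    also have "\<dots> \<longleftrightarrow> (\<exists>P. prime_chain (UP D) P n)"
      unfolding residues_u by (rule UD.prime_chain_avoiding_indeterminate)
    finally show ?thesis .
  qed
  show ?thesis
  proof (rule antisym)
    show "krull_dim (localization G (powers G v)) \<le> krull_dim (UP D)"
      by (rule krull_dim_mono) (use eq in blast)
    show "krull_dim (UP D) \<le> krull_dim (localization G (powers G v))"
      by (rule krull_dim_mono) (use eq in blast)
  qed
qed

end

text \<open>If u were zero, the extended prime and hence \<open>p\<close> itself would vanish. Every
  nonzero fraction a/s would then have the inverse s/a, and the localization would be a
  field.\<close>

lemma uniformizer_nonzero: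
  fixes R (structure)
  assumes "domain R" and p: "primeideal p R" and "u \<in> p" and dvr: "\<not> field (loc_at_prime R p)"
    and ext: "extend_at_prime R p p = PIdl\<^bsub>loc_at_prime R p\<^esub> (to_loc_at_prime R p u)"
  shows "u \<noteq> \<zero>"
proof
  assume u: "u = \<zero>"
  interpret "domain" R by fact
  note pc = ideal_closed[OF primeideal.axioms(1)[OF p]]
  interpret loc: domain_localization R "carrier R - p"
    using prime_one_notin[OF p] pc(1) prime_mult_notin[OF p] by unfold_locales auto
  have emb: "to_loc_at_prime R p = loc.emb"
    by (simp add: to_loc_at_prime_def loc.emb_def fun_eq_iff)
  have L: "loc_at_prime R p = loc.L" by (simp add: loc_at_prime_def)
  have M: "extend_at_prime R p p = {\<zero>\<^bsub>loc.L\<^esub>}"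
    unfolding ext emb L u cgenideal_def 
    using loc.L.zero_closed by (auto intro!: exI[of _ "\<zero>\<^bsub>loc.L\<^esub>"])
  have p0: "a = \<zero>" if a: "a \<in> p" for a
  proof -
    have "loc.emb ` p \<subseteq> carrier loc.L" using pc(2) by auto
    then have "loc.emb a \<in> extend_at_prime R p p"
      unfolding extend_at_prime_def emb L using loc.L.genideal_self a by blast
    then have "loc.emb a = loc.emb \<zero>" unfolding M by simp
    then show ?thesis by (rule iffD1[OF loc.emb_eq_iff, rotated 2]) (use a pc(2) in auto)
  qed
  have "field loc.L"
  proof (rule loc.L.cring_fieldI2)
    show "\<zero>\<^bsub>loc.L\<^esub> \<noteq> \<one>\<^bsub>loc.L\<^esub>" by simp
    fix x assume x: "x \<in> carrier loc.L" "x \<noteq> \<zero>\<^bsub>loc.L\<^esub>"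
    obtain a s where a: "a \<in> carrier R" "s \<in> carrier R - p" "x = loc.fraction a s" using loc.L_cases[OF x(1)] .
    have "a \<noteq> \<zero>" using x(2) loc.frac_eq_zero[OF a(1,2)] a(3) by simp
    then have ap: "a \<in> carrier R - p" using p0 a by blast
    have "x \<otimes>\<^bsub>loc.L\<^esub> loc.fraction s a = \<one>\<^bsub>loc.L\<^esub>"
      unfolding a(3) loc.one_L
      using a(1,2) ap loc.S_mult[OF a(2) ap] loc.S_one
      by (subst loc.mult_L) (auto simp: loc.frac_eq_iff m_comm)
    then show "\<exists>y\<in>carrier loc.L. x \<otimes>\<^bsub>loc.L\<^esub> y = \<one>\<^bsub>loc.L\<^esub>"
      using loc.frac_closed[of s a] a(2) ap by blast
  qed
  then show False using dvr unfolding L by simp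
qed

theorem theorem4p2:
  fixes A :: "('a, 'm) ring_scheme" and p :: "'a set" and u :: 'a
    and G :: "(nat \<Rightarrow> 'a set) ring" and v :: "nat \<Rightarrow> 'a set"
  assumes "noetherian_domain A"
    and "primeideal p A"
    and "dvr (loc_at_prime A p)"
    and "u \<in> p"
    and "extend_at_prime A p p = PIdl\<^bsub>loc_at_prime A p\<^esub> (to_loc_at_prime A p u)"
  defines "G \<equiv> symbolic_graded A p"
    and "v \<equiv> homogeneous_form A (symbolic_power A p) 1 u"
  shows "(domain G \<and> krull_dim G = 1 + krull_dim (A Quot p) \<and>
           (krull_dim (A Quot p) < \<infinity> \<longrightarrow> jaffard_domain G)) \<and>
         (krull_dim (G Quot (PIdl\<^bsub>G\<^esub> v)) = krull_dim (A Quot p) \<and>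
           krull_dim (localization G (powers G v)) = krull_dim (UP (D_ring A p u)))"
proof -
  have A: "noetherian_ring A" "domain A" using assms(1) by (auto simp: noetherian_domain_def)
  have "u \<noteq> \<zero>\<^bsub>A\<^esub>"
    using uniformizer_nonzero[OF A(2) assms(2,4) _ assms(5)] assms(3) by (simp add: dvr_def)
  then interpret up: uniformized_prime A p u
    using A(2) assms(2,4,5) by (simp add: uniformized_prime_def uniformized_prime_axioms_def)
  have G: "G = up.G" by (simp add: G_def symbolic_graded_def)
  have v: "v = up.v" by (simp add: v_def up.filt.initial_forms_single)
  have dim: "krull_dim G = 1 + krull_dim (A Quot p)"
    using up.krull_dim_G[OF A(1)] by (simp add: G add.commute)
  have "jaffard_domain G" if fin: "krull_dim (A Quot p) < \<infinity>"
  proof (rule domain.jaffard_domainI)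
    show "domain G" unfolding G by (rule up.domain_G)
    show "locally_noetherian_dim G (krull_dim G)"
      using up.locally_noetherian_G[OF A(1)] up.krull_dim_G[OF A(1)] unfolding G by simp
    show "krull_dim G < \<infinity>"
      unfolding dim using fin by (cases "krull_dim (A Quot p)") (simp_all add: one_enat_def)
  qed
  then show ?thesis
    using dim up.domain_G up.krull_dim_G_Quot[OF A(1)] up.krull_dim_G_localization
    unfolding G v by simp
qed

end
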